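(* Let $(X,d)$ be a locally compact, separable, proper ultrametric space, let $m$ be a Radon measure on $X$ such that $m(B)>0$ for each ball $B$ of positive diameter and $m(\{x\})=0$ if and only if $x$ is a non-isolated point, and let $C:\mathcal B\to(0,\infty)$ be a choice function. For any $1\le q<\infty$, the operator $(L_C,\mathcal D)$ acting in $L^q=L^q(X,m)$ admits a closed extension $L_C^q$. The closed operator $-L_C^q$ coincides with the infinitesimal generator of a Markov semigroup acting in $L^q$. Moreover, for all $1\le q<\infty$, $$\mathsf{Spec}(L_C^q)=\mathsf{Spec}(L_C^2)=\overline{\{\lambda(B):B\in\mathcal B\}}\cup\{0\}.$$
   Context: A metric is proper if all its closed balls are compact. Balls are sets $B_r(a)=\{x: d(x,a)<r\}$, $r>0$; $\mathcal B$ is the set of all non-singleton balls. A choice function is a function $C:\mathcal B\to(0,\infty)$ such that: (i) $\lambda(B):=\sum_{T\in\mathcal B:\,B\subseteq T}C(T)<\infty$ for every ball $B$; (ii) $\lim_{B\downarrow\{x\}}\lambda(B)=\infty$ (limit along balls $B\ni x$ shrinking to $\{x\}$) whenever $x$ is not an isolated point. $\mathcal D$ is the set of locally constant functions on $X$ with compact support, and the hierarchical Laplacian is $$L_Cf(x)=-\sum_{B\in\mathcal B:\,x\in B}C(B)\bigl(P_Bf-f(x)\bigr),\qquad f\in\mathcal D,\qquad P_Bf=\frac1{m(B)}\int_B f\,dm ;$$ it maps $\mathcal D$ into every $L^q$, $1\le q\le\infty$. In $L^2$ it is essentially self-adjoint and non-negative definite; $L_C$ also denotes its self-adjoint extension and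 $P_t=\exp(-tL_C)$. The semigroup $\{P_t\}$ is symmetric and Markovian, hence extends to a continuous contraction semigroup $\{P_t^q\}$ on $L^q$, $1\le q<\infty$. The closed extension $L_C^q$ in the statement is the operator such that $-L_C^q$ is the infinitesimal generator of $\{P_t^q\}$. *)

theory Defs
  imports "HOL-Analysis.Analysis"
begin

section \<open>The ultrametric measure space and the choice function\<close>

definition ultrametric_space :: "'a::metric_space itself \<Rightarrow> bool" where
  "ultrametric_space _ \<longleftrightarrow> (\<forall>x y z :: 'a. dist x z \<le> max (dist x y) (dist y z))"

definition proper_space :: "'a::metric_space itself \<Rightarrow> bool" where
  "proper_space _ \<longleftrightarrow> (\<forall>(a::'a) r. compact (cball a r))"

definition radon_measure :: "'a::metric_space measure \<Rightarrow> bool" where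
  "radon_measure m \<longleftrightarrow>
     sets m = sets borel \<and>
     (\<forall>K. compact K \<longrightarrow> emeasure m K < \<infinity>) \<and>
     (\<forall>A\<in>sets borel. emeasure m A = (SUP K\<in>{K. compact K \<and> K \<subseteq> A}. emeasure m K))"

definition all_balls :: "'a::metric_space set set" where
  "all_balls = {ball a r |a r. 0 < r}"

definition ns_balls :: "'a::metric_space set set" where
  "ns_balls = {B \<in> all_balls. \<not> is_singleton B}"

definition lam :: "('a::metric_space set \<Rightarrow> real) \<Rightarrow> 'a set \<Rightarrow> real" where
  "lam C B = (\<Sum>\<^sub>\<infinity>T\<in>{T \<in> ns_balls. B \<subseteq> T}. C T)"

text \<open>A choice function is only ever evaluated on \<^const>\<open>ns_balls\<close>; its values on
  other sets are irrelevant. A point is non-isolated iff it is a limit point of the space.\<close>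

definition choice_function :: "('a::metric_space set \<Rightarrow> real) \<Rightarrow> bool" where
  "choice_function C \<longleftrightarrow>
     (\<forall>B\<in>ns_balls. 0 < C B) \<and>
     (\<forall>B\<in>all_balls. C summable_on {T \<in> ns_balls. B \<subseteq> T}) \<and>
     (\<forall>x. x islimpt UNIV \<longrightarrow>
        (\<forall>M. \<exists>r>0. \<forall>B\<in>all_balls. x \<in> B \<and> B \<subseteq> ball x r \<longrightarrow> M < lam C B))"


section \<open>The hierarchical Laplacian on test functions\<close>

definition test_functions :: "('a::metric_space \<Rightarrow> complex) set" where
  "test_functions =
     {f. (\<forall>x. \<forall>\<^sub>F y in nhds x. f y = f x) \<and> compact (closure {x. f x \<noteq> 0})}"

definition ball_mean :: "'a measure \<Rightarrow> 'a set \<Rightarrow> ('a \<Rightarrow> complex) \<Rightarrow> complex" where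
  "ball_mean m B f = (1 / measure m B) *\<^sub>R set_lebesgue_integral m B f"

definition hier_Laplacian ::
  "'a::metric_space measure \<Rightarrow> ('a set \<Rightarrow> real) \<Rightarrow> ('a \<Rightarrow> complex) \<Rightarrow> 'a \<Rightarrow> complex" where
  "hier_Laplacian m C f x =
     - (\<Sum>\<^sub>\<infinity>B\<in>{B \<in> ns_balls. x \<in> B}. C B *\<^sub>R (ball_mean m B f - f x))"


section \<open>Operators in \<open>L\<^sup>q\<close>\<close>

text \<open>Elements of \<open>L\<^sup>q\<close> are represented by complex-valued functions, two of which
  denote the same element iff they agree almost everywhere. Unbounded operators are represented
  by their graphs.\<close>

type_synonym 'a graph = "(('a \<Rightarrow> complex) \<times> ('a \<Rightarrow> complex)) set"

definition Lq :: "'a measure \<Rightarrow> real \<Rightarrow> ('a \<Rightarrow> complex) set" where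
  "Lq m q = {f \<in> borel_measurable m. integrable m (\<lambda>x. norm (f x) powr q)}"

definition Lq_norm :: "'a measure \<Rightarrow> real \<Rightarrow> ('a \<Rightarrow> complex) \<Rightarrow> real" where
  "Lq_norm m q f = (\<integral>x. norm (f x) powr q \<partial>m) powr (1 / q)"

definition hier_graph :: "'a::metric_space measure \<Rightarrow> ('a set \<Rightarrow> real) \<Rightarrow> 'a graph" where
  "hier_graph m C = {(f, hier_Laplacian m C f) |f. f \<in> test_functions}"

text \<open>The fourth and fifth conjuncts say that the graph is a single-valued relation between
  equivalence classes modulo almost everywhere equality, containing all representatives.\<close>

definition Lq_operator :: "'a measure \<Rightarrow> real \<Rightarrow> 'a graph \<Rightarrow> bool" where
  "Lq_operator m q A \<longleftrightarrow>
     A \<subseteq> Lq m q \<times> Lq m q \<and>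
     (\<lambda>_. 0, \<lambda>_. 0) \<in> A \<and>
     (\<forall>c f g f' g'. (f, g) \<in> A \<and> (f', g') \<in> A \<longrightarrow>
        (\<lambda>x. c * f x + f' x, \<lambda>x. c * g x + g' x) \<in> A) \<and>
     (\<forall>f g f' g'. (f, g) \<in> A \<and> f' \<in> Lq m q \<and> g' \<in> Lq m q \<and>
        (AE x in m. f' x = f x) \<and> (AE x in m. g' x = g x) \<longrightarrow> (f', g') \<in> A) \<and>
     (\<forall>f g g'. (f, g) \<in> A \<and> (f, g') \<in> A \<longrightarrow> (AE x in m. g x = g' x))"

definition Lq_closure :: "'a measure \<Rightarrow> real \<Rightarrow> 'a graph \<Rightarrow> 'a graph" where
  "Lq_closure m q A =
     {(f, g). f \<in> Lq m q \<and> g \<in> Lq m q \<and>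
        (\<exists>u v. (\<forall>n::nat. (u n, v n) \<in> A \<inter> (Lq m q \<times> Lq m q)) \<and>
           (\<lambda>n. Lq_norm m q (\<lambda>x. u n x - f x)) \<longlonglongrightarrow> 0 \<and>
           (\<lambda>n. Lq_norm m q (\<lambda>x. v n x - g x)) \<longlonglongrightarrow> 0)}"

definition closed_operator :: "'a measure \<Rightarrow> real \<Rightarrow> 'a graph \<Rightarrow> bool" where
  "closed_operator m q A \<longleftrightarrow> Lq_operator m q A \<and> Lq_closure m q A \<subseteq> A"

definition neg_op :: "'a graph \<Rightarrow> 'a graph" where
  "neg_op A = {(f, \<lambda>x. - g x) |f g. (f, g) \<in> A}"

definition densely_defined :: "'a measure \<Rightarrow> real \<Rightarrow> 'a graph \<Rightarrow> bool" where
  "densely_defined m q A \<longleftrightarrow>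
     (\<forall>f\<in>Lq m q. \<forall>e>0. \<exists>u\<in>Domain A. Lq_norm m q (\<lambda>x. f x - u x) < e)"

definition L2_adjoint :: "'a measure \<Rightarrow> 'a graph \<Rightarrow> 'a graph" where
  "L2_adjoint m A =
     {(u, v). u \<in> Lq m 2 \<and> v \<in> Lq m 2 \<and>
        (\<forall>(f, g)\<in>A. (\<integral>x. g x * cnj (u x) \<partial>m) = (\<integral>x. f x * cnj (v x) \<partial>m))}"

definition self_adjoint :: "'a measure \<Rightarrow> 'a graph \<Rightarrow> bool" where
  "self_adjoint m A \<longleftrightarrow>
     Lq_operator m 2 A \<and> densely_defined m 2 A \<and> L2_adjoint m A = A"

definition bounded_operator ::
  "'a measure \<Rightarrow> real \<Rightarrow> (('a \<Rightarrow> complex) \<Rightarrow> ('a \<Rightarrow> complex)) \<Rightarrow> bool" where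
  "bounded_operator m q R \<longleftrightarrow>
     (\<forall>f\<in>Lq m q. R f \<in> Lq m q) \<and>
     (\<forall>c. \<forall>f\<in>Lq m q. \<forall>g\<in>Lq m q.
        AE x in m. R (\<lambda>y. c * f y + g y) x = c * R f x + R g x) \<and>
     (\<exists>K. \<forall>f\<in>Lq m q. Lq_norm m q (R f) \<le> K * Lq_norm m q f)"

text \<open>\<open>z\<close> is in the resolvent set iff \<open>z - A\<close> has a bounded two-sided inverse \<open>R\<close>.\<close>

definition resolvent_set :: "'a measure \<Rightarrow> real \<Rightarrow> 'a graph \<Rightarrow> complex set" where
  "resolvent_set m q A =
     {z. \<exists>R. bounded_operator m q R \<and>
        (\<forall>g\<in>Lq m q. \<exists>h. (R g, h) \<in> A \<and> (AE x in m. z * R g x - h x = g x)) \<and>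
        (\<forall>(f, h)\<in>A. AE x in m. R (\<lambda>y. z * f y - h y) x = f x)}"

definition spectrum :: "'a measure \<Rightarrow> real \<Rightarrow> 'a graph \<Rightarrow> complex set" where
  "spectrum m q A = - resolvent_set m q A"


section \<open>Semigroups in \<open>L\<^sup>q\<close>\<close>

type_synonym 'a semigroup = "real \<Rightarrow> ('a \<Rightarrow> complex) \<Rightarrow> ('a \<Rightarrow> complex)"

definition C0_semigroup :: "'a measure \<Rightarrow> real \<Rightarrow> 'a semigroup \<Rightarrow> bool" where
  "C0_semigroup m q T \<longleftrightarrow>
     (\<forall>t\<ge>0. bounded_operator m q (T t)) \<and>
     (\<forall>f\<in>Lq m q. AE x in m. T 0 f x = f x) \<and>
     (\<forall>s\<ge>0. \<forall>t\<ge>0. \<forall>f\<in>Lq m q. AE x in m. T (s + t) f x = T s (T t f) x) \<and>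
     (\<forall>f\<in>Lq m q. ((\<lambda>t. Lq_norm m q (\<lambda>x. T t f x - f x)) \<longlongrightarrow> 0) (at_right 0))"

definition C0_contraction_semigroup :: "'a measure \<Rightarrow> real \<Rightarrow> 'a semigroup \<Rightarrow> bool" where
  "C0_contraction_semigroup m q T \<longleftrightarrow>
     C0_semigroup m q T \<and>
     (\<forall>t\<ge>0. \<forall>f\<in>Lq m q. Lq_norm m q (T t f) \<le> Lq_norm m q f)"

text \<open>Markov property in the sense of Dirichlet form theory:
  \<open>0 \<le> f \<le> 1\<close> implies \<open>0 \<le> T t f \<le> 1\<close>.\<close>

definition markov_semigroup :: "'a measure \<Rightarrow> real \<Rightarrow> 'a semigroup \<Rightarrow> bool" where
  "markov_semigroup m q T \<longleftrightarrow>
     C0_contraction_semigroup m q T \<and>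
     (\<forall>t\<ge>0. \<forall>f\<in>Lq m q. (AE x in m. f x \<in> complex_of_real ` {0..1}) \<longrightarrow>
        (AE x in m. T t f x \<in> complex_of_real ` {0..1}))"

definition generator :: "'a measure \<Rightarrow> real \<Rightarrow> 'a semigroup \<Rightarrow> 'a graph" where
  "generator m q T =
     {(f, g). f \<in> Lq m q \<and> g \<in> Lq m q \<and>
        ((\<lambda>t. Lq_norm m q (\<lambda>x. (T t f x - f x) / complex_of_real t - g x)) \<longlongrightarrow> 0) (at_right 0)}"


section \<open>The operators \<open>L\<^sub>C\<^sup>q\<close>\<close>

text \<open>Essential self-adjointness means that the \<open>L\<^sup>2\<close>-closure of the operator on test functions
  is self-adjoint, and that closure is then its unique self-adjoint extension \<open>A\<close>;
  \<open>exp (- t A)\<close> is the \<open>C\<^sub>0\<close>-semigroup with generator \<open>- A\<close>.\<close>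

definition heat_semigroup ::
  "'a::metric_space measure \<Rightarrow> ('a set \<Rightarrow> real) \<Rightarrow> 'a semigroup \<Rightarrow> bool" where
  "heat_semigroup m C P \<longleftrightarrow>
     self_adjoint m (Lq_closure m 2 (hier_graph m C)) \<and>
     C0_semigroup m 2 P \<and>
     generator m 2 P = neg_op (Lq_closure m 2 (hier_graph m C))"

text \<open>\<open>A\<close> is the operator whose negative generates the extension of the \<open>L\<^sup>2\<close> heat semigroup
  to a contraction semigroup on \<open>L\<^sup>q\<close>. As a \<open>C\<^sub>0\<close>-semigroup is determined by its generator and
  \<open>L\<^sup>2 \<inter> L\<^sup>q\<close> is dense in \<open>L\<^sup>q\<close>, at most one graph \<open>A\<close> has this property.\<close>

definition is_Lq_Laplacian ::
  "'a::metric_space measure \<Rightarrow> ('a set \<Rightarrow> real) \<Rightarrow> real \<Rightarrow> 'a graph \<Rightarrow> bool" where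
  "is_Lq_Laplacian m C q A \<longleftrightarrow>
     (\<exists>P T. heat_semigroup m C P \<and>
        C0_contraction_semigroup m q T \<and>
        (\<forall>t\<ge>0. \<forall>f\<in>Lq m 2 \<inter> Lq m q. AE x in m. T t f x = P t f x) \<and>
        generator m q T = neg_op A)"

end

theory Submission
  imports Defs
begin

text \<open>The averages \<open>P\<^sub>T\<close> over the balls \<open>T\<close> are nested, so a function \<open>F\<close> of the hierarchical
  Laplacian acts by
  \<open>F(L) u (x) = (\<Sum>T \<ni> x. (F (\<lambda> T') - F (\<lambda> T)) * P\<^sub>T u) + F (\<lambda> x) * u x\<close>,
  where \<open>T'\<close> is the next larger ball and \<open>\<lambda> x\<close> is the limit of \<open>\<lambda>\<close> at \<open>x\<close>. For decreasing \<open>F \<ge> 0\<close> this is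
  an average of \<open>u\<close> of total mass \<open>F 0\<close> whose kernel is symmetric, hence by Jensen bounded by \<open>F 0\<close> in every
  \<open>L\<^sup>q\<close>. The choice \<open>F s = exp (- t * s)\<close> gives the semigroup. The increments of the resolvent
  function \<open>1 / (z - s)\<close> along the values \<open>\<lambda> B\<close> are dominated by those of a multiple of
  \<open>1 / (1 + s)\<close> as soon as \<open>z\<close> stays away from these values and from \<open>0\<close>; so the resolvent set does not
  depend on \<open>q\<close>. Operator identities are verified on means over balls, which determine a function almost
  everywhere and on which the calculus is multiplicative by telescoping along chains of balls.
  The values \<open>\<lambda> B\<close> are eigenvalues: if \<open>e\<^sub>B\<close> is the normalized indicator of \<open>B\<close> and \<open>B\<close> the next ball
  above \<open>S\<close>, then \<open>e\<^sub>S - e\<^sub>B\<close> is an eigenfunction. The same relation solves \<open>(1 + L) d = e\<^sub>B + L e\<^sub>N\<close> for every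
  ball \<open>N\<close> above \<open>B\<close>, and \<open>L e\<^sub>N\<close> is small for large \<open>N\<close>; so the test functions form a core, which yields
  essential self-adjointness.\<close>

section \<open>Powers of \<open>L\<^sup>q\<close> norms and unordered sums\<close>

text \<open>Nothing is interpolated between exponents or extended from L^2 by continuity. One map
  \<open>heat t\<close> acts on every L^q, so the semigroups agree on intersections by construction,
  and every bound comes from the mass of a kernel, in which q does not occur. The obstacle is that L
  is unbounded and that the series defining \<open>fcalc\<close> at a single point may diverge on a
  null set. Ball means avoid both: at a fixed ball only the balls above it occur, the values of
  lambda there are bounded, all series converge absolutely, and L acts by the same formula as a
  bounded function of L. Isolated points need care, since the chain of balls around such a point
  ends there; the diagonal part of F(L) then carries F at \<open>lam C {x}\<close> instead of its
  limit at infinity. The number 0 has its own place in the spectrum: lambda tends to 0 along growing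
  balls, and if the space is a single ball the constants are in the kernel of L. Density of the
  range of 1 + L has to hold for q = 1 too, where no decay comes from the measure of large balls; it
  rests on the decay of lambda alone.\<close>

text \<open>For limits and bounds up to constants the \<open>q\<close>-th power of the norm suffices, and its
  quasi-triangle inequality replaces Minkowski's inequality.\<close>

definition Lq_pow :: "'a measure \<Rightarrow> real \<Rightarrow> ('a \<Rightarrow> complex) \<Rightarrow> real" where
  "Lq_pow m q f = (\<integral>x. norm (f x) powr q \<partial>m)"

lemma Lq_pow_nonneg [simp]: "0 \<le> Lq_pow m q f" by (simp add: Lq_pow_def)

lemma Lq_norm_eq: "Lq_norm m q f = Lq_pow m q f powr (1/q)" by (simp add: Lq_norm_def Lq_pow_def)

text \<open>The tangent at c lies below the graph of s powr q; for q > 1 this is Young's inequality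
  for the factors s and c powr (q - 1). Being linear in s, the left-hand side passes through
  averages, which is how Jensen's inequality is obtained for kernels and for ball means.\<close>

lemma powr_tangent:
  fixes q s c :: real
  assumes "1 \<le> q" "0 \<le> s" "0 < c"
  shows "q * c powr (q - 1) * s \<le> s powr q + (q - 1) * c powr q"
proof (cases "q = 1")
  case True thus ?thesis using assms by simp
next
  case False
  hence q: "1 < q" using assms by simp
  let ?r = "q / (q - 1)"
  have "s * c powr (q - 1) \<le> s powr q / q + (c powr (q - 1)) powr ?r / ?r"
    using q assms by (intro Youngs_inequality) (auto simp: field_simps)
  also have "(c powr (q - 1)) powr ?r = c powr q" using q by (simp add: powr_powr)
  finally show ?thesis using q by (simp add: field_simps)
qed

text \<open>Gives integrability on sets of finite measure without Hoelder's inequality.\<close>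

lemma le_powr_add_one:
  fixes q s :: real
  assumes "1 \<le> q" "0 \<le> s" shows "s \<le> s powr q + 1"
proof (cases "s \<le> 1")
  case True thus ?thesis using powr_ge_zero[of s q] by linarith
next
  case False thus ?thesis using powr_mono[of 1 q s] assms by simp
qed

lemma powr_add_le:
  assumes "0 \<le> q" shows "norm (a + b :: 'b::real_normed_vector) powr q \<le> 2 powr q * (norm a powr q + norm b powr q)"
proof -
  have "norm (a + b) \<le> 2 * max (norm a) (norm b)" using norm_triangle_ineq[of a b] by linarith
  hence "norm (a + b) powr q \<le> (2 * max (norm a) (norm b)) powr q" using assms by (intro powr_mono2) auto
  also have "\<dots> = 2 powr q * max (norm a) (norm b) powr q" by (simp add: powr_mult)
  also have "max (norm a) (norm b) powr q \<le> norm a powr q + norm b powr q" by (auto simp: max_def)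
  finally show ?thesis by simp
qed

lemma Lq_measurable: "f \<in> Lq m q \<Longrightarrow> f \<in> borel_measurable m"
  and Lq_integrable: "f \<in> Lq m q \<Longrightarrow> integrable m (\<lambda>x. norm (f x) powr q)"
  by (auto simp: Lq_def)

lemma Lq_bound:
  assumes "f \<in> borel_measurable m" "(\<integral>\<^sup>+x. ennreal (norm (f x) powr q) \<partial>m) \<le> ennreal A" "0 \<le> A"
  shows "f \<in> Lq m q" "Lq_pow m q f \<le> A"
proof -
  have i: "integrable m (\<lambda>x. norm (f x) powr q)"
    using assms(1) le_less_trans[OF assms(2) ennreal_less_top] by (intro integrableI_bounded) auto
  thus "f \<in> Lq m q" using assms by (simp add: Lq_def)
  have "ennreal (Lq_pow m q f) \<le> ennreal A"
    using assms(2) nn_integral_eq_integral[OF i] by (simp add: Lq_pow_def)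
  thus "Lq_pow m q f \<le> A" using assms(3) by (simp add: ennreal_le_iff)
qed

lemma nn_integral_Lq: "f \<in> Lq m q \<Longrightarrow> (\<integral>\<^sup>+x. ennreal (norm (f x) powr q) \<partial>m) = ennreal (Lq_pow m q f)"
  using nn_integral_eq_integral[OF Lq_integrable] by (auto simp: Lq_pow_def)

lemma Lq_pow_cmult: "0 \<le> q \<Longrightarrow> Lq_pow m q (\<lambda>x. c * f x) = norm c powr q * Lq_pow m q f"
  by (simp add: Lq_pow_def norm_mult powr_mult)

lemma Lq_cmult: "0 \<le> q \<Longrightarrow> f \<in> Lq m q \<Longrightarrow> (\<lambda>x. c * f x) \<in> Lq m q"
  by (auto simp: Lq_def norm_mult powr_mult)

lemma Lq_zero [simp]: "(\<lambda>x. 0) \<in> Lq m q" by (simp add: Lq_def)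

lemma Lq_add:
  assumes "0 \<le> q" "f \<in> Lq m q" "g \<in> Lq m q"
  shows "(\<lambda>x. f x + g x) \<in> Lq m q" "Lq_pow m q (\<lambda>x. f x + g x) \<le> 2 powr q * (Lq_pow m q f + Lq_pow m q g)"
proof -
  have [measurable]: "f \<in> borel_measurable m" "g \<in> borel_measurable m" using assms Lq_measurable by auto
  have i: "integrable m (\<lambda>x. 2 powr q * (norm (f x) powr q + norm (g x) powr q))"
    using Lq_integrable[OF assms(2)] Lq_integrable[OF assms(3)] by auto
  have j: "integrable m (\<lambda>x. norm (f x + g x) powr q)"
    using i by (rule Bochner_Integration.integrable_bound) (use powr_add_le[OF assms(1)] in auto)
  thus "(\<lambda>x. f x + g x) \<in> Lq m q" by (simp add: Lq_def)
  have "Lq_pow m q (\<lambda>x. f x + g x) \<le> (\<integral>x. 2 powr q * (norm (f x) powr q + norm (g x) powr q) \<partial>m)"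
    unfolding Lq_pow_def using j i by (rule integral_mono) (use powr_add_le[OF assms(1)] in auto)
  also have "\<dots> = 2 powr q * (Lq_pow m q f + Lq_pow m q g)"
    unfolding Lq_pow_def using Lq_integrable[OF assms(2)] Lq_integrable[OF assms(3)] by simp
  finally show "Lq_pow m q (\<lambda>x. f x + g x) \<le> 2 powr q * (Lq_pow m q f + Lq_pow m q g)" .
qed

lemma Lq_lincomb: "0 \<le> q \<Longrightarrow> f \<in> Lq m q \<Longrightarrow> g \<in> Lq m q \<Longrightarrow> (\<lambda>x. c * f x + g x) \<in> Lq m q"
  by (intro Lq_add Lq_cmult)

lemma Lq_minus: "f \<in> Lq m q \<Longrightarrow> (\<lambda>x. - f x) \<in> Lq m q"
  by (auto simp: Lq_def)

lemma Lq_pow_minus: "Lq_pow m q (\<lambda>x. f x - g x) = Lq_pow m q (\<lambda>x. g x - f x)"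
  by (simp add: Lq_pow_def norm_minus_commute)

lemma Lq_diff:
  assumes "0 \<le> q" "f \<in> Lq m q" "g \<in> Lq m q"
  shows "(\<lambda>x. f x - g x) \<in> Lq m q" "Lq_pow m q (\<lambda>x. f x - g x) \<le> 2 powr q * (Lq_pow m q f + Lq_pow m q g)"
proof -
  have "Lq_pow m q (\<lambda>x. - g x) = Lq_pow m q g" by (simp add: Lq_pow_def)
  thus "(\<lambda>x. f x - g x) \<in> Lq m q" "Lq_pow m q (\<lambda>x. f x - g x) \<le> 2 powr q * (Lq_pow m q f + Lq_pow m q g)"
    using Lq_add[OF assms(1,2) Lq_minus[OF assms(3)]] by simp_all
qed

lemma Lq_pow_triangle:
  assumes "0 \<le> q" "f \<in> Lq m q" "g \<in> Lq m q" "h \<in> Lq m q"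
  shows "Lq_pow m q (\<lambda>x. f x - h x) \<le> 2 powr q * (Lq_pow m q (\<lambda>x. f x - g x) + Lq_pow m q (\<lambda>x. g x - h x))"
  using Lq_add(2)[OF assms(1) Lq_diff(1)[OF assms(1,2,3)] Lq_diff(1)[OF assms(1,3,4)]] by simp

lemma Lq_norm_le:
  assumes "Lq_pow m q f \<le> M powr q * Lq_pow m q g" "1 \<le> q" "0 \<le> M"
  shows "Lq_norm m q f \<le> M * Lq_norm m q g"
proof -
  have "Lq_norm m q f \<le> (M powr q * Lq_pow m q g) powr (1/q)"
    unfolding Lq_norm_eq using assms by (intro powr_mono2) auto
  also have "\<dots> = M * Lq_norm m q g" using assms by (simp add: powr_mult powr_powr Lq_norm_eq)
  finally show ?thesis .
qed

lemma Lq_pow_eq: "1 \<le> q \<Longrightarrow> Lq_pow m q f = Lq_norm m q f powr q"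
  by (simp add: Lq_norm_eq powr_powr)

lemma Lq_norm_tendsto_iff:
  assumes "1 \<le> q"
  shows "((\<lambda>t. Lq_norm m q (f t)) \<longlongrightarrow> 0) F \<longleftrightarrow> ((\<lambda>t. Lq_pow m q (f t)) \<longlongrightarrow> 0) F"
proof
  assume "((\<lambda>t. Lq_norm m q (f t)) \<longlongrightarrow> 0) F"
  hence "((\<lambda>t. Lq_norm m q (f t) powr q) \<longlongrightarrow> 0 powr q) F"
    using assms by (intro tendsto_powr') (auto simp: Lq_norm_eq)
  thus "((\<lambda>t. Lq_pow m q (f t)) \<longlongrightarrow> 0) F" using assms by (simp add: Lq_pow_eq)
next
  assume "((\<lambda>t. Lq_pow m q (f t)) \<longlongrightarrow> 0) F"
  hence "((\<lambda>t. Lq_pow m q (f t) powr (1/q)) \<longlongrightarrow> 0 powr (1/q)) F"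
    using assms by (intro tendsto_powr') auto
  thus "((\<lambda>t. Lq_norm m q (f t)) \<longlongrightarrow> 0) F" using assms by (simp add: Lq_norm_eq)
qed

lemma Lq_pow_cong_AE:
  assumes "f \<in> borel_measurable m" "g \<in> borel_measurable m" "AE x in m. f x = g x"
  shows "Lq_pow m q f = Lq_pow m q g"
  unfolding Lq_pow_def using assms by (intro integral_cong_AE) auto

lemma Lq_pow_zero_AE:
  assumes "f \<in> Lq m q" "Lq_pow m q f = 0" shows "AE x in m. f x = 0"
  using integral_nonneg_eq_0_iff_AE[OF Lq_integrable[OF assms(1)]] assms(2) by (simp add: Lq_pow_def)

lemma Lq_pow_zero [simp]: "Lq_pow m q (\<lambda>x. 0) = 0" by (simp add: Lq_pow_def)

text \<open>Both sides are \<open>0\<close> if the family is not summable.\<close>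

lemma infsum_eq_lebesgue:
  fixes f :: "'i \<Rightarrow> complex"
  shows "infsum f A = (\<integral>x. f x \<partial>count_space A)"
proof (cases "Infinite_Set_Sum.abs_summable_on f A")
  case True
  thus ?thesis using infsetsum_infsum[OF True] by (simp add: infsetsum_def)
next
  case False
  hence "\<not> f summable_on A"
    by (metis abs_summable_equivalent summable_on_iff_abs_summable_on_complex)
  moreover have "\<not> integrable (count_space A) f" using False by (simp add: abs_summable_on_def)
  ultimately show ?thesis by (simp add: infsum_not_exists not_integrable_integral_eq)
qed

text \<open>For complex families summability and absolute summability agree, so Fubini's theorem for
  \<open>count_space\<close> and \<open>m\<close> can return summability statements.\<close>

lemma summable_on_iff_integrable:
  fixes f :: "'i \<Rightarrow> complex"
  shows "f summable_on A \<longleftrightarrow> integrable (count_space A) f"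
  by (metis abs_summable_equivalent summable_on_iff_abs_summable_on_complex abs_summable_on_def)

lemma nn_integral_count_space_infsum:
  assumes "f summable_on A" "\<And>x. x \<in> A \<Longrightarrow> 0 \<le> (f x :: real)"
  shows "(\<integral>\<^sup>+x. ennreal (f x) \<partial>count_space A) = ennreal (infsum f A)"
proof -
  have "(\<lambda>x. norm (f x)) summable_on A" using assms by (subst summable_on_cong[of A _ f]) auto
  hence *: "Infinite_Set_Sum.abs_summable_on f A" using abs_summable_equivalent by blast
  show ?thesis using nn_integral_conv_infsetsum[OF *] infsetsum_infsum[OF *] assms(2) by simp
qed

text \<open>No convergence has to be known beforehand: a divergent family has the sum 0, for which
  the bound is trivial.\<close>

lemma norm_infsum_le_nn:
  fixes f :: "'i \<Rightarrow> complex"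
  shows "ennreal (norm (infsum f A)) \<le> (\<integral>\<^sup>+x. ennreal (norm (f x)) \<partial>count_space A)"
proof (cases "integrable (count_space A) f")
  case True thus ?thesis unfolding infsum_eq_lebesgue by (rule integral_norm_bound_ennreal)
qed (simp add: infsum_eq_lebesgue not_integrable_integral_eq)

section \<open>Balls of a proper ultrametric space\<close>

locale hierarchical =
  fixes m :: "'a::metric_space measure" and C :: "'a set \<Rightarrow> real"
  assumes ultrametric: "dist x z \<le> max (dist x y) (dist y (z::'a))"
    and compact_cball: "compact (cball (a::'a) r)"
    and radon: "radon_measure m"
    and fat_balls: "B \<in> all_balls \<Longrightarrow> diameter B > 0 \<Longrightarrow> emeasure m B > 0"
    and atoms: "emeasure m {x} = 0 \<longleftrightarrow> x islimpt UNIV"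
    and choice: "choice_function C"
begin

lemma ball_recenter: assumes "y \<in> ball (x::'a) r" shows "ball y r = ball x r"
proof -
  have *: "dist b z < r" if "dist a b < r" "dist a z < r" for a b z :: 'a
    using ultrametric[of b z a] that by (simp add: dist_commute)
  have "dist x y < r" using assms by simp
  moreover from this have "dist y x < r" by (simp add: dist_commute)
  ultimately have "dist y z < r \<longleftrightarrow> dist x z < r" for z
    using *[of x y z] *[of y x z] by blast
  thus ?thesis by (auto simp: ball_def)
qed

lemma ball_in_all_balls [simp, intro]: "0 < r \<Longrightarrow> ball (x::'a) r \<in> all_balls"
  by (auto simp: all_balls_def)

lemma all_balls_centered:
  assumes "B \<in> all_balls" "(x::'a) \<in> B"
  obtains r where "0 < r" "B = ball x r"
  using assms ball_recenter by (auto simp: all_balls_def)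

lemma balls_nonempty: "B \<in> all_balls \<Longrightarrow> B \<noteq> ({}::'a set)"
  by (auto simp: all_balls_def)

lemma balls_nested:
  assumes "B \<in> all_balls" "T \<in> all_balls" "B \<inter> T \<noteq> ({}::'a set)"
  shows "B \<subseteq> T \<or> T \<subseteq> B"
proof -
  obtain x where x: "x \<in> B" "x \<in> T" using assms by auto
  obtain r s where "B = ball x r" "T = ball x s"
    by (metis all_balls_centered assms(1,2) x)
  thus ?thesis by (metis le_cases subset_ball)
qed

lemma ns_balls_all: "T \<in> ns_balls \<Longrightarrow> T \<in> all_balls" by (simp add: ns_balls_def)

text \<open>Two balls of equal radius are equal or disjoint, so the ball of radius r about a point
  outside stays outside.\<close>

lemma ball_closed: "closed (ball (x::'a) r)"
proof -
  have "ball y r \<inter> ball x r = {}" if "y \<notin> ball x r" "r > 0" for y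
  proof (rule ccontr)
    assume "ball y r \<inter> ball x r \<noteq> {}"
    then obtain z where "z \<in> ball y r" "z \<in> ball x r" by auto
    hence "ball y r = ball x r" using ball_recenter by metis
    thus False using that by auto
  qed
  hence "open (- ball x r)" if "r > 0"
    unfolding open_contains_ball using that by (metis ComplD disjoint_eq_subset_Compl)
  thus ?thesis by (cases "r > 0") (auto simp: closed_def ball_empty)
qed

lemma balls_open: "B \<in> all_balls \<Longrightarrow> open (B::'a set)" by (auto simp: all_balls_def)

lemma balls_compact: assumes "B \<in> all_balls" shows "compact (B::'a set)"
proof -
  obtain x r where "B = ball x r" using assms by (auto simp: all_balls_def)
  hence "B = cball x r \<inter> ball x r" by auto
  thus ?thesis using compact_Int_closed[OF compact_cball ball_closed] \<open>B = ball x r\<close> by metis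
qed

section \<open>Measures of balls\<close>

lemma sets_m [measurable_cong]: "sets m = sets borel" using radon by (simp add: radon_measure_def)

lemma space_m [simp]: "space m = UNIV" using sets_eq_imp_space_eq[OF sets_m] by simp

lemma balls_sets [measurable]: "B \<in> all_balls \<Longrightarrow> B \<in> sets m"
  by (simp add: sets_m balls_open)

lemma emeasure_compact: "compact K \<Longrightarrow> emeasure m K < \<infinity>" using radon by (simp add: radon_measure_def)

lemma emeasure_ball_finite: "B \<in> all_balls \<Longrightarrow> emeasure m B < \<infinity>"
  using balls_compact emeasure_compact by blast

text \<open>\<open>fat_balls\<close> speaks of positive diameter only. A ball without two distinct
  points is an open singleton, so its point is isolated and \<open>atoms\<close> gives it positive
  mass.\<close>

lemma emeasure_ball_pos: assumes "B \<in> all_balls" shows "emeasure m B > 0"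
proof (cases "\<exists>x\<in>B. \<exists>y\<in>B. x \<noteq> y")
  case True
  then obtain x y where xy: "x \<in> B" "y \<in> B" "x \<noteq> y" by auto
  have "bounded B" using assms balls_compact compact_imp_bounded by blast
  hence "dist x y \<le> diameter B" using xy diameter_bounded_bound by metis
  hence "diameter B > 0" using xy by (smt (verit) zero_less_dist_iff)
  thus ?thesis using fat_balls assms by blast
next
  case False
  obtain x where x: "x \<in> B" using balls_nonempty assms by blast
  have B: "B = {x}" using False x by auto
  hence "open {x}" using assms balls_open by metis
  hence "\<not> x islimpt UNIV" by (auto simp: islimpt_def)
  thus ?thesis using atoms B by (metis zero_less_iff_neq_zero)
qed

definition mu :: "'a set \<Rightarrow> real" where "mu B = measure m B"

lemma mu_pos [simp]: "B \<in> all_balls \<Longrightarrow> mu B > 0"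
  using emeasure_ball_pos emeasure_ball_finite
  by (metis enn2real_positive_iff measure_def mu_def less_top infinity_ennreal_def)

lemma mu_nonneg [simp]: "mu B \<ge> 0" by (simp add: mu_def)

lemma emeasure_mu: "B \<in> all_balls \<Longrightarrow> emeasure m B = ennreal (mu B)"
  using emeasure_ball_finite by (simp add: emeasure_eq_ennreal_measure mu_def less_top[symmetric])

section \<open>Finite and countable families of balls\<close>

lemma compact_totally_bounded:
  assumes "compact (K::'a set)" "0 < e"
  shows "\<exists>V. finite V \<and> V \<subseteq> K \<and> K \<subseteq> (\<Union>x\<in>V. ball x e)"
proof -
  have "seq_compact K" using assms(1) by (simp add: compact_eq_seq_compact_metric)
  from seq_compact_imp_totally_bounded[OF this] show ?thesis using assms(2) by blast
qed

text \<open>Fix a finite cover of N by balls of radius e. A ball of radius at least e inside N is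
  the union of the members it contains, so there are no more such balls than subfamilies of the
  cover.\<close>

lemma finite_subballs:
  assumes "e > 0" "N \<in> all_balls"
  shows "finite {ball (x::'a) r |x r. e \<le> r \<and> ball x r \<subseteq> N}"
proof -
  obtain V where V: "finite V" "V \<subseteq> N" "N \<subseteq> (\<Union>x\<in>V. ball x e)"
    using compact_totally_bounded[OF balls_compact[OF assms(2)] assms(1)] by auto
  define \<V> where "\<V> = (\<lambda>x. ball x e) ` V"
  have "T = \<Union>{U\<in>\<V>. U \<subseteq> T}" if "T = ball x r" "e \<le> r" "ball x r \<subseteq> N" for T x r
  proof
    show "T \<subseteq> \<Union>{U\<in>\<V>. U \<subseteq> T}"
    proof
      fix y assume y: "y \<in> T"
      have "y \<in> N" using y that by blast
      then obtain v where v: "v \<in> V" "y \<in> ball v e" using V by auto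
      have "ball v e \<subseteq> ball y r" using ball_recenter[OF v(2)] that(2) by (metis subset_ball)
      hence "ball v e \<subseteq> T" using y that ball_recenter by metis
      thus "y \<in> \<Union>{U\<in>\<V>. U \<subseteq> T}" using v by (auto simp: \<V>_def)
    qed
  qed auto
  note eq = this
  have "{ball x r |x r. e \<le> r \<and> ball x r \<subseteq> N} \<subseteq> Union ` Pow \<V>"
  proof
    fix T assume "T \<in> {ball x r |x r. e \<le> r \<and> ball x r \<subseteq> N}"
    then obtain x r where "T = ball x r" "e \<le> r" "ball x r \<subseteq> N" by blast
    hence "T = \<Union>{U\<in>\<V>. U \<subseteq> T}" by (rule eq)
    thus "T \<in> Union ` Pow \<V>" by (rule image_eqI) auto
  qed
  moreover have "finite (Union ` Pow \<V>)" using V(1) by (simp add: \<V>_def)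
  ultimately show ?thesis by (rule finite_subset)
qed

lemma finite_between:
  assumes "B \<in> all_balls" "N \<in> all_balls"
  shows "finite {T \<in> all_balls. B \<subseteq> T \<and> T \<subseteq> (N::'a set)}"
proof -
  obtain x e where x: "0 < e" "B = ball x e" using assms by (auto simp: all_balls_def)
  have "{T \<in> all_balls. B \<subseteq> T \<and> T \<subseteq> N} \<subseteq> {ball x r |x r. e \<le> r \<and> ball x r \<subseteq> N}"
  proof
    fix T assume "T \<in> {T \<in> all_balls. B \<subseteq> T \<and> T \<subseteq> N}"
    hence T: "T \<in> all_balls" "B \<subseteq> T" "T \<subseteq> N" by auto
    have "x \<in> T" using T x by auto
    then obtain r where r: "T = ball x r" using all_balls_centered[OF T(1)] by metis
    \<comment> \<open>A ball does not determine its radius: r may be below e although B is contained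
      in T. Then T = B, and e is a radius of T as well.\<close>
    have eq: "T = ball x (max r e)"
    proof (cases "e \<le> r")
      case False
      hence "T \<subseteq> B" using r x(2) by (simp add: subset_ball)
      hence "T = B" using T by blast
      thus ?thesis using False x(2) by (simp add: max_def)
    qed (simp add: r)
    have "ball x (max r e) \<subseteq> N" using T unfolding eq by simp
    thus "T \<in> {ball x r |x r. e \<le> r \<and> ball x r \<subseteq> N}"
      by (auto intro!: exI[of _ x] exI[of _ "max r e"] simp: eq)
  qed
  thus ?thesis using finite_subballs[OF x(1) assms(2)] by (rule finite_subset)
qed

text \<open>Makes \<open>count_space ns_balls\<close> sigma-finite, as Fubini's theorem requires.
  Radius and position are controlled by one index n, which leaves finitely many balls for each
  n.\<close>

lemma countable_all_balls: "countable (all_balls :: 'a set set)"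
proof -
  obtain a :: 'a where True by blast
  let ?F = "\<lambda>n::nat. {ball x r |x r. inverse (Suc n) \<le> r \<and> ball x r \<subseteq> ball a (Suc n)}"
  have "(all_balls :: 'a set set) \<subseteq> (\<Union>n. ?F n)"
  proof
    fix B :: "'a set" assume "B \<in> all_balls"
    then obtain x r where B: "B = ball x r" "0 < r" by (auto simp: all_balls_def)
    obtain n1 where n1: "inverse (Suc n1) < r" using B(2) reals_Archimedean by blast
    obtain n2 :: nat where n2: "dist a x + r < n2" using reals_Archimedean2 by blast
    define n where "n = max n1 n2"
    have "inverse (real (Suc n)) \<le> inverse (Suc n1)" by (simp add: n_def)
    moreover have "ball x r \<subseteq> ball a (Suc n)"
    proof
      fix y assume "y \<in> ball x r"
      hence "dist a y < dist a x + r" using dist_triangle[of a y x] by (simp add: dist_commute)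
      also have "\<dots> < Suc n" using n2 by (simp add: n_def)
      finally show "y \<in> ball a (Suc n)" by simp
    qed
    ultimately have "inverse (real (Suc n)) \<le> r \<and> ball x r \<subseteq> ball a (Suc n)" using n1 by linarith
    hence "B \<in> ?F n" using B(1) by blast
    thus "B \<in> (\<Union>n. ?F n)" by blast
  qed
  moreover have "countable (\<Union>n. ?F n)"
    by (intro countable_UN countableI_type countable_finite finite_subballs) auto
  ultimately show ?thesis using countable_subset by blast
qed

lemma countable_ns_balls: "countable (ns_balls :: 'a set set)"
  using countable_all_balls ns_balls_all by (meson countable_subset subsetI)

section \<open>Isolated points, parents and children\<close>

lemma not_singleton_ball: "B \<in> all_balls \<Longrightarrow> T \<in> all_balls \<Longrightarrow> B \<subset> T \<Longrightarrow> (T::'a set) \<in> ns_balls"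
  using balls_nonempty[of B] by (auto simp: ns_balls_def is_singleton_def)

lemma limpt_ball_ns: assumes "x islimpt (UNIV::'a set)" "B \<in> all_balls" "x \<in> B" shows "B \<in> ns_balls"
proof -
  have "\<not> is_singleton B"
  proof
    assume "is_singleton B"
    hence "B = {x}" using assms by (auto simp: is_singleton_def)
    hence "open {x}" using assms balls_open by metis
    thus False using assms(1) by (auto simp: islimpt_def)
  qed
  thus ?thesis using assms by (simp add: ns_balls_def)
qed

lemma isolated_ball: assumes "\<not> x islimpt (UNIV::'a set)" shows "{x} \<in> all_balls"
proof -
  obtain U where U: "open U" "x \<in> U" "U \<subseteq> {x}" using assms by (auto simp: islimpt_def)
  obtain e where "e > 0" "ball x e \<subseteq> U" using U open_contains_ball by metis
  hence "ball x e = {x}" using U by auto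
  thus ?thesis using \<open>e > 0\<close> by (metis ball_in_all_balls)
qed

lemma chain_subset:
  assumes "B \<in> all_balls" "S \<in> all_balls" "T \<in> all_balls" "B \<subseteq> S" "B \<subseteq> (T::'a set)"
  shows "S \<subseteq> T \<or> T \<subseteq> S"
  using balls_nested[of S T] balls_nonempty[of B] assms by blast

text \<open>N' is the child of N on the way to B, maximal in the finite set of balls from B upwards
  that are properly below N. That no ball lies between is expressed through upper sets because
  \<open>lam_parent\<close> is a sum over one.\<close>

lemma predecessor:
  assumes "B \<in> all_balls" "N \<in> all_balls" "B \<subset> (N::'a set)"
  obtains N' where "N' \<in> all_balls" "B \<subseteq> N'" "N' \<subset> N"
    "\<And>T. T \<in> all_balls \<Longrightarrow> N' \<subset> T \<longleftrightarrow> N \<subseteq> T"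
proof -
  define \<A> where "\<A> = {T\<in>all_balls. B \<subseteq> T \<and> T \<subset> N}"
  have "finite \<A>" using finite_between[OF assms(1,2)] by (rule rev_finite_subset) (auto simp: \<A>_def)
  moreover have "\<A> \<noteq> {}" using assms by (auto simp: \<A>_def)
  ultimately obtain N' where N': "N' \<in> \<A>" "\<And>T. T \<in> \<A> \<Longrightarrow> N' \<subseteq> T \<Longrightarrow> N' = T"
    using finite_has_maximal[of \<A>] by metis
  have "N \<subseteq> T" if T: "T \<in> all_balls" "N' \<subset> T" for T
  proof (rule ccontr)
    assume n: "\<not> N \<subseteq> T"
    have "T \<subseteq> N" using n chain_subset[of N' T N] N' T assms by (auto simp: \<A>_def)
    hence "T \<in> \<A>" using n T N' by (auto simp: \<A>_def)
    thus False using N' T by blast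
  qed
  thus thesis using that[of N'] N'(1) by (auto simp: \<A>_def)
qed

text \<open>Dually, N' is the parent of B; the ball N supplies a finite interval in which a minimal
  ball above B exists.\<close>

lemma successor:
  assumes "B \<in> all_balls" "N \<in> all_balls" "B \<subset> (N::'a set)"
  obtains N' where "N' \<in> all_balls" "B \<subset> N'" "N' \<subseteq> N"
    "\<And>T. T \<in> all_balls \<Longrightarrow> B \<subset> T \<longleftrightarrow> N' \<subseteq> T"
proof -
  define \<A> where "\<A> = {T\<in>all_balls. B \<subset> T \<and> T \<subseteq> N}"
  have "finite \<A>" using finite_between[OF assms(1,2)] by (rule rev_finite_subset) (auto simp: \<A>_def)
  moreover have "\<A> \<noteq> {}" using assms by (auto simp: \<A>_def)
  ultimately obtain N' where N': "N' \<in> \<A>" "\<And>T. T \<in> \<A> \<Longrightarrow> T \<subseteq> N' \<Longrightarrow> N' = T"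
    using finite_has_minimal[of \<A>] by metis
  have "N' \<subseteq> T" if T: "T \<in> all_balls" "B \<subset> T" for T
  proof (rule ccontr)
    assume n: "\<not> N' \<subseteq> T"
    have "T \<subseteq> N'" using n chain_subset[of B T N'] N' T assms by (auto simp: \<A>_def)
    hence "T \<in> \<A>" using n T N' by (auto simp: \<A>_def)
    thus False using N' T n \<open>T \<subseteq> N'\<close> by blast
  qed
  thus thesis using that[of N'] N'(1) by (auto simp: \<A>_def)
qed

text \<open>By recentering, every member of the family is one of the balls about the points of a
  finite net.\<close>

lemma compact_cover_balls:
  assumes "compact (K::'a set)" "0 < r"
  shows "finite ((\<lambda>x. ball x r) ` K)"
proof -
  obtain V where V: "finite V" "V \<subseteq> K" "K \<subseteq> (\<Union>x\<in>V. ball x r)"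
    using compact_totally_bounded[OF assms] by auto
  have "(\<lambda>x. ball x r) ` K \<subseteq> (\<lambda>x. ball x r) ` V"
  proof
    fix U assume "U \<in> (\<lambda>x. ball x r) ` K"
    then obtain x where x: "x \<in> K" "U = ball x r" by auto
    then obtain v where v: "v \<in> V" "x \<in> ball v r" using V by auto
    show "U \<in> (\<lambda>x. ball x r) ` V" using v(1) ball_recenter[OF v(2)] x(2) by auto
  qed
  thus ?thesis using V finite_subset by blast
qed

lemma balls_same_radius_disjoint: "disjoint ((\<lambda>x::'a. ball x r) ` K)"
  unfolding disjoint_def using ball_recenter by blast

section \<open>Multipliers acting on functions of balls\<close>

text \<open>\<open>lam_parent B\<close> is \<open>\<lambda>\<close> of the next ball above \<open>B\<close>, and \<open>0\<close> if there is none. Thus \<open>Lam\<close>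
  contains the values of both \<open>lam\<close> and \<open>lam_parent\<close>.\<close>

definition up :: "'a set \<Rightarrow> 'a set set" where "up B = {T \<in> ns_balls. B \<subset> T}"
definition lam_parent :: "'a set \<Rightarrow> real" where "lam_parent B = (\<Sum>\<^sub>\<infinity>T\<in>up B. C T)"
definition chain :: "'a set \<Rightarrow> 'a set \<Rightarrow> 'a set set" where
  "chain B N = {T \<in> ns_balls. B \<subset> T \<and> T \<subseteq> N}"
definition Lam :: "real set" where "Lam = insert 0 (lam C ` ns_balls)"

lemma C_pos: "T \<in> ns_balls \<Longrightarrow> C T > 0" using choice by (simp add: choice_function_def)

lemma C_summable: "B \<in> all_balls \<Longrightarrow> C summable_on {T \<in> ns_balls. B \<subseteq> T}"
  using choice by (simp add: choice_function_def)

lemma C_summable_up: "B \<in> all_balls \<Longrightarrow> C summable_on up B"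
  using C_summable by (rule summable_on_subset_banach) (auto simp: up_def)

lemma up_ns: "T \<in> up B \<Longrightarrow> T \<in> ns_balls" and up_all: "T \<in> up B \<Longrightarrow> T \<in> all_balls"
  and up_sub: "T \<in> up B \<Longrightarrow> B \<subset> T"
  by (auto simp: up_def ns_balls_all)

lemma up_le: "T \<in> up B \<Longrightarrow> B \<subseteq> T" by (auto simp: up_def)

lemma lam_eq: assumes "T \<in> ns_balls" shows "lam C T = lam_parent T + C T"
proof -
  have "{S \<in> ns_balls. T \<subseteq> S} = insert T (up T)" using assms by (auto simp: up_def)
  thus ?thesis using infsum_insert[OF C_summable_up, of T T] assms
    by (simp add: lam_def lam_parent_def ns_balls_all up_def)
qed

lemma lam_non_ns: "B \<notin> ns_balls \<Longrightarrow> lam C B = lam_parent B"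
  unfolding lam_def lam_parent_def up_def by (rule infsum_cong_neutral) auto

lemma lam_parent_pred:
  assumes "\<And>T. T \<in> all_balls \<Longrightarrow> N' \<subset> T \<longleftrightarrow> N \<subseteq> T"
  shows "lam_parent N' = lam C N"
proof -
  have "up N' = {T \<in> ns_balls. N \<subseteq> T}" using assms ns_balls_all unfolding up_def by blast
  thus ?thesis by (simp add: lam_def lam_parent_def)
qed

lemma lam_parent_nonneg [simp]: "lam_parent B \<ge> 0"
  unfolding lam_parent_def using C_pos by (intro infsum_nonneg) (auto simp: up_def less_imp_le)

lemma lam_nonneg [simp]: "lam C B \<ge> 0"
  unfolding lam_def using C_pos by (intro infsum_nonneg) (auto simp: less_imp_le)

lemma lam_parent_le_lam: "T \<in> ns_balls \<Longrightarrow> lam_parent T \<le> lam C T"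
  using lam_eq[of T] C_pos[of T] by simp

lemma lam_mono: assumes "S \<subseteq> T" "S \<in> all_balls" "T \<in> all_balls" shows "lam C T \<le> lam C S"
  unfolding lam_def using C_summable C_pos assms
  by (intro infsum_mono2) (auto simp: less_imp_le)

lemma lam_le_lam_parent: assumes "S \<subset> T" "S \<in> all_balls" "T \<in> all_balls" shows "lam C T \<le> lam_parent S"
  unfolding lam_def lam_parent_def using C_summable C_summable_up C_pos assms
  by (intro infsum_mono2) (auto simp: less_imp_le up_def)

lemma lam_parent_mono: assumes "S \<subseteq> T" "S \<in> all_balls" "T \<in> all_balls" shows "lam_parent T \<le> lam_parent S"
  unfolding lam_parent_def using C_summable_up C_pos assms
  by (intro infsum_mono2) (auto simp: less_imp_le up_def)

lemma Lam_nonneg: "a \<in> Lam \<Longrightarrow> a \<ge> 0" by (auto simp: Lam_def)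

lemma zero_Lam [simp]: "0 \<in> Lam" by (simp add: Lam_def)

lemma lam_Lam [simp]: "T \<in> ns_balls \<Longrightarrow> lam C T \<in> Lam" by (simp add: Lam_def)

text \<open>The value is 0 if no ball lies above B, and otherwise \<open>lam C\<close> of the
  parent, which is not a singleton.\<close>

lemma lam_parent_Lam [simp]: assumes "B \<in> all_balls" shows "lam_parent B \<in> Lam"
proof (cases "up B = {}")
  case True thus ?thesis by (simp add: lam_parent_def)
next
  case False
  then obtain N where "N \<in> up B" by blast
  hence N: "N \<in> all_balls" "B \<subset> N" using up_all up_sub by blast+
  obtain N' where N': "N' \<in> all_balls" "B \<subset> N'" "\<And>T. T \<in> all_balls \<Longrightarrow> B \<subset> T \<longleftrightarrow> N' \<subseteq> T"
    using successor[OF assms N] by metis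
  have "lam_parent B = lam C N'" using lam_parent_pred N'(3) by blast
  moreover have "N' \<in> ns_balls" using not_singleton_ball assms N' by blast
  ultimately show ?thesis by simp
qed

section \<open>Telescoping along chains of balls\<close>

lemma finite_chain: "B \<in> all_balls \<Longrightarrow> N \<in> all_balls \<Longrightarrow> finite (chain B N)"
  using finite_between[of B N] by (rule finite_subset[rotated]) (auto simp: chain_def ns_balls_all)

text \<open>The weight of the average over T in F(L). The sign makes it nonnegative for decreasing
  F, as in the heat kernel.\<close>

definition incr :: "(real \<Rightarrow> 'b::real_normed_vector) \<Rightarrow> 'a set \<Rightarrow> 'b" where
  "incr F T = F (lam_parent T) - F (lam C T)"

lemma chain_pred:
  assumes "B \<in> all_balls" "N \<in> all_balls" "B \<subset> N" "N' \<in> all_balls" "B \<subseteq> N'" "N' \<subset> N"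
    "\<And>T. T \<in> all_balls \<Longrightarrow> N' \<subset> T \<longleftrightarrow> N \<subseteq> T"
  shows "chain B N = insert N (chain B N')"
proof -
  have "T \<subseteq> N'" if "T \<in> ns_balls" "B \<subset> T" "T \<subseteq> N" "T \<noteq> N" for T
  proof -
    have "T \<in> all_balls" using that ns_balls_all by blast
    hence "T \<subseteq> N' \<or> N' \<subset> T" using chain_subset[of B T N'] assms that by blast
    thus ?thesis using assms(7)[OF \<open>T \<in> all_balls\<close>] that by blast
  qed
  moreover have "N \<in> ns_balls" using not_singleton_ball assms by blast
  ultimately show ?thesis using assms(3,5,6) unfolding chain_def by blast
qed

text \<open>The step climbs from a child N' to its parent N, which adds one ball to the finite chain
  above B.\<close>

lemma ball_chain_induct [consumes 3, case_names base step]: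
  fixes B :: "'a set"
  assumes "B \<in> all_balls" "N \<in> all_balls" "B \<subseteq> N" "P B"
    "\<And>N N'. N \<in> all_balls \<Longrightarrow> N' \<in> all_balls \<Longrightarrow> B \<subseteq> N' \<Longrightarrow> N' \<subset> N \<Longrightarrow>
      (\<And>T. T \<in> all_balls \<Longrightarrow> N' \<subset> T \<longleftrightarrow> N \<subseteq> T) \<Longrightarrow> P N' \<Longrightarrow> P N"
  shows "P N"
  using assms(2,3)
proof (induction "card (chain B N)" arbitrary: N rule: less_induct)
  case less
  show ?case
  proof (cases "B = N")
    case True thus ?thesis using assms(4) by simp
  next
    case False
    hence sub: "B \<subset> N" using less by blast
    obtain N' where N': "N' \<in> all_balls" "B \<subseteq> N'" "N' \<subset> N"
      "\<And>T. T \<in> all_balls \<Longrightarrow> N' \<subset> T \<longleftrightarrow> N \<subseteq> T"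
      using predecessor[OF assms(1) less(2) sub] by metis
    have "chain B N = insert N (chain B N')" using chain_pred assms(1) less(2) sub N' by metis
    moreover have "N \<notin> chain B N'" using N' by (auto simp: chain_def)
    ultimately have "card (chain B N') < card (chain B N)"
      using finite_chain[OF assms(1) N'(1)] by simp
    hence "P N'" using less N' by blast
    thus ?thesis using assms(5) less N' by metis
  qed
qed

text \<open>\<open>lam_parent\<close> of a child is \<open>lam C\<close> of its parent, so
  consecutive increments cancel.\<close>

lemma sum_chain:
  assumes "B \<in> all_balls" "N \<in> all_balls" "B \<subseteq> N"
  shows "(\<Sum>T\<in>chain B N. incr F T) = F (lam_parent N) - F (lam_parent B)"
  using assms
proof (induction rule: ball_chain_induct)
  case base
  have "chain B B = {}" by (auto simp: chain_def)
  thus ?case by simp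
next
  case (step N N')
  have "B \<subset> N" using step by blast
  hence "chain B N = insert N (chain B N')" using chain_pred assms(1) step by metis
  moreover have "N \<notin> chain B N'" using step by (auto simp: chain_def)
  moreover have "lam_parent N' = lam C N" using lam_parent_pred step by blast
  ultimately show ?case using step finite_chain[OF assms(1), of N'] by (simp add: incr_def)
qed

text \<open>A bound on the variation of F by a decreasing G. Only values on \<open>Lam\<close>
  enter, so F may be complex and may have poles elsewhere, as 1 / (z - s) has.\<close>

definition dominated :: "(real \<Rightarrow> 'b::real_normed_vector) \<Rightarrow> (real \<Rightarrow> real) \<Rightarrow> bool" where
  "dominated F G \<longleftrightarrow> (\<forall>a\<in>Lam. 0 \<le> G a) \<and> (\<forall>a\<in>Lam. \<forall>b\<in>Lam. a \<le> b \<longrightarrow> norm (F a - F b) \<le> G a - G b)"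

lemma dominated_incr: "dominated F G \<Longrightarrow> T \<in> ns_balls \<Longrightarrow> norm (incr F T) \<le> incr G T"
  by (simp add: dominated_def incr_def lam_parent_le_lam ns_balls_all)

lemma dominated_mono: "dominated F G \<Longrightarrow> a \<in> Lam \<Longrightarrow> b \<in> Lam \<Longrightarrow> a \<le> b \<Longrightarrow> G b \<le> G a"
  unfolding dominated_def by (smt (verit) norm_ge_zero)

lemma dominated_incr_nonneg: "dominated F G \<Longrightarrow> T \<in> ns_balls \<Longrightarrow> 0 \<le> incr G T"
  using dominated_incr norm_ge_zero order_trans by blast

lemma finite_chain_top:
  assumes "finite \<F>" "\<F> \<noteq> {}" "\<F> \<subseteq> all_balls" "\<And>T. T \<in> \<F> \<Longrightarrow> x \<in> (T::'a set)"
  obtains N where "N \<in> \<F>" "\<And>T. T \<in> \<F> \<Longrightarrow> T \<subseteq> N"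
proof -
  obtain N where N: "N \<in> \<F>" "\<And>T. T \<in> \<F> \<Longrightarrow> N \<subseteq> T \<Longrightarrow> N = T"
    using finite_has_maximal[OF assms(1,2)] by metis
  have "T \<subseteq> N" if "T \<in> \<F>" for T using balls_nested[of T N] assms N that by blast
  thus thesis using that N by blast
qed

lemma finite_chain_bot:
  assumes "finite \<F>" "\<F> \<noteq> {}" "\<F> \<subseteq> all_balls" "\<And>T. T \<in> \<F> \<Longrightarrow> x \<in> (T::'a set)"
  obtains S where "S \<in> \<F>" "\<And>T. T \<in> \<F> \<Longrightarrow> S \<subseteq> T"
proof -
  obtain N where N: "N \<in> \<F>" "\<And>T. T \<in> \<F> \<Longrightarrow> T \<subseteq> N \<Longrightarrow> N = T"
    using finite_has_minimal[OF assms(1,2)] by metis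
  have "N \<subseteq> T" if "T \<in> \<F>" for T using balls_nested[of T N] assms N that by blast
  thus thesis using that N by blast
qed

text \<open>Filling up the finite family to a whole chain adds only nonnegative increments, and the
  chain telescopes.\<close>

lemma sum_incr_up_le:
  assumes "dominated F G" "B \<in> all_balls" "finite \<F>" "\<F> \<subseteq> up B"
  shows "(\<Sum>T\<in>\<F>. incr G T) \<le> G 0 - G (lam_parent B)"
proof (cases "\<F> = {}")
  case True
  thus ?thesis using dominated_mono[OF assms(1), of 0 "lam_parent B"] assms(2) by simp
next
  case False
  obtain x where x: "x \<in> B" using balls_nonempty assms by blast
  obtain N where N: "N \<in> \<F>" "\<And>T. T \<in> \<F> \<Longrightarrow> T \<subseteq> N"
    by (rule finite_chain_top[OF assms(3) False, of x]) (use assms up_all up_sub x in blast)+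
  have Na: "N \<in> all_balls" "B \<subseteq> N" using N assms up_all up_sub by blast+
  have "(\<Sum>T\<in>\<F>. incr G T) \<le> (\<Sum>T\<in>chain B N. incr G T)"
  proof (rule sum_mono2)
    show "finite (chain B N)" using finite_chain assms Na by blast
    show "\<F> \<subseteq> chain B N" using N assms by (auto simp: chain_def up_def)
    fix T assume "T \<in> chain B N - \<F>"
    thus "0 \<le> incr G T" using dominated_incr_nonneg assms by (auto simp: chain_def)
  qed
  also have "\<dots> = G (lam_parent N) - G (lam_parent B)" using sum_chain Na assms by blast
  also have "\<dots> \<le> G 0 - G (lam_parent B)" using dominated_mono[OF assms(1), of 0 "lam_parent N"] Na by simp
  finally show ?thesis .
qed

text \<open>Here the lowest ball S of the family contributes too, so the telescoped sum ends at
  \<open>lam C S\<close>, where the lower bound g is applied.\<close>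

lemma sum_incr_point_le:
  assumes "dominated F G" "finite \<F>" "\<F> \<subseteq> {T \<in> ns_balls. x \<in> T}" "g \<le> G 0"
    "\<And>T. T \<in> ns_balls \<Longrightarrow> x \<in> T \<Longrightarrow> g \<le> G (lam C T)"
  shows "(\<Sum>T\<in>\<F>. incr G T) \<le> G 0 - g"
proof (cases "\<F> = {}")
  case True
  thus ?thesis using assms by simp
next
  case False
  have all: "\<F> \<subseteq> all_balls" "\<And>T. T \<in> \<F> \<Longrightarrow> x \<in> T" using assms(3) ns_balls_all by blast+
  obtain N where N: "N \<in> \<F>" "\<And>T. T \<in> \<F> \<Longrightarrow> T \<subseteq> N"
    using finite_chain_top[OF assms(2) False all] by metis
  obtain S where S: "S \<in> \<F>" "\<And>T. T \<in> \<F> \<Longrightarrow> S \<subseteq> T"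
    using finite_chain_bot[OF assms(2) False all] by metis
  have NS: "N \<in> all_balls" "S \<in> all_balls" "S \<subseteq> N" "S \<in> ns_balls" "x \<in> S"
    using N S all assms by blast+
  have "(\<Sum>T\<in>\<F>. incr G T) \<le> (\<Sum>T\<in>insert S (chain S N). incr G T)"
  proof (rule sum_mono2)
    show "finite (insert S (chain S N))" using finite_chain NS by blast
    show "\<F> \<subseteq> insert S (chain S N)" using N S assms by (auto simp: chain_def)
    fix T assume "T \<in> insert S (chain S N) - \<F>"
    thus "0 \<le> incr G T" using dominated_incr_nonneg assms NS by (auto simp: chain_def)
  qed
  also have "\<dots> = incr G S + (\<Sum>T\<in>chain S N. incr G T)"
    using finite_chain NS by (intro sum.insert) (auto simp: chain_def)
  also have "\<dots> = G (lam_parent N) - G (lam C S)" using sum_chain[of S N G] NS by (simp add: incr_def)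
  also have "\<dots> \<le> G 0 - g" 
    using dominated_mono[OF assms(1), of 0 "lam_parent N"] NS assms(5)[of S] by simp
  finally show ?thesis .
qed

lemma summable_norm_incr:
  assumes "dominated F G" "I \<subseteq> ns_balls" "\<And>\<F>. finite \<F> \<Longrightarrow> \<F> \<subseteq> I \<Longrightarrow> (\<Sum>T\<in>\<F>. incr G T) \<le> K"
  shows "(\<lambda>T. norm (incr F T)) summable_on I" "incr G summable_on I" "infsum (incr G) I \<le> K"
    "(\<Sum>\<^sub>\<infinity>T\<in>I. norm (incr F T)) \<le> K"
proof -
  have nn: "0 \<le> incr G T" if "T \<in> I" for T using dominated_incr_nonneg assms that by blast
  show G: "incr G summable_on I"
    using assms(3) by (intro nonneg_bdd_above_summable_on bdd_aboveI2[where M=K] nn) auto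
  show F: "(\<lambda>T. norm (incr F T)) summable_on I"
    using G by (rule summable_on_comparison_test) (use dominated_incr[OF assms(1)] assms(2) in auto)
  show i: "infsum (incr G) I \<le> K" using assms(3) G by (intro infsum_le_finite_sums) auto
  have "(\<Sum>\<^sub>\<infinity>T\<in>I. norm (incr F T)) \<le> infsum (incr G) I"
    using F G by (intro infsum_mono) (use dominated_incr[OF assms(1)] assms(2) in auto)
  thus "(\<Sum>\<^sub>\<infinity>T\<in>I. norm (incr F T)) \<le> K" using i by simp
qed

lemma summable_incr_up:
  assumes "dominated F G" "B \<in> all_balls"
  shows "(\<lambda>T. norm (incr F T)) summable_on up B" "incr G summable_on up B"
    "infsum (incr G) (up B) \<le> G 0 - G (lam_parent B)" "(\<Sum>\<^sub>\<infinity>T\<in>up B. norm (incr F T)) \<le> G 0 - G (lam_parent B)"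
proof -
  have up: "up B \<subseteq> ns_balls" by (auto simp: up_def)
  note s = summable_norm_incr[OF assms(1) up sum_incr_up_le[OF assms]]
  show "(\<lambda>T. norm (incr F T)) summable_on up B" "incr G summable_on up B"
    "infsum (incr G) (up B) \<le> G 0 - G (lam_parent B)" "(\<Sum>\<^sub>\<infinity>T\<in>up B. norm (incr F T)) \<le> G 0 - G (lam_parent B)"
    using s by auto
qed

text \<open>The value of \<open>F\<close> at \<open>\<lambda> {x}\<close>. At a limit point \<open>\<lambda> {x} = \<infinity>\<close>, whereas \<open>lam C {x}\<close>
  is the junk value \<open>0\<close> of a divergent sum; the limit \<open>c\<close> of \<open>F\<close> at infinity is used there.\<close>

definition phi :: "(real \<Rightarrow> 'b::real_normed_vector) \<Rightarrow> 'b \<Rightarrow> 'a \<Rightarrow> 'b" where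
  "phi F c x = (if x islimpt UNIV then c else F (lam C {x}))"

lemma isolated_lam_Lam: "\<not> x islimpt UNIV \<Longrightarrow> lam C {x} \<in> Lam"
  using isolated_ball[of x] lam_non_ns[of "{x}"] by (simp add: ns_balls_def is_singleton_def)

lemma lam_at_limpt:
  assumes "x islimpt UNIV" "e > 0"
  shows "filterlim (\<lambda>n. lam C (ball x (e / Suc n))) at_top sequentially"
proof (subst filterlim_at_top, intro allI)
  fix M :: real
  obtain r where r: "r > 0" "\<And>B. B \<in> all_balls \<Longrightarrow> x \<in> B \<Longrightarrow> B \<subseteq> ball x r \<Longrightarrow> M < lam C B"
    using choice assms(1) unfolding choice_function_def by meson
  have "(\<lambda>n. e / real (Suc n)) \<longlonglongrightarrow> 0"
    using LIMSEQ_Suc[OF lim_const_over_n[of e]] by simp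
  hence "\<forall>\<^sub>F n in sequentially. e / real (Suc n) < r" using r(1) by (rule order_tendstoD)
  thus "\<forall>\<^sub>F n in sequentially. M \<le> lam C (ball x (e / Suc n))"
  proof eventually_elim
    case (elim n)
    have "ball x (e / Suc n) \<subseteq> ball x r" using elim by (intro subset_ball) simp
    thus ?case using r(2)[of "ball x (e / Suc n)"] assms(2) by (simp add: less_imp_le)
  qed
qed

lemma phi_le:
  assumes "dominated F G" "\<And>a. a \<in> Lam \<Longrightarrow> g \<le> G a"
  shows "phi G g x \<le> G 0" "T \<in> ns_balls \<Longrightarrow> x \<in> T \<Longrightarrow> phi G g x \<le> G (lam C T)"
proof -
  show "phi G g x \<le> G 0"
    using assms dominated_mono[OF assms(1), of 0 "lam C {x}"] isolated_lam_Lam[of x]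
    by (auto simp: phi_def)
  assume T: "T \<in> ns_balls" "x \<in> T"
  show "phi G g x \<le> G (lam C T)"
  proof (cases "x islimpt UNIV")
    case False
    have "lam C T \<le> lam C {x}" using T False by (intro lam_mono isolated_ball ns_balls_all) auto
    thus ?thesis using False dominated_mono[OF assms(1)] T isolated_lam_Lam by (simp add: phi_def)
  qed (use assms T in \<open>auto simp: phi_def\<close>)
qed

text \<open>The balls from x up to B telescope. At an isolated point they form a finite chain above
  the ball {x}. At a limit point \<open>lam C\<close> tends to infinity along balls shrinking to x,
  so the lower end of the telescoped sum tends to the limit c of F.\<close>

lemma has_sum_incr_point:
  fixes F :: "real \<Rightarrow> 'b::banach"
  assumes dom: "dominated F G" and lim: "(F \<longlongrightarrow> c) at_top" and B: "B \<in> all_balls" "x \<in> B"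
  shows "(incr F has_sum (F (lam_parent B) - phi F c x)) {T \<in> ns_balls. x \<in> T \<and> T \<subseteq> B}"
proof (cases "x islimpt UNIV")
  case False
  hence "{T \<in> ns_balls. x \<in> T \<and> T \<subseteq> B} = chain {x} B"
    by (auto simp: chain_def ns_balls_def is_singleton_def)
  moreover have "(\<Sum>T\<in>chain {x} B. incr F T) = F (lam_parent B) - F (lam_parent {x})"
    using sum_chain isolated_ball[OF False] B by auto
  moreover have "lam C {x} = lam_parent {x}" by (rule lam_non_ns) (simp add: ns_balls_def is_singleton_def)
  ultimately show ?thesis using False finite_chain[OF isolated_ball[OF False] B(1)]
    by (intro has_sum_finiteI) (auto simp: phi_def)
next
  case True
  let ?I = "{T \<in> ns_balls. x \<in> T \<and> T \<subseteq> B}"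
  have "(\<lambda>T. norm (incr F T)) summable_on ?I"
  proof (rule summable_norm_incr(1)[OF dom])
    fix \<F> assume "finite \<F>" "\<F> \<subseteq> ?I"
    thus "sum (incr G) \<F> \<le> G 0 - 0"
      using dom by (intro sum_incr_point_le[OF dom, of _ x]) (auto simp: dominated_def)
  qed auto
  hence sm: "incr F summable_on ?I" by (rule abs_summable_summable)
  obtain e where e: "e > 0" "B = ball x e" using all_balls_centered B by metis
  define S where "S = (\<lambda>n. ball x (e / Suc n))"
  have Sa: "S n \<in> all_balls" "x \<in> S n" for n using e by (auto simp: S_def)
  have Sn: "S n \<in> ns_balls" for n using limpt_ball_ns True Sa by blast
  have SB: "S n \<subseteq> B" for n
    unfolding S_def e(2) using e(1) by (intro subset_ball) (simp add: divide_le_eq)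
  define I where "I = (\<lambda>n. insert (S n) (chain (S n) B))"
  have finI: "finite (I n)" for n using finite_chain Sa B by (simp add: I_def)
  have Isub: "I n \<subseteq> ?I" for n using Sa Sn SB by (auto simp: I_def chain_def)
  have ev: "\<forall>\<^sub>F n in sequentially. T \<in> I n" if T: "T \<in> ?I" for T
  proof -
    obtain r where r: "r > 0" "T = ball x r" using all_balls_centered[of T x] ns_balls_all[of T] T by blast
    have "(\<lambda>n. e / real (Suc n)) \<longlonglongrightarrow> 0" using LIMSEQ_Suc[OF lim_const_over_n[of e]] by simp
    hence "\<forall>\<^sub>F n in sequentially. e / real (Suc n) < r" using r(1) by (rule order_tendstoD)
    thus ?thesis
    proof eventually_elim
      case (elim n)
      have "S n \<subseteq> T" unfolding S_def r(2) using elim by (intro subset_ball) simp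
      thus ?case using T by (auto simp: I_def chain_def)
    qed
  qed
  \<comment> \<open>Every ball around x contains some S n, so the chains I n eventually include any
    given finite set of balls; the sum, already known to exist, may be computed along them.\<close>
  have "filterlim I (finite_subsets_at_top ?I) sequentially"
    unfolding filterlim_iff
  proof (intro allI impI)
    fix P assume "eventually P (finite_subsets_at_top ?I)"
    then obtain X where X: "finite X" "X \<subseteq> ?I" "\<And>Y. finite Y \<Longrightarrow> X \<subseteq> Y \<Longrightarrow> Y \<subseteq> ?I \<Longrightarrow> P Y"
    proof -
      have "\<exists>X. finite X \<and> X \<subseteq> ?I \<and> (\<forall>Y. finite Y \<and> X \<subseteq> Y \<and> Y \<subseteq> ?I \<longrightarrow> P Y)"
        using \<open>eventually P (finite_subsets_at_top ?I)\<close> by (simp only: eventually_finite_subsets_at_top)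
      thus thesis using that by (elim exE conjE) presburger
    qed
    have "\<forall>\<^sub>F n in sequentially. \<forall>T\<in>X. T \<in> I n"
      using X ev by (intro eventually_ball_finite) blast+
    thus "\<forall>\<^sub>F n in sequentially. P (I n)"
    proof eventually_elim
      case (elim n)
      show ?case by (rule X(3)[OF finI _ Isub]) (use elim in blast)
    qed
  qed
  from filterlim_compose[OF infsum_tendsto[OF sm] this]
  have "(\<lambda>n. sum (incr F) (I n)) \<longlonglongrightarrow> infsum (incr F) ?I" .
  moreover have "sum (incr F) (I n) = F (lam_parent B) - F (lam C (S n))" for n
    unfolding I_def using finite_chain[OF Sa(1) B(1)] sum_chain[OF Sa(1) B(1) SB, of F]
    by (subst sum.insert) (auto simp: chain_def incr_def)
  moreover have "(\<lambda>n. F (lam_parent B) - F (lam C (S n))) \<longlonglongrightarrow> F (lam_parent B) - c"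
    unfolding S_def using lam_at_limpt[OF True e(1)]
    by (intro tendsto_intros filterlim_compose[OF lim])
  ultimately have "infsum (incr F) ?I = F (lam_parent B) - c" using LIMSEQ_unique by auto
  thus ?thesis using sm True by (simp add: has_sum_iff phi_def)
qed

text \<open>The action of \<open>F(L)\<close> on the ball means \<open>p B\<close> of a function.\<close>

definition multiplier :: "(real \<Rightarrow> complex) \<Rightarrow> ('a set \<Rightarrow> complex) \<Rightarrow> 'a set \<Rightarrow> complex" where
  "multiplier F p B = F (lam_parent B) * p B + (\<Sum>\<^sub>\<infinity>T\<in>up B. incr F T * p T)"

text \<open>Weaker than \<open>dominated\<close>, so that \<open>lam_id\<close> qualifies: above a
  fixed ball the values of \<open>lam\<close> are bounded.\<close>

definition incr_summable :: "(real \<Rightarrow> complex) \<Rightarrow> bool" where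
  "incr_summable F \<longleftrightarrow> (\<forall>B\<in>all_balls. (\<lambda>T. norm (incr F T)) summable_on up B)"

text \<open>The bound may depend on B. Means of an L^q function over the balls containing B are
  bounded in terms of the measure of B, and in general not uniformly in B.\<close>

definition bounded_above :: "('a set \<Rightarrow> complex) \<Rightarrow> bool" where
  "bounded_above p \<longleftrightarrow> (\<forall>B\<in>all_balls. \<exists>K. \<forall>T\<in>all_balls. B \<subseteq> T \<longrightarrow> norm (p T) \<le> K)"

lemma bounded_aboveE:
  assumes "bounded_above p" "B \<in> all_balls"
  obtains K where "K \<ge> 0" "\<And>T. T \<in> all_balls \<Longrightarrow> B \<subseteq> T \<Longrightarrow> norm (p T) \<le> K"
proof -
  obtain K where K: "\<And>T. T \<in> all_balls \<Longrightarrow> B \<subseteq> T \<Longrightarrow> norm (p T) \<le> K"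
    using assms unfolding bounded_above_def by meson
  hence "norm (p B) \<le> K" using assms by blast
  hence "K \<ge> 0" using norm_ge_zero order_trans by blast
  thus thesis using that K by blast
qed

lemma dominated_incr_summable: "dominated F G \<Longrightarrow> incr_summable F"
  unfolding incr_summable_def using summable_incr_up(1) by (auto simp: up_def)

lemma multiplier_summable:
  assumes "incr_summable F" "bounded_above p" "B \<in> all_balls"
  shows "(\<lambda>T. norm (incr F T * p T)) summable_on up B" "(\<lambda>T. incr F T * p T) summable_on up B"
proof -
  obtain K where K: "\<And>T. T \<in> all_balls \<Longrightarrow> B \<subseteq> T \<Longrightarrow> norm (p T) \<le> K"
    using bounded_aboveE[OF assms(2,3)] by metis
  have "(\<lambda>T. norm (incr F T) * K) summable_on up B"
    using assms by (intro summable_on_cmult_left) (auto simp: incr_summable_def)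
  thus "(\<lambda>T. norm (incr F T * p T)) summable_on up B"
    by (rule summable_on_comparison_test)
       (use K in \<open>auto simp: norm_mult up_all up_le intro!: mult_left_mono\<close>)
  thus "(\<lambda>T. incr F T * p T) summable_on up B" by (rule abs_summable_summable)
qed

lemma multiplier_cong:
  assumes "B \<in> all_balls" "\<And>a. a \<in> Lam \<Longrightarrow> F a = F' a" "\<And>T. T \<in> all_balls \<Longrightarrow> p T = p' T"
  shows "multiplier F p B = multiplier F' p' B"
  unfolding multiplier_def incr_def using assms
  by (intro arg_cong2[where f="(+)"] infsum_cong) (auto simp: up_all up_ns)

lemma multiplier_linear:
  assumes "incr_summable F" "bounded_above p" "bounded_above p'" "B \<in> all_balls"
  shows "multiplier F (\<lambda>T. c * p T + p' T) B = c * multiplier F p B + multiplier F p' B"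
proof -
  have "(\<Sum>\<^sub>\<infinity>T\<in>up B. incr F T * (c * p T + p' T)) = (\<Sum>\<^sub>\<infinity>T\<in>up B. c * (incr F T * p T) + incr F T * p' T)"
    by (simp add: algebra_simps)
  also have "\<dots> = c * (\<Sum>\<^sub>\<infinity>T\<in>up B. incr F T * p T) + (\<Sum>\<^sub>\<infinity>T\<in>up B. incr F T * p' T)"
    using multiplier_summable assms by (subst infsum_add) (auto intro: summable_on_cmult_right simp: infsum_cmult_right')
  finally show ?thesis by (simp add: multiplier_def algebra_simps)
qed

lemma multiplier_affine: "multiplier (\<lambda>s. a * F s + b) p B = a * multiplier F p B + b * p B"
proof -
  have "(\<Sum>\<^sub>\<infinity>T\<in>up B. incr (\<lambda>s. a * F s + b) T * p T) = (\<Sum>\<^sub>\<infinity>T\<in>up B. a * (incr F T * p T))"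
    by (intro infsum_cong) (simp add: incr_def algebra_simps)
  thus ?thesis by (simp add: multiplier_def infsum_cmult_right' algebra_simps)
qed

text \<open>A product rule: the increment of G * F at S is the increment of G times F at
  \<open>lam_parent S\<close>, plus G at \<open>lam C S\<close> times the increment of F. The double
  sum over pairs T properly below S is exchanged, so that the increments of G over T telescope and,
  together with the term G at \<open>lam_parent B\<close>, leave the factor G at
  \<open>lam C S\<close>.\<close>

lemma multiplier_compose:
  assumes G: "incr_summable G" and F: "incr_summable F" and p: "bounded_above p" and B: "B \<in> all_balls"
  shows "multiplier G (multiplier F p) B = multiplier (\<lambda>s. G s * F s) p B"
proof -
  define f where "f T S = (if T \<subset> S then incr G T * (incr F S * p S) else 0)" for T S
  have sF: "(\<lambda>S. norm (incr F S * p S)) summable_on up B" using multiplier_summable F p B by blast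
  have sG: "(\<lambda>S. norm (incr G S)) summable_on up B" using G B by (simp add: incr_summable_def)
  have "(\<lambda>z. norm (incr G (fst z) * (incr F (snd z) * p (snd z)))) summable_on up B \<times> up B"
  proof (rule Infinite_Sum.abs_summable_on_Sigma_iff[THEN iffD2], intro conjI ballI)
    fix T assume "T \<in> up B"
    show "(\<lambda>S. norm (incr G (fst (T, S)) * (incr F (snd (T, S)) * p (snd (T, S))))) summable_on up B"
      using summable_on_cmult_right[OF sF, of "norm (incr G T)"] by (simp add: norm_mult)
  next
    have "(\<lambda>T. norm (incr G T) * (\<Sum>\<^sub>\<infinity>S\<in>up B. norm (incr F S * p S))) summable_on up B"
      by (rule summable_on_cmult_left[OF sG])
    thus "(\<lambda>T. norm (\<Sum>\<^sub>\<infinity>S\<in>up B. norm (incr G (fst (T, S)) * (incr F (snd (T, S)) * p (snd (T, S)))))) summable_on up B"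
      by (simp add: norm_mult infsum_cmult_right' infsum_nonneg abs_mult)
  qed
  hence "(\<lambda>z. norm (case z of (T, S) \<Rightarrow> f T S)) summable_on up B \<times> up B"
    by (rule summable_on_comparison_test) (auto simp: f_def)
  hence swap: "(\<Sum>\<^sub>\<infinity>T\<in>up B. \<Sum>\<^sub>\<infinity>S\<in>up B. f T S) = (\<Sum>\<^sub>\<infinity>S\<in>up B. \<Sum>\<^sub>\<infinity>T\<in>up B. f T S)"
    and sm: "(\<lambda>(T, S). f T S) summable_on up B \<times> up B"
    by (auto intro!: infsum_swap_banach abs_summable_summable)
  have inner1: "(\<Sum>\<^sub>\<infinity>S\<in>up B. f T S) = incr G T * (\<Sum>\<^sub>\<infinity>S\<in>up T. incr F S * p S)" if "T \<in> up B" for T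
  proof -
    have "(\<Sum>\<^sub>\<infinity>S\<in>up B. f T S) = (\<Sum>\<^sub>\<infinity>S\<in>up T. incr G T * (incr F S * p S))"
      using that by (intro infsum_cong_neutral) (auto simp: f_def up_def)
    thus ?thesis by (simp add: infsum_cmult_right')
  qed
  have inner2: "(\<Sum>\<^sub>\<infinity>T\<in>up B. f T S) = (G (lam C S) - G (lam_parent B)) * (incr F S * p S)" if S: "S \<in> up B" for S
  proof -
    have Sa: "S \<in> all_balls" "S \<in> ns_balls" "B \<subset> S" using S up_all up_sub up_ns by blast+
    have fin: "finite (chain B S)" by (rule finite_chain[OF B Sa(1)])
    have "(\<Sum>\<^sub>\<infinity>T\<in>up B. f T S) = (\<Sum>\<^sub>\<infinity>T\<in>chain B S - {S}. incr G T * (incr F S * p S))"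
      by (intro infsum_cong_neutral) (auto simp: f_def up_def chain_def)
    also have "\<dots> = (\<Sum>T\<in>chain B S - {S}. incr G T) * (incr F S * p S)"
      using fin by (simp add: sum_distrib_right)
    \<comment> \<open>T runs strictly below S; leaving out S itself makes the sum end at
      \<open>lam C S\<close> and not at \<open>lam_parent S\<close>.\<close>
    also have "(\<Sum>T\<in>chain B S - {S}. incr G T) = (\<Sum>T\<in>chain B S. incr G T) - incr G S"
      using Sa fin by (simp add: sum_diff1 chain_def)
    also have "\<dots> = G (lam C S) - G (lam_parent B)" using sum_chain[OF B Sa(1), of G] Sa by (simp add: incr_def)
    finally show ?thesis .
  qed
  have sumG1: "(\<lambda>T. \<Sum>\<^sub>\<infinity>S\<in>up B. f T S) summable_on up B"
    using sm by (rule summable_on_Sigma_banach)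
  have sumG2: "(\<lambda>S. \<Sum>\<^sub>\<infinity>T\<in>up B. f T S) summable_on up B"
  proof -
    have "(\<lambda>(S, T). f T S) summable_on up B \<times> up B"
      using sm by (subst summable_on_swap) (simp add: case_prod_unfold)
    from summable_on_Sigma_banach[OF this] show ?thesis by simp
  qed
  have sFB: "(\<lambda>T. G (lam_parent B) * (incr F T * p T)) summable_on up B"
    using multiplier_summable(2)[OF F p B] by (rule summable_on_cmult_right)
  \<comment> \<open>The increments of F above B have a finite sum, so F at
    \<open>lam_parent T\<close> stays bounded for T above B.\<close>
  have ex: "(\<lambda>T. incr G T * (F (lam_parent T) * p T)) summable_on up B" 
  proof -
    obtain N' where bF: "\<And>T. T \<in> up B \<Longrightarrow> norm (F (lam_parent T)) \<le> N'"
    proof -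
      have "norm (F (lam_parent T) - F (lam_parent B)) \<le> (\<Sum>\<^sub>\<infinity>S\<in>up B. norm (incr F S))" if "T \<in> up B" for T
      proof -
        have Ta: "T \<in> all_balls" "B \<subset> T" using that up_all up_sub by blast+
        have "F (lam_parent T) - F (lam_parent B) = (\<Sum>S\<in>chain B T. incr F S)"
          using sum_chain[OF B Ta(1), of F] Ta by simp
        hence "norm (F (lam_parent T) - F (lam_parent B)) \<le> (\<Sum>S\<in>chain B T. norm (incr F S))"
          by (simp add: norm_sum)
        also have "\<dots> \<le> (\<Sum>\<^sub>\<infinity>S\<in>up B. norm (incr F S))"
          using F B finite_chain[OF B Ta(1)]
          by (intro finite_sum_le_infsum) (auto simp: incr_summable_def chain_def up_def)
        finally show ?thesis .
      qed
      hence "norm (F (lam_parent T)) \<le> norm (F (lam_parent B)) + (\<Sum>\<^sub>\<infinity>S\<in>up B. norm (incr F S))" if "T \<in> up B" for T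
        using that norm_triangle_sub[of "F (lam_parent T)" "F (lam_parent B)"] by fastforce
      thus thesis using that by blast
    qed
    obtain K where K: "K \<ge> 0" "\<And>T. T \<in> all_balls \<Longrightarrow> B \<subseteq> T \<Longrightarrow> norm (p T) \<le> K"
      using bounded_aboveE[OF p B] by metis
    have "(\<lambda>T. norm (incr G T) * (N' * K)) summable_on up B" using sG by (rule summable_on_cmult_left)
    hence "(\<lambda>T. norm (incr G T * (F (lam_parent T) * p T))) summable_on up B"
    proof (rule summable_on_comparison_test)
      fix T assume T: "T \<in> up B"
      have "norm (F (lam_parent T)) * norm (p T) \<le> N' * K"
        using bF[OF T] K(1) K(2)[OF up_all[OF T] up_le[OF T]] by (intro mult_mono) (auto intro: order_trans[OF norm_ge_zero])
      thus "norm (incr G T * (F (lam_parent T) * p T)) \<le> norm (incr G T) * (N' * K)"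
        by (simp add: norm_mult mult_left_mono)
    qed auto
    thus ?thesis by (rule abs_summable_summable)
  qed
  have "(\<Sum>\<^sub>\<infinity>T\<in>up B. incr G T * multiplier F p T)
      = (\<Sum>\<^sub>\<infinity>T\<in>up B. incr G T * (F (lam_parent T) * p T) + (\<Sum>\<^sub>\<infinity>S\<in>up B. f T S))"
    by (intro infsum_cong) (simp add: multiplier_def inner1 algebra_simps)
  also have "\<dots> = (\<Sum>\<^sub>\<infinity>T\<in>up B. incr G T * (F (lam_parent T) * p T)) + (\<Sum>\<^sub>\<infinity>S\<in>up B. \<Sum>\<^sub>\<infinity>T\<in>up B. f T S)"
    using ex sumG1 by (simp add: infsum_add swap)
  finally have "multiplier G (multiplier F p) B = G (lam_parent B) * F (lam_parent B) * p B
     + (\<Sum>\<^sub>\<infinity>T\<in>up B. G (lam_parent B) * (incr F T * p T)) 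
     + ((\<Sum>\<^sub>\<infinity>T\<in>up B. incr G T * (F (lam_parent T) * p T)) + (\<Sum>\<^sub>\<infinity>S\<in>up B. \<Sum>\<^sub>\<infinity>T\<in>up B. f T S))"
    by (subst multiplier_def) (simp only: multiplier_def[of F p B] infsum_cmult_right' distrib_left mult.assoc add.assoc)
  also have "\<dots> = G (lam_parent B) * F (lam_parent B) * p B + (\<Sum>\<^sub>\<infinity>T\<in>up B. G (lam_parent B) * (incr F T * p T)
     + (incr G T * (F (lam_parent T) * p T) + (\<Sum>\<^sub>\<infinity>S\<in>up B. f S T)))"
    using sFB ex sumG2 by (simp add: infsum_add summable_on_add)
  also have "(\<Sum>\<^sub>\<infinity>T\<in>up B. G (lam_parent B) * (incr F T * p T)
     + (incr G T * (F (lam_parent T) * p T) + (\<Sum>\<^sub>\<infinity>S\<in>up B. f S T)))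
     = (\<Sum>\<^sub>\<infinity>T\<in>up B. incr (\<lambda>s. G s * F s) T * p T)"
    by (intro infsum_cong) (simp add: inner2 incr_def algebra_simps)
  finally show ?thesis by (simp add: multiplier_def)
qed

text \<open>The right-hand side is small when G is nearly constant up to
  \<open>lam_parent B\<close>; this yields the limit of multipliers as t tends to 0 in
  \<open>generator_LC\<close>.\<close>

lemma multiplier_bound:
  assumes "dominated F G" "B \<in> all_balls" "\<And>T. T \<in> all_balls \<Longrightarrow> B \<subseteq> T \<Longrightarrow> norm (p T) \<le> K"
  shows "norm (multiplier F p B - F (lam_parent B) * p B) \<le> (G 0 - G (lam_parent B)) * K"
proof -
  have K: "K \<ge> 0" using assms(2,3) norm_ge_zero order_trans by blast
  have s: "(\<lambda>T. norm (incr F T)) summable_on up B" "(\<Sum>\<^sub>\<infinity>T\<in>up B. norm (incr F T)) \<le> G 0 - G (lam_parent B)"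
    using summable_incr_up(1,4)[OF assms(1,2)] by auto
  have s1: "(\<lambda>T. norm (incr F T) * K) summable_on up B" using s(1) by (rule summable_on_cmult_left)
  have le: "norm (incr F T * p T) \<le> norm (incr F T) * K" if "T \<in> up B" for T
    using assms(3)[OF up_all[OF that] up_le[OF that]] by (auto simp: norm_mult intro!: mult_left_mono)
  have s2: "(\<lambda>T. norm (incr F T * p T)) summable_on up B"
    using s1 by (rule summable_on_comparison_test) (use le in auto)
  have "norm (multiplier F p B - F (lam_parent B) * p B) \<le> (\<Sum>\<^sub>\<infinity>T\<in>up B. norm (incr F T * p T))"
    unfolding multiplier_def using norm_infsum_bound[OF s2] by simp
  also have "\<dots> \<le> (\<Sum>\<^sub>\<infinity>T\<in>up B. norm (incr F T) * K)" using s1 s2 le by (intro infsum_mono) auto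
  also have "\<dots> = (\<Sum>\<^sub>\<infinity>T\<in>up B. norm (incr F T)) * K" by (simp add: infsum_cmult_left')
  also have "\<dots> \<le> (G 0 - G (lam_parent B)) * K" using s(2) K by (intro mult_right_mono)
  finally show ?thesis .
qed

section \<open>Averaging kernels\<close>

lemma sigma_finite_m: "sigma_finite_measure m"
proof
  have "x \<in> \<Union>all_balls" for x :: 'a
    by (rule UnionI[of "ball x 1"]) auto
  hence "\<Union>(all_balls :: 'a set set) = space m" by auto
  moreover have "all_balls \<subseteq> sets m" using balls_sets by blast
  moreover have "\<forall>a\<in>all_balls. emeasure m a \<noteq> \<infinity>" 
  proof
    fix a :: "'a set" assume "a \<in> all_balls"
    thus "emeasure m a \<noteq> \<infinity>" using emeasure_ball_finite[of a] by auto
  qed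
  ultimately show "\<exists>A. countable A \<and> A \<subseteq> sets m \<and> \<Union>A = space m \<and> (\<forall>a\<in>A. emeasure m a \<noteq> \<infinity>)"
    using countable_all_balls by (intro exI[of _ all_balls] conjI) assumption+
qed

lemma pair_sigma_finite_m: "I \<subseteq> (ns_balls :: 'a set set) \<Longrightarrow> pair_sigma_finite (count_space I) m"
  by (intro pair_sigma_finite.intro sigma_finite_measure_count_space_countable sigma_finite_m
      countable_subset[OF _ countable_ns_balls])

lemma ns_sets [measurable]: "T \<in> ns_balls \<Longrightarrow> T \<in> sets m"
  using ns_balls_all balls_sets by blast

abbreviation mean :: "('a \<Rightarrow> complex) \<Rightarrow> 'a set \<Rightarrow> complex" where "mean u T \<equiv> ball_mean m T u"

lemma nn_integral_ns_measurable:
  assumes "\<And>T :: 'a set. T \<in> ns_balls \<Longrightarrow> f T \<in> borel_measurable m"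
  shows "(\<lambda>x. \<integral>\<^sup>+T. f T x \<partial>count_space ns_balls) \<in> borel_measurable m"
proof -
  interpret sigma_finite_measure "count_space (ns_balls :: 'a set set)"
    by (rule sigma_finite_measure_count_space_countable[OF countable_ns_balls])
  have "(\<lambda>(T, x). f T x) \<in> borel_measurable (count_space ns_balls \<Otimes>\<^sub>M m)"
    by (rule measurable_pair_measure_countable1[OF countable_ns_balls]) (simp add: assms)
  from measurable_pair_swap[OF this]
  have "case_prod (\<lambda>x T. f T x) \<in> borel_measurable (m \<Otimes>\<^sub>M count_space ns_balls)" by simp
  thus ?thesis by (rule borel_measurable_nn_integral)
qed

definition nnmean :: "('a \<Rightarrow> ennreal) \<Rightarrow> 'a set \<Rightarrow> ennreal" where
  "nnmean U T = (\<integral>\<^sup>+y. U y * indicator T y \<partial>m) / emeasure m T"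

text \<open>The kernel is the sum of a T * 1_T(x) 1_T(y) / m(T) over T, plus a diagonal part b; it
  is symmetric in x and y. Values in [0, infinity] spare all questions of convergence.\<close>

definition avg :: "('a set \<Rightarrow> ennreal) \<Rightarrow> ('a \<Rightarrow> ennreal) \<Rightarrow> ('a \<Rightarrow> ennreal) \<Rightarrow> 'a \<Rightarrow> ennreal" where
  "avg a b U x = (\<integral>\<^sup>+T. a T * indicator T x * nnmean U T \<partial>count_space ns_balls) + b x * U x"

lemma mean_eq: "mean u B = (\<integral>x. indicator B x * u x \<partial>m) / mu B"
proof -
  have "(\<lambda>x. indicat_real B x *\<^sub>R u x) = (\<lambda>x. indicator B x * u x)" by (auto simp: indicator_def)
  thus ?thesis by (simp add: ball_mean_def set_lebesgue_integral_def mu_def) (simp add: scaleR_conv_of_real)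
qed

lemma norm_mean_le: "B \<in> all_balls \<Longrightarrow> ennreal (norm (mean u B)) \<le> nnmean (\<lambda>x. ennreal (norm (u x))) B"
proof -
  assume B: "B \<in> all_balls"
  have e: "norm (indicator B x * u x) = norm (u x) * indicator B x" for x by (simp add: indicator_def)
  have "ennreal (norm (\<integral>x. indicator B x * u x \<partial>m)) \<le> (\<integral>\<^sup>+x. ennreal (norm (u x)) * indicator B x \<partial>m)"
  proof (cases "integrable m (\<lambda>x. indicator B x * u x)")
    case True
    from integral_norm_bound_ennreal[OF True] show ?thesis
      by (simp add: e ennreal_mult' ennreal_indicator)
  qed (simp add: not_integrable_integral_eq)
  hence "ennreal (norm (\<integral>x. indicator B x * u x \<partial>m)) / ennreal (mu B) \<le> nnmean (\<lambda>x. ennreal (norm (u x))) B"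
    using B by (simp add: nnmean_def emeasure_mu divide_right_mono_ennreal)
  thus ?thesis using B by (simp add: mean_eq norm_divide divide_ennreal)
qed

lemma nnmean_cmult: "U \<in> borel_measurable m \<Longrightarrow> B \<in> all_balls \<Longrightarrow> nnmean (\<lambda>x. c * U x) B = c * nnmean U B"
  by (simp add: nnmean_def mult.assoc nn_integral_cmult ennreal_times_divide)

lemma nnmean_mono: "(\<And>x. U x \<le> V x) \<Longrightarrow> nnmean U B \<le> nnmean V B"
  unfolding nnmean_def by (intro divide_right_mono_ennreal nn_integral_mono mult_right_mono) auto

lemma nnmean_add_const:
  assumes [measurable]: "U \<in> borel_measurable m" and B: "B \<in> all_balls"
  shows "nnmean (\<lambda>x. U x + k) B = nnmean U B + k"
proof -
  note [measurable] = balls_sets[OF B]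
  have "(\<integral>\<^sup>+y. (U y + k) * indicator B y \<partial>m) = (\<integral>\<^sup>+y. U y * indicator B y \<partial>m) + k * emeasure m B"
    by (simp add: distrib_right nn_integral_add nn_integral_cmult_indicator)
  moreover have "k * emeasure m B / emeasure m B = k"
    using B emeasure_ball_pos[OF B] emeasure_ball_finite[OF B]
    by (simp add: ennreal_times_divide[symmetric] ennreal_divide_self)
  ultimately show ?thesis by (simp add: nnmean_def add_divide_distrib_ennreal)
qed

lemma avg_mono: "(\<And>x. U x \<le> V x) \<Longrightarrow> avg a b U x \<le> avg a b V x"
  unfolding avg_def by (intro add_mono nn_integral_mono mult_left_mono nnmean_mono) auto

lemma avg_cmult:
  "U \<in> borel_measurable m \<Longrightarrow> avg a b (\<lambda>x. c * U x) x = c * avg a b U x"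
proof -
  assume U: "U \<in> borel_measurable m"
  have "(\<integral>\<^sup>+T. a T * indicator T x * nnmean (\<lambda>x. c * U x) T \<partial>count_space ns_balls)
     = (\<integral>\<^sup>+T. c * (a T * indicator T x * nnmean U T) \<partial>count_space ns_balls)"
    by (intro nn_integral_cong) (simp add: nnmean_cmult[OF U] ns_balls_all mult_ac)
  thus ?thesis by (simp add: avg_def nn_integral_cmult distrib_left mult_ac)
qed

lemma avg_add_const:
  assumes U: "U \<in> borel_measurable m"
  shows "avg a b (\<lambda>x. U x + k) x = avg a b U x +
    k * ((\<integral>\<^sup>+T. a T * indicator T x \<partial>count_space ns_balls) + b x)"
proof -
  have "(\<integral>\<^sup>+T. a T * indicator T x * nnmean (\<lambda>x. U x + k) T \<partial>count_space ns_balls)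
     = (\<integral>\<^sup>+T. a T * indicator T x * nnmean U T + k * (a T * indicator T x) \<partial>count_space ns_balls)"
    by (intro nn_integral_cong, subst nnmean_add_const[OF U])
      (simp_all add: ns_balls_all distrib_left mult_ac)
  thus ?thesis by (simp add: avg_def nn_integral_add nn_integral_cmult distrib_left mult_ac add_ac)
qed

text \<open>By symmetry of the kernel, integrating out x leaves at y the mass that the kernel has at
  y; Tonelli's theorem makes this an identity for every measurable U.\<close>

lemma nn_integral_avg:
  assumes [measurable]: "U \<in> borel_measurable m" "b \<in> borel_measurable m"
  shows "(\<integral>\<^sup>+x. avg a b U x \<partial>m) =
    (\<integral>\<^sup>+x. U x * ((\<integral>\<^sup>+T. a T * indicator T x \<partial>count_space ns_balls) + b x) \<partial>m)"
proof -
  have meas: "(\<lambda>x. \<integral>\<^sup>+T. f T * indicator T x * g x \<partial>count_space ns_balls) \<in> borel_measurable m"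
    if [measurable]: "g \<in> borel_measurable m" for f :: "'a set \<Rightarrow> ennreal" and g
    by (intro nn_integral_ns_measurable) auto
  have c1: "(\<integral>\<^sup>+x. indicator T x * g \<partial>m) = emeasure m T * g" if "T \<in> ns_balls" for T and g :: ennreal
    using that by (simp add: nn_integral_multc)
  have "(\<integral>\<^sup>+x. (\<integral>\<^sup>+T. a T * indicator T x * nnmean U T \<partial>count_space ns_balls) \<partial>m)
     = (\<integral>\<^sup>+T. (\<integral>\<^sup>+x. a T * indicator T x * nnmean U T \<partial>m) \<partial>count_space ns_balls)"
    by (intro nn_integral_count_space_nn_integral countable_ns_balls) auto
  also have "\<dots> = (\<integral>\<^sup>+T. (\<integral>\<^sup>+x. a T * indicator T x * U x \<partial>m) \<partial>count_space ns_balls)"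
  proof (rule nn_integral_cong)
    fix T assume "T \<in> space (count_space (ns_balls :: 'a set set))"
    hence T: "T \<in> all_balls" "T \<in> ns_balls" using ns_balls_all by auto
    note [measurable] = balls_sets[OF T(1)]
    have "emeasure m T * nnmean U T = (\<integral>\<^sup>+y. U y * indicator T y \<partial>m)"
      using emeasure_ball_pos[OF T(1)] emeasure_ball_finite[OF T(1)]
      unfolding nnmean_def
      by (simp add: ennreal_times_divide mult.commute[of "emeasure m T"] ennreal_mult_divide_eq)
    thus "(\<integral>\<^sup>+x. a T * indicator T x * nnmean U T \<partial>m) = (\<integral>\<^sup>+x. a T * indicator T x * U x \<partial>m)"
      by (simp add: mult.assoc nn_integral_cmult c1[OF T(2)] mult.commute[of "U _"])
  qed
  also have "\<dots> = (\<integral>\<^sup>+x. (\<integral>\<^sup>+T. a T * indicator T x * U x \<partial>count_space ns_balls) \<partial>m)"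
    by (intro nn_integral_count_space_nn_integral[symmetric] countable_ns_balls) auto
  finally have "(\<integral>\<^sup>+x. avg a b U x \<partial>m) =
      (\<integral>\<^sup>+x. (\<integral>\<^sup>+T. a T * indicator T x * U x \<partial>count_space ns_balls) + b x * U x \<partial>m)"
    unfolding avg_def by (subst (1 2) nn_integral_add) (auto intro: meas nn_integral_ns_measurable)
  also have "\<dots> = (\<integral>\<^sup>+x. U x * ((\<integral>\<^sup>+T. a T * indicator T x \<partial>count_space ns_balls) + b x) \<partial>m)"
    by (rule nn_integral_cong, subst nn_integral_multc) (auto simp: algebra_simps)
  finally show ?thesis .
qed

text \<open>Jensen's inequality for a sub-probability average: integrate the tangent inequality
  \<open>powr_tangent\<close> and take \<open>c\<close> to be the average itself.\<close>

lemma avg_power: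
  fixes u :: "'a \<Rightarrow> real"
  assumes q: "1 \<le> q" and M: "0 < M"
    and tot: "(\<integral>\<^sup>+T. a T * indicator T x \<partial>count_space ns_balls) + b x \<le> ennreal M"
    and u: "u \<in> borel_measurable m" "\<And>y. 0 \<le> u y" and v: "0 \<le> v" "ennreal v \<le> avg a b (\<lambda>y. ennreal (u y)) x"
  shows "ennreal (v powr q) \<le> ennreal (M powr (q - 1)) * avg a b (\<lambda>y. ennreal (u y powr q)) x"
proof (cases "v = 0 \<or> avg a b (\<lambda>y. ennreal (u y powr q)) x = top")
  case True
  thus ?thesis using M by (auto simp: ennreal_mult_top)
next
  case False
  note [measurable] = u(1)
  obtain r where r: "0 \<le> r" "avg a b (\<lambda>y. ennreal (u y powr q)) x = ennreal r"
    using False by (cases "avg a b (\<lambda>y. ennreal (u y powr q)) x") auto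
  define c where "c = v / M"
  have c: "0 < c" "v = c * M" using False M v by (auto simp: c_def)
  define \<alpha> where "\<alpha> = q * c powr (q - 1)"
  define k where "k = (q - 1) * c powr q"
  have nn: "0 \<le> \<alpha>" "0 \<le> k" using q by (auto simp: \<alpha>_def k_def)
  have "ennreal (\<alpha> * v) \<le> ennreal \<alpha> * avg a b (\<lambda>y. ennreal (u y)) x"
    using v nn by (simp add: ennreal_mult mult_left_mono)
  also have "\<dots> = avg a b (\<lambda>y. ennreal \<alpha> * ennreal (u y)) x" by (subst avg_cmult) auto
  also have "\<dots> \<le> avg a b (\<lambda>y. ennreal (u y powr q) + ennreal k) x"
    using powr_tangent[OF q u(2) c(1)] nn
    by (intro avg_mono) (simp add: ennreal_mult[symmetric] ennreal_plus[symmetric] u(2) \<alpha>_def k_def del: ennreal_plus)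
  also have "\<dots> = ennreal r + ennreal k * ((\<integral>\<^sup>+T. a T * indicator T x \<partial>count_space ns_balls) + b x)"
    by (subst avg_add_const) (auto simp: r)
  also have "\<dots> \<le> ennreal r + ennreal k * ennreal M" using tot by (intro add_left_mono mult_left_mono) auto
  also have "\<dots> = ennreal (r + k * M)" using nn r M by (simp add: ennreal_mult ennreal_plus)
  finally have "\<alpha> * v \<le> r + k * M" using nn r M by (subst (asm) ennreal_le_iff) auto
  moreover have "c powr (q - 1) * c = c powr q" using c by (simp add: powr_mult_base mult.commute)
  hence "\<alpha> * v = q * c powr q * M" using c by (simp add: \<alpha>_def mult.assoc)
  ultimately have "c powr q * M \<le> r" by (simp add: k_def algebra_simps)
  hence "M powr (q - 1) * (c powr q * M) \<le> M powr (q - 1) * r" by (intro mult_left_mono) auto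
  moreover have "M powr (q - 1) * M = M powr q" using M by (simp add: powr_mult_base mult.commute)
  hence "v powr q = M powr (q - 1) * (c powr q * M)" using c M by (simp add: powr_mult mult_ac)
  ultimately show ?thesis using r by (simp add: ennreal_mult[symmetric])
qed

text \<open>Schur's test for a symmetric kernel of mass at most M: Jensen's inequality at each point
  yields M powr (q - 1), the integration over x the remaining factor M.\<close>

lemma avg_Lq:
  assumes q: "1 \<le> q" and M: "0 < M"
    and tot: "\<And>x. (\<integral>\<^sup>+T. a T * indicator T x \<partial>count_space ns_balls) + b x \<le> ennreal M"
    and b: "b \<in> borel_measurable m" and u: "u \<in> Lq m q" and v: "v \<in> borel_measurable m"
    and le: "\<And>x. ennreal (norm (v x)) \<le> avg a b (\<lambda>y. ennreal (norm (u y))) x"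
  shows "v \<in> Lq m q" "Lq_pow m q v \<le> M powr q * Lq_pow m q u"
proof -
  note [measurable] = b Lq_measurable[OF u] v
  have "(\<integral>\<^sup>+x. ennreal (norm (v x) powr q) \<partial>m)
      \<le> (\<integral>\<^sup>+x. avg a b (\<lambda>y. ennreal (M powr (q - 1)) * ennreal (norm (u y) powr q)) x \<partial>m)"
  proof (rule nn_integral_mono)
    fix x
    show "ennreal (norm (v x) powr q) \<le> avg a b (\<lambda>y. ennreal (M powr (q - 1)) * ennreal (norm (u y) powr q)) x"
      by (subst avg_cmult) (auto intro!: avg_power[OF q M tot] le)
  qed
  also have "\<dots> = (\<integral>\<^sup>+x. ennreal (M powr (q - 1)) * ennreal (norm (u x) powr q)
      * ((\<integral>\<^sup>+T. a T * indicator T x \<partial>count_space ns_balls) + b x) \<partial>m)"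
    by (rule nn_integral_avg) auto
  also have "\<dots> \<le> (\<integral>\<^sup>+x. ennreal (M powr (q - 1)) * ennreal (norm (u x) powr q) * ennreal M \<partial>m)"
    using tot by (intro nn_integral_mono mult_left_mono) auto
  also have "\<dots> = ennreal (M powr (q - 1)) * ennreal M * (\<integral>\<^sup>+x. ennreal (norm (u x) powr q) \<partial>m)"
    by (subst nn_integral_cmult[symmetric]) (auto simp: mult_ac)
  also have "\<dots> = ennreal (M powr (q - 1)) * ennreal M * ennreal (Lq_pow m q u)"
    using nn_integral_Lq[OF u] by simp
  also have "\<dots> = ennreal (M powr (q - 1) * M * Lq_pow m q u)" using M by (simp add: ennreal_mult)
  also have "M powr (q - 1) * M = M powr q" using M by (simp add: powr_mult_base mult.commute)
  finally have *: "(\<integral>\<^sup>+x. ennreal (norm (v x) powr q) \<partial>m) \<le> ennreal (M powr q * Lq_pow m q u)" .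
  show "v \<in> Lq m q" "Lq_pow m q v \<le> M powr q * Lq_pow m q u" using Lq_bound[OF v *] by auto
qed

section \<open>Means of L^q functions over balls\<close>

lemma Lq_integrable_ball:
  assumes q: "1 \<le> q" and u: "u \<in> Lq m q" and B: "B \<in> all_balls"
  shows "integrable m (\<lambda>x. indicator B x * u x)"
proof -
  note [measurable] = balls_sets[OF B] Lq_measurable[OF u]
  have "integrable m (\<lambda>x. indicat_real B x + norm (u x) powr q)"
    using Lq_integrable[OF u] B emeasure_ball_finite by (intro Bochner_Integration.integrable_add) auto
  thus ?thesis
  proof (rule Bochner_Integration.integrable_bound)
    have "norm (u x) \<le> 1 + norm (u x) powr q" for x
      using le_powr_add_one[OF q, of "norm (u x)"] by simp
    thus "AE x in m. norm (indicator B x * u x) \<le> norm (indicat_real B x + norm (u x) powr q)"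
      by (auto simp: indicator_def)
  qed auto
qed

text \<open>The tangent inequality is taken at c, the modulus of the mean itself, and integrated
  over B; of q c^q m(B) on the left, all but one c^q m(B) is absorbed on the right.\<close>

lemma mean_powr_le:
  assumes q: "1 \<le> q" and u: "u \<in> Lq m q" and B: "B \<in> all_balls"
  shows "norm (mean u B) powr q \<le> Lq_pow m q u / mu B"
proof (cases "mean u B = 0")
  case True thus ?thesis using B by (simp add: mu_pos less_imp_le)
next
  case False
  note [measurable] = balls_sets[OF B] Lq_measurable[OF u]
  define c where "c = norm (mean u B)"
  have c: "0 < c" using False by (simp add: c_def)
  have i: "integrable m (\<lambda>x. indicator B x * u x)" by (rule Lq_integrable_ball[OF q u B])
  have ip: "integrable m (\<lambda>x. norm (u x) powr q + (q - 1) * c powr q * indicat_real B x)"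
    using Lq_integrable[OF u] B emeasure_ball_finite by (intro Bochner_Integration.integrable_add) auto
  have "c * mu B = norm (\<integral>x. indicator B x * u x \<partial>m)"
    using mu_pos[OF B] by (simp add: c_def mean_eq norm_divide)
  also have "\<dots> \<le> (\<integral>x. norm (indicator B x * u x) \<partial>m)" by (rule integral_norm_bound)
  finally have "q * c powr (q - 1) * (c * mu B) \<le> q * c powr (q - 1) * (\<integral>x. norm (indicator B x * u x) \<partial>m)"
    using q by (intro mult_left_mono) auto
  also have "\<dots> = (\<integral>x. q * c powr (q - 1) * norm (indicator B x * u x) \<partial>m)" by simp
  also have "\<dots> \<le> (\<integral>x. norm (u x) powr q + (q - 1) * c powr q * indicat_real B x \<partial>m)"
  proof (rule integral_mono)
    show "integrable m (\<lambda>x. q * c powr (q - 1) * norm (indicator B x * u x))"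
      using i by (intro integrable_mult_right integrable_norm) 
    fix x show "q * c powr (q - 1) * norm (indicator B x * u x) \<le> norm (u x) powr q + (q - 1) * c powr q * indicat_real B x"
      using powr_tangent[OF q _ c, of "norm (u x)"] by (auto simp: indicator_def)
  qed (rule ip)
  also have "\<dots> = Lq_pow m q u + (q - 1) * c powr q * mu B"
    using Lq_integrable[OF u] B emeasure_ball_finite[OF B] by (subst Bochner_Integration.integral_add) (auto simp: Lq_pow_def mu_def)
  also have "q * c powr (q - 1) * (c * mu B) = q * c powr q * mu B"
    using c powr_mult_base[of c "q - 1"] by (simp add: mult_ac)
  finally have "c powr q * mu B \<le> Lq_pow m q u" by (simp add: algebra_simps)
  thus ?thesis using B by (simp add: c_def pos_le_divide_eq)
qed

lemma mean_le:
  assumes q: "1 \<le> q" and u: "u \<in> Lq m q" and B: "B \<in> all_balls" "T \<in> all_balls" "B \<subseteq> T"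
  shows "norm (mean u T) \<le> (Lq_pow m q u / mu B) powr (1 / q)"
proof -
  have "mu B \<le> mu T"
    using emeasure_mono[OF B(3) balls_sets[OF B(2)]] B emeasure_mu by (simp add: ennreal_le_iff)
  hence "norm (mean u T) powr q \<le> Lq_pow m q u / mu B"
    using mean_powr_le[OF q u B(2)] B by (smt (verit) frac_le mu_pos Lq_pow_nonneg)
  hence "(norm (mean u T) powr q) powr (1/q) \<le> (Lq_pow m q u / mu B) powr (1/q)"
    using q by (intro powr_mono2) auto
  thus ?thesis using q by (simp add: powr_powr)
qed

lemma bounded_above_mean: "1 \<le> q \<Longrightarrow> u \<in> Lq m q \<Longrightarrow> bounded_above (mean u)"
  unfolding bounded_above_def using mean_le[of q u] by metis

text \<open>The hypothesis is Tonelli's condition. A sum over the balls containing x is an integral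
  over \<open>count_space I\<close>, so Fubini's theorem for product measures applies.\<close>

lemma Fubini_balls:
  fixes a :: "'a set \<Rightarrow> complex" and g :: "'a \<Rightarrow> complex"
  assumes I: "I \<subseteq> ns_balls" and g: "g \<in> borel_measurable m"
    and fin: "(\<integral>\<^sup>+T. ennreal (norm (a T)) * (\<integral>\<^sup>+x. indicator T x * ennreal (norm (g x)) \<partial>m) \<partial>count_space I) < \<infinity>"
  shows "integrable m (\<lambda>x. (\<Sum>\<^sub>\<infinity>T\<in>{T \<in> I. x \<in> T}. a T) * g x)" (is ?A)
    "(\<integral>x. (\<Sum>\<^sub>\<infinity>T\<in>{T \<in> I. x \<in> T}. a T) * g x \<partial>m) = (\<Sum>\<^sub>\<infinity>T\<in>I. a T * (\<integral>x. indicator T x * g x \<partial>m))" (is ?B)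
    "(\<lambda>T. a T * (\<integral>x. indicator T x * g x \<partial>m)) summable_on I" (is ?C)
proof -
  interpret pair_sigma_finite "count_space I" m by (rule pair_sigma_finite_m[OF I])
  note [measurable] = g
  define f :: "'a set \<Rightarrow> 'a \<Rightarrow> complex" where "f T x = a T * (indicator T x * g x)" for T x
  have cI: "countable I" using I countable_ns_balls by (rule countable_subset)
  have meas: "case_prod f \<in> borel_measurable (count_space I \<Otimes>\<^sub>M m)"
  proof (rule measurable_pair_measure_countable1[OF cI])
    fix T assume "T \<in> I"
    hence [measurable]: "T \<in> sets m" using I ns_sets by auto
    show "(\<lambda>y. case (T, y) of (T, x) \<Rightarrow> f T x) \<in> borel_measurable m" by (simp add: f_def)
  qed
  have nn: "(\<integral>\<^sup>+x. ennreal (norm (f T x)) \<partial>m)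
      = ennreal (norm (a T)) * (\<integral>\<^sup>+x. indicator T x * ennreal (norm (g x)) \<partial>m)" if "T \<in> I" for T
  proof -
    have [measurable]: "T \<in> sets m" using I ns_sets that by auto
    have "ennreal (norm (f T x)) = ennreal (norm (a T)) * (indicator T x * ennreal (norm (g x)))" for x
      by (simp add: f_def norm_mult ennreal_mult indicator_def)
    thus ?thesis by (simp add: nn_integral_cmult)
  qed
  have int: "integrable (count_space I \<Otimes>\<^sub>M m) (case_prod f)"
  proof (rule integrableI_bounded[OF meas])
    have "(\<integral>\<^sup>+z. ennreal (norm (case_prod f z)) \<partial>(count_space I \<Otimes>\<^sub>M m))
        = (\<integral>\<^sup>+T. (\<integral>\<^sup>+x. ennreal (norm (f T x)) \<partial>m) \<partial>count_space I)"
      using meas by (subst M2.nn_integral_fst[symmetric]) auto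
    also have "\<dots> = (\<integral>\<^sup>+T. ennreal (norm (a T)) * (\<integral>\<^sup>+x. indicator T x * ennreal (norm (g x)) \<partial>m) \<partial>count_space I)"
      by (rule nn_integral_cong) (simp add: nn)
    finally show "(\<integral>\<^sup>+z. ennreal (norm (case_prod f z)) \<partial>(count_space I \<Otimes>\<^sub>M m)) < \<infinity>" using fin by simp
  qed
  have e: "(\<integral>T. f T x \<partial>count_space I) = (\<Sum>\<^sub>\<infinity>T\<in>{T \<in> I. x \<in> T}. a T) * g x" for x
  proof -
    have "(\<integral>T. f T x \<partial>count_space I) = (\<Sum>\<^sub>\<infinity>T\<in>I. f T x)" by (simp add: infsum_eq_lebesgue)
    also have "\<dots> = (\<Sum>\<^sub>\<infinity>T\<in>{T \<in> I. x \<in> T}. a T * g x)"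
      by (intro infsum_cong_neutral) (auto simp: f_def indicator_def)
    finally show ?thesis by (simp add: infsum_cmult_left')
  qed
  have e2: "(\<integral>x. f T x \<partial>m) = a T * (\<integral>x. indicator T x * g x \<partial>m)" for T by (simp add: f_def)
  show ?A using integrable_snd[OF int] by (simp add: e)
  show ?B using Fubini_integral[OF int] by (simp add: e e2 infsum_eq_lebesgue)
  show ?C using integrable_fst[OF int] by (simp add: e2 summable_on_iff_integrable)
qed

section \<open>Functional calculus\<close>

text \<open>The operator \<open>F(L)\<close>, where \<open>c\<close> is the limit of \<open>F\<close> at infinity.\<close>

definition fcalc :: "(real \<Rightarrow> complex) \<Rightarrow> complex \<Rightarrow> ('a \<Rightarrow> complex) \<Rightarrow> 'a \<Rightarrow> complex" where
  "fcalc F c u x = (\<Sum>\<^sub>\<infinity>T\<in>{T \<in> ns_balls. x \<in> T}. incr F T * mean u T) + phi F c x * u x"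

text \<open>M bounds the mass of the kernel of F(L) at each point, and thereby its norm in all L^q
  simultaneously.\<close>

definition admissible :: "(real \<Rightarrow> complex) \<Rightarrow> complex \<Rightarrow> real \<Rightarrow> bool" where
  "admissible F c M \<longleftrightarrow> (\<exists>G. dominated F G) \<and> (F \<longlongrightarrow> c) at_top \<and> 0 < M \<and>
     (\<forall>x. (\<Sum>\<^sub>\<infinity>T\<in>{T \<in> ns_balls. x \<in> T}. norm (incr F T)) + norm (phi F c x) \<le> M)"

lemma point_summable:
  assumes "dominated F G"
  shows "(\<lambda>T. norm (incr F T)) summable_on {T \<in> ns_balls. x \<in> T}"
    "(\<Sum>\<^sub>\<infinity>T\<in>{T \<in> ns_balls. x \<in> T}. norm (incr F T)) \<le> G 0"
proof -
  have "sum (incr G) \<F> \<le> G 0" if "finite \<F>" "\<F> \<subseteq> {T \<in> ns_balls. x \<in> T}" for \<F>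
    using sum_incr_point_le[OF assms that, of 0] assms by (auto simp: dominated_def)
  from summable_norm_incr[OF assms _ this]
  show "(\<lambda>T. norm (incr F T)) summable_on {T \<in> ns_balls. x \<in> T}"
    "(\<Sum>\<^sub>\<infinity>T\<in>{T \<in> ns_balls. x \<in> T}. norm (incr F T)) \<le> G 0" by auto
qed

text \<open>Subtracting the diagonal value keeps the total mass at G 0; the cruder bound of
  \<open>point_summable\<close> would lose the contraction property.\<close>

lemma point_sum_decreasing:
  assumes "dominated F G" "\<And>a. a \<in> Lam \<Longrightarrow> g \<le> G a"
  shows "(\<Sum>\<^sub>\<infinity>T\<in>{T \<in> ns_balls. x \<in> T}. norm (incr F T)) \<le> G 0 - phi G g x"
proof -
  have "sum (incr G) \<F> \<le> G 0 - phi G g x" if "finite \<F>" "\<F> \<subseteq> {T \<in> ns_balls. x \<in> T}" for \<F>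
    by (rule sum_incr_point_le[OF assms(1) that]) (use phi_le[OF assms(1,2)] in auto)
  from summable_norm_incr(4)[OF assms(1) _ this] show ?thesis by auto
qed

lemma phi_of_real: "phi (\<lambda>s. of_real (G s)) (of_real g) x = (of_real (phi G g x) :: complex)"
  by (simp add: phi_def)

lemma dominated_decreasing:
  assumes "\<And>a. a \<in> Lam \<Longrightarrow> 0 \<le> G a" "\<And>a b. a \<in> Lam \<Longrightarrow> b \<in> Lam \<Longrightarrow> a \<le> b \<Longrightarrow> G b \<le> G a"
  shows "dominated (\<lambda>s. of_real (G s) :: complex) G"
  unfolding dominated_def
proof (intro conjI ballI impI)
  fix a b assume "a \<in> Lam" "b \<in> Lam" "a \<le> b"
  hence "G b \<le> G a" using assms by blast
  thus "norm (of_real (G a) - of_real (G b) :: complex) \<le> G a - G b"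
    by (metis abs_of_nonneg diff_ge_0_iff_ge norm_of_real of_real_diff order_refl)
qed (use assms in auto)

lemma admissible_decreasing:
  assumes "\<And>a. a \<in> Lam \<Longrightarrow> g \<le> G a" "\<And>a b. a \<in> Lam \<Longrightarrow> b \<in> Lam \<Longrightarrow> a \<le> b \<Longrightarrow> G b \<le> G a"
    "0 \<le> g" "(G \<longlongrightarrow> g) at_top" "0 < G 0"
  shows "admissible (\<lambda>s. of_real (G s)) (of_real g) (G 0)"
proof -
  have nn: "0 \<le> G a" if "a \<in> Lam" for a using assms(1)[OF that] assms(3) by simp
  have dom: "dominated (\<lambda>s. of_real (G s) :: complex) G" using assms nn by (intro dominated_decreasing)
  have "0 \<le> phi G g x" for x using assms(3) nn isolated_lam_Lam[of x] by (simp add: phi_def)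
  hence "(\<Sum>\<^sub>\<infinity>T\<in>{T \<in> ns_balls. x \<in> T}. norm (incr (\<lambda>s. of_real (G s) :: complex) T))
      + norm (phi (\<lambda>s. of_real (G s)) (of_real g) x :: complex) \<le> G 0" for x
    using point_sum_decreasing[OF dom assms(1), of x] by (simp add: phi_of_real)
  thus ?thesis unfolding admissible_def using dom assms(4,5) by (auto intro!: tendsto_of_real)
qed

lemma admissible_incr_summable: "admissible F c M \<Longrightarrow> incr_summable F"
  unfolding admissible_def using dominated_incr_summable by blast

text \<open>\<open>phi\<close> deviates from the constant c only at isolated points, and these are
  countably many because each is a ball.\<close>

lemma phi_measurable [measurable]: "phi F (c::complex) \<in> borel_measurable m"
proof -
  have "inj_on (\<lambda>x. {x}) {x::'a. \<not> x islimpt UNIV}" by (auto intro: inj_onI)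
  moreover have "countable ((\<lambda>x. {x}) ` {x::'a. \<not> x islimpt UNIV})"
    using isolated_ball by (intro countable_subset[OF _ countable_all_balls]) auto
  ultimately have c: "countable {x::'a. \<not> x islimpt UNIV}" by (rule countable_image_inj_on[rotated])
  show ?thesis
    by (rule measurable_discrete_difference[where f = "\<lambda>_. c", OF _ c]) (auto simp: phi_def sets_m)
qed

lemma point_infsum_measurable:
  fixes a :: "'a set \<Rightarrow> complex"
  shows "(\<lambda>x. \<Sum>\<^sub>\<infinity>T\<in>{T \<in> ns_balls. x \<in> T}. a T) \<in> borel_measurable m"
proof -
  interpret sigma_finite_measure "count_space (ns_balls :: 'a set set)"
    by (rule sigma_finite_measure_count_space_countable[OF countable_ns_balls])
  have "(\<lambda>(T, x). indicator T x * a T) \<in> borel_measurable (count_space ns_balls \<Otimes>\<^sub>M m)"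
    by (rule measurable_pair_measure_countable1[OF countable_ns_balls]) simp
  from measurable_pair_swap[OF this]
  have "case_prod (\<lambda>x T. indicator T x * a T) \<in> borel_measurable (m \<Otimes>\<^sub>M count_space ns_balls)" by simp
  hence "(\<lambda>x. \<integral>T. indicator T x * a T \<partial>count_space ns_balls) \<in> borel_measurable m"
    by (rule borel_measurable_lebesgue_integral)
  moreover have "(\<integral>T. indicator T x * a T \<partial>count_space ns_balls) = (\<Sum>\<^sub>\<infinity>T\<in>{T \<in> ns_balls. x \<in> T}. a T)" for x
    unfolding infsum_eq_lebesgue[symmetric] by (intro infsum_cong_neutral) (auto simp: indicator_def)
  ultimately show ?thesis by simp
qed

lemma fcalc_measurable:
  assumes [measurable]: "u \<in> borel_measurable m" shows "fcalc F c u \<in> borel_measurable m"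
proof -
  note [measurable] = point_infsum_measurable[of "\<lambda>T. incr F T * mean u T"]
  show ?thesis unfolding fcalc_def[abs_def] by measurable
qed

lemma nn_point_sum:
  fixes f :: "'a set \<Rightarrow> real"
  assumes "f summable_on {T \<in> ns_balls. x \<in> T}" "\<And>T. 0 \<le> f T"
  shows "(\<integral>\<^sup>+T. ennreal (f T) * indicator T x \<partial>count_space ns_balls)
    = ennreal (\<Sum>\<^sub>\<infinity>T\<in>{T \<in> ns_balls. x \<in> T}. f T)"
proof -
  let ?g = "\<lambda>T. f T * indicator T x"
  have "?g summable_on ns_balls \<longleftrightarrow> f summable_on {T \<in> ns_balls. x \<in> T}"
    by (intro summable_on_cong_neutral) (auto simp: indicator_def)
  hence "(\<integral>\<^sup>+T. ennreal (?g T) \<partial>count_space ns_balls) = ennreal (infsum ?g ns_balls)"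
    using assms by (intro nn_integral_count_space_infsum) auto
  also have "infsum ?g ns_balls = (\<Sum>\<^sub>\<infinity>T\<in>{T \<in> ns_balls. x \<in> T}. f T)"
    by (intro infsum_cong_neutral) (auto simp: indicator_def)
  finally show ?thesis using assms(2) by (simp add: ennreal_mult ennreal_indicator)
qed

abbreviation wabs :: "(real \<Rightarrow> complex) \<Rightarrow> 'a set \<Rightarrow> ennreal" where "wabs F \<equiv> \<lambda>T. ennreal (norm (incr F T))"
abbreviation pabs :: "(real \<Rightarrow> complex) \<Rightarrow> complex \<Rightarrow> 'a \<Rightarrow> ennreal" where "pabs F c \<equiv> \<lambda>x. ennreal (norm (phi F c x))"

lemma admissible_total:
  assumes "admissible F c M"
  shows "(\<integral>\<^sup>+T. wabs F T * indicator T x \<partial>count_space ns_balls) + pabs F c x \<le> ennreal M"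
proof -
  obtain G where "dominated F G" using assms by (auto simp: admissible_def)
  from nn_point_sum[OF point_summable(1)[OF this]] show ?thesis
    using assms by (simp add: admissible_def ennreal_plus[symmetric] infsum_nonneg del: ennreal_plus)
qed

lemma norm_fcalc_le: "ennreal (norm (fcalc F c u x)) \<le> avg (wabs F) (pabs F c) (\<lambda>y. ennreal (norm (u y))) x"
proof -
  let ?a = "\<lambda>T. incr F T * mean u T"
  have "(\<Sum>\<^sub>\<infinity>T\<in>{T \<in> ns_balls. x \<in> T}. ?a T) = (\<Sum>\<^sub>\<infinity>T\<in>ns_balls. ?a T * indicator T x)"
    by (intro infsum_cong_neutral) (auto simp: indicator_def)
  hence "ennreal (norm (\<Sum>\<^sub>\<infinity>T\<in>{T \<in> ns_balls. x \<in> T}. ?a T))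
      \<le> (\<integral>\<^sup>+T. ennreal (norm (?a T * indicator T x)) \<partial>count_space ns_balls)"
    using norm_infsum_le_nn by metis
  also have "\<dots> \<le> (\<integral>\<^sup>+T. wabs F T * indicator T x * nnmean (\<lambda>y. ennreal (norm (u y))) T \<partial>count_space ns_balls)"
  proof (rule nn_integral_mono)
    fix T assume "T \<in> space (count_space (ns_balls :: 'a set set))"
    hence T: "T \<in> all_balls" using ns_balls_all by auto
    have "ennreal (norm (?a T * indicator T x)) = wabs F T * indicator T x * ennreal (norm (mean u T))"
      by (simp add: norm_mult ennreal_mult indicator_def)
    also have "\<dots> \<le> wabs F T * indicator T x * nnmean (\<lambda>y. ennreal (norm (u y))) T"
      using norm_mean_le[OF T] by (intro mult_left_mono) auto
    finally show "ennreal (norm (?a T * indicator T x)) \<le> wabs F T * indicator T x * nnmean (\<lambda>y. ennreal (norm (u y))) T" .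
  qed
  finally have "ennreal (norm (\<Sum>\<^sub>\<infinity>T\<in>{T \<in> ns_balls. x \<in> T}. ?a T)) + ennreal (norm (phi F c x * u x))
      \<le> avg (wabs F) (pabs F c) (\<lambda>y. ennreal (norm (u y))) x"
    unfolding avg_def by (intro add_mono) (simp_all add: norm_mult ennreal_mult)
  moreover have "ennreal (norm (fcalc F c u x)) \<le>
      ennreal (norm (\<Sum>\<^sub>\<infinity>T\<in>{T \<in> ns_balls. x \<in> T}. ?a T)) + ennreal (norm (phi F c x * u x))"
    unfolding fcalc_def ennreal_plus[symmetric, OF norm_ge_zero norm_ge_zero]
    by (intro ennreal_leI norm_triangle_ineq)
  ultimately show ?thesis by (rule order_trans[rotated])
qed

lemma fcalc_Lq:
  assumes "admissible F c M" "1 \<le> q" "u \<in> Lq m q"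
  shows "fcalc F c u \<in> Lq m q" "Lq_pow m q (fcalc F c u) \<le> M powr q * Lq_pow m q u"
proof -
  have M: "0 < M" using assms(1) by (simp add: admissible_def)
  note r = avg_Lq[OF assms(2) M admissible_total[OF assms(1)] _ assms(3) fcalc_measurable norm_fcalc_le]
  show "fcalc F c u \<in> Lq m q" "Lq_pow m q (fcalc F c u) \<le> M powr q * Lq_pow m q u"
    using r Lq_measurable[OF assms(3)] by simp_all
qed

text \<open>Tonelli's condition for \<open>mean_fcalc\<close>. Since norm (u y) is at most norm (u
  y) powr q + 1, the average splits into an integrable part and a part that is at most M on
  B.\<close>

lemma avg_ball_finite:
  assumes "admissible F c M" "1 \<le> q" "u \<in> Lq m q" "B \<in> all_balls"
  shows "(\<integral>\<^sup>+x. indicator B x * avg (wabs F) (pabs F c) (\<lambda>y. ennreal (norm (u y))) x \<partial>m) < \<infinity>"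
proof -
  note [measurable] = Lq_measurable[OF assms(3)] balls_sets[OF assms(4)]
  let ?U = "\<lambda>y. ennreal (norm (u y) powr q)"
  have M: "0 < M" using assms(1) by (simp add: admissible_def)
  have avm: "avg (wabs F) (pabs F c) ?U \<in> borel_measurable m"
  proof -
    have "(\<lambda>x. \<integral>\<^sup>+T. wabs F T * indicator T x * nnmean ?U T \<partial>count_space ns_balls) \<in> borel_measurable m"
      by (intro nn_integral_ns_measurable) simp
    thus ?thesis unfolding avg_def[abs_def] by measurable
  qed
  have "norm (u x) \<le> norm (u x) powr q + 1" for x by (simp add: le_powr_add_one assms(2))
  hence le: "ennreal (norm (u x)) \<le> ?U x + 1" for x
    using ennreal_leI[of "norm (u x)" "norm (u x) powr q + 1"] by simp
  have "avg (wabs F) (pabs F c) (\<lambda>y. ennreal (norm (u y))) x \<le> avg (wabs F) (pabs F c) ?U x + ennreal M" for x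
  proof -
    have "avg (wabs F) (pabs F c) (\<lambda>y. ennreal (norm (u y))) x \<le> avg (wabs F) (pabs F c) (\<lambda>y. ?U y + 1) x"
      using le by (rule avg_mono)
    also have "\<dots> = avg (wabs F) (pabs F c) ?U x +
        1 * ((\<integral>\<^sup>+T. wabs F T * indicator T x \<partial>count_space ns_balls) + pabs F c x)"
      by (rule avg_add_const) simp
    also have "\<dots> \<le> avg (wabs F) (pabs F c) ?U x + ennreal M"
      unfolding mult_1 by (intro add_left_mono admissible_total[OF assms(1)])
    finally show ?thesis .
  qed
  hence "(\<integral>\<^sup>+x. indicator B x * avg (wabs F) (pabs F c) (\<lambda>y. ennreal (norm (u y))) x \<partial>m)
    \<le> (\<integral>\<^sup>+x. avg (wabs F) (pabs F c) ?U x + ennreal M * indicator B x \<partial>m)"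
    by (intro nn_integral_mono) (auto simp: indicator_def)
  also have "\<dots> = (\<integral>\<^sup>+x. avg (wabs F) (pabs F c) ?U x \<partial>m) + ennreal M * emeasure m B"
    using avm by (subst nn_integral_add) (auto simp: nn_integral_cmult_indicator)
  also have "(\<integral>\<^sup>+x. avg (wabs F) (pabs F c) ?U x \<partial>m)
      = (\<integral>\<^sup>+x. ?U x * ((\<integral>\<^sup>+T. wabs F T * indicator T x \<partial>count_space ns_balls) + pabs F c x) \<partial>m)"
    by (rule nn_integral_avg) auto
  also have "\<dots> \<le> (\<integral>\<^sup>+x. ?U x * ennreal M \<partial>m)"
    using admissible_total[OF assms(1)] by (intro nn_integral_mono mult_left_mono) auto
  also have "\<dots> = ennreal (Lq_pow m q u) * ennreal M"
    using nn_integral_Lq[OF assms(3)] by (simp add: nn_integral_multc)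
  finally have "(\<integral>\<^sup>+x. indicator B x * avg (wabs F) (pabs F c) (\<lambda>y. ennreal (norm (u y))) x \<partial>m)
      \<le> ennreal (Lq_pow m q u) * ennreal M + ennreal M * ennreal (mu B)"
    using emeasure_mu[OF assms(4)] by simp
  also have "\<dots> < \<infinity>" by (simp add: ennreal_mult_less_top)
  finally show ?thesis .
qed

lemma integral_indicator_Int: 
  assumes "S \<in> all_balls" "T \<in> all_balls"
  shows "(\<integral>x. indicator S x * (indicator T x :: complex) \<partial>m) = of_real (mu (S \<inter> T))"
proof -
  have "(\<integral>x. indicator S x * (indicator T x :: complex) \<partial>m) = (\<integral>x. complex_of_real (indicator (S \<inter> T) x) \<partial>m)"
    by (intro Bochner_Integration.integral_cong) (auto simp: indicator_def)
  also have "\<dots> = of_real (\<integral>x. indicator (S \<inter> T) x \<partial>m)" by (rule integral_complex_of_real)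
  finally show ?thesis by (simp add: mu_def)
qed

lemma mean_times_mu:
  assumes "B \<in> all_balls" shows "mean u B * mu B = (\<integral>x. indicator B x * u x \<partial>m)"
  using mu_pos[OF assms] by (simp add: mean_eq)

text \<open>Integrated over B, the average over a ball T inside B becomes the integral of u over T.
  Summed over all such T around a point of B, the weights telescope to F (lam_parent B) minus
  \<open>phi\<close>, and the diagonal part of \<open>fcalc\<close> cancels this \<open>phi\<close>.
  Averages over balls above B are constant on B and form the series of
  \<open>multiplier\<close>.\<close>

lemma mean_fcalc:
  assumes adm: "admissible F c M" and q: "1 \<le> q" and u: "u \<in> Lq m q" and B: "B \<in> all_balls"
  shows "mean (fcalc F c u) B = multiplier F (mean u) B"
proof -
  note [measurable] = Lq_measurable[OF u] balls_sets[OF B]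
  obtain G where dom: "dominated F G" using adm by (auto simp: admissible_def)
  have lim: "(F \<longlongrightarrow> c) at_top" using adm by (simp add: admissible_def)
  let ?a = "\<lambda>T. incr F T * mean u T"
  \<comment> \<open>The weights of the balls inside B. Fubini's theorem is applied twice: to all
    balls tested against the indicator of B, and to the balls inside B tested against u.\<close>
  let ?b = "\<lambda>T. if T \<subseteq> B then incr F T else 0"
  have "(\<integral>\<^sup>+T. ennreal (norm (?a T)) * (\<integral>\<^sup>+x. indicator T x * ennreal (norm (indicator B x :: complex)) \<partial>m) \<partial>count_space ns_balls)
     = (\<integral>\<^sup>+T. (\<integral>\<^sup>+x. ennreal (norm (?a T)) * (indicator T x * indicator B x) \<partial>m) \<partial>count_space ns_balls)"
  proof (rule nn_integral_cong)
    fix T assume "T \<in> space (count_space (ns_balls :: 'a set set))"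
    hence [measurable]: "T \<in> sets m" using ns_sets by auto
    show "ennreal (norm (?a T)) * (\<integral>\<^sup>+x. indicator T x * ennreal (norm (indicator B x :: complex)) \<partial>m)
      = (\<integral>\<^sup>+x. ennreal (norm (?a T)) * (indicator T x * indicator B x) \<partial>m)"
      by (subst nn_integral_cmult[symmetric]) (auto intro!: nn_integral_cong simp: indicator_def)
  qed
  also have "\<dots> = (\<integral>\<^sup>+x. (\<integral>\<^sup>+T. ennreal (norm (?a T)) * (indicator T x * indicator B x) \<partial>count_space ns_balls) \<partial>m)"
    by (intro nn_integral_count_space_nn_integral[symmetric] countable_ns_balls) auto
  also have "\<dots> \<le> (\<integral>\<^sup>+x. indicator B x * avg (wabs F) (pabs F c) (\<lambda>y. ennreal (norm (u y))) x \<partial>m)"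
  proof (rule nn_integral_mono)
    fix x
    have "(\<integral>\<^sup>+T. ennreal (norm (?a T)) * (indicator T x * indicator B x) \<partial>count_space ns_balls)
       \<le> (\<integral>\<^sup>+T. indicator B x * (wabs F T * indicator T x * nnmean (\<lambda>y. ennreal (norm (u y))) T) \<partial>count_space ns_balls)"
    proof (rule nn_integral_mono)
      fix T assume "T \<in> space (count_space (ns_balls :: 'a set set))"
      hence T: "T \<in> all_balls" using ns_balls_all by auto
      have "wabs F T * ennreal (norm (mean u T)) \<le> wabs F T * nnmean (\<lambda>y. ennreal (norm (u y))) T"
        using norm_mean_le[OF T] by (intro mult_left_mono) auto
      thus "ennreal (norm (?a T)) * (indicator T x * indicator B x) \<le>
        indicator B x * (wabs F T * indicator T x * nnmean (\<lambda>y. ennreal (norm (u y))) T)"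
        by (auto simp: norm_mult ennreal_mult indicator_def)
    qed
    also have "\<dots> = indicator B x * (\<integral>\<^sup>+T. wabs F T * indicator T x * nnmean (\<lambda>y. ennreal (norm (u y))) T \<partial>count_space ns_balls)"
      by (simp add: nn_integral_cmult)
    also have "\<dots> \<le> indicator B x * avg (wabs F) (pabs F c) (\<lambda>y. ennreal (norm (u y))) x"
      unfolding avg_def by (intro mult_left_mono) auto
    finally show "(\<integral>\<^sup>+T. ennreal (norm (?a T)) * (indicator T x * indicator B x) \<partial>count_space ns_balls)
      \<le> indicator B x * avg (wabs F) (pabs F c) (\<lambda>y. ennreal (norm (u y))) x" .
  qed
  also have "\<dots> < \<infinity>" by (rule avg_ball_finite[OF adm q u B])
  finally have fin1: "(\<integral>\<^sup>+T. ennreal (norm (?a T)) * (\<integral>\<^sup>+x. indicator T x * ennreal (norm (indicator B x :: complex)) \<partial>m) \<partial>count_space ns_balls) < \<infinity>" .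
  note F1 = Fubini_balls[OF subset_refl _ fin1]

  have "(\<integral>\<^sup>+T. ennreal (norm (?b T)) * (\<integral>\<^sup>+x. indicator T x * ennreal (norm (u x)) \<partial>m) \<partial>count_space ns_balls)
     = (\<integral>\<^sup>+T. (\<integral>\<^sup>+x. ennreal (norm (?b T)) * (indicator T x * ennreal (norm (u x))) \<partial>m) \<partial>count_space ns_balls)"
    by (intro nn_integral_cong nn_integral_cmult[symmetric]) auto
  also have "\<dots> = (\<integral>\<^sup>+x. (\<integral>\<^sup>+T. ennreal (norm (?b T)) * (indicator T x * ennreal (norm (u x))) \<partial>count_space ns_balls) \<partial>m)"
    by (intro nn_integral_count_space_nn_integral[symmetric] countable_ns_balls) auto
  also have "\<dots> \<le> (\<integral>\<^sup>+x. ennreal M * ennreal (norm (indicator B x * u x)) \<partial>m)"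
  proof (rule nn_integral_mono)
    fix x
    have "(\<integral>\<^sup>+T. ennreal (norm (?b T)) * (indicator T x * ennreal (norm (u x))) \<partial>count_space ns_balls)
      \<le> (\<integral>\<^sup>+T. (wabs F T * indicator T x) * ennreal (norm (indicator B x * u x)) \<partial>count_space ns_balls)"
      by (intro nn_integral_mono) (auto simp: indicator_def)
    also have "\<dots> = (\<integral>\<^sup>+T. wabs F T * indicator T x \<partial>count_space ns_balls) * ennreal (norm (indicator B x * u x))"
      by (rule nn_integral_multc) simp
    also have "\<dots> \<le> ennreal M * ennreal (norm (indicator B x * u x))"
      using admissible_total[OF adm, of x] by (intro mult_right_mono) (auto intro: order_trans[rotated])
    finally show "(\<integral>\<^sup>+T. ennreal (norm (?b T)) * (indicator T x * ennreal (norm (u x))) \<partial>count_space ns_balls)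
      \<le> ennreal M * ennreal (norm (indicator B x * u x))" .
  qed
  also have "\<dots> < \<infinity>"
    using Lq_integrable_ball[OF q u B] by (simp add: nn_integral_cmult integrable_iff_bounded ennreal_mult_less_top)
  finally have fin2: "(\<integral>\<^sup>+T. ennreal (norm (?b T)) * (\<integral>\<^sup>+x. indicator T x * ennreal (norm (u x)) \<partial>m) \<partial>count_space ns_balls) < \<infinity>" .
  note F2 = Fubini_balls[OF subset_refl _ fin2]

  have inner: "(\<Sum>\<^sub>\<infinity>T\<in>{T \<in> ns_balls. x \<in> T}. ?b T) = indicator B x * (F (lam_parent B) - phi F c x)" for x
  proof -
    have "(\<Sum>\<^sub>\<infinity>T\<in>{T \<in> ns_balls. x \<in> T}. ?b T) = (\<Sum>\<^sub>\<infinity>T\<in>{T \<in> ns_balls. x \<in> T \<and> T \<subseteq> B}. incr F T)"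
      by (intro infsum_cong_neutral) auto
    also have "\<dots> = indicator B x * (F (lam_parent B) - phi F c x)"
    proof (cases "x \<in> B")
      case True
      thus ?thesis using infsumI[OF has_sum_incr_point[OF dom lim B True]] by simp
    next
      case False
      hence "{T \<in> ns_balls. x \<in> T \<and> T \<subseteq> B} = {}" by auto
      thus ?thesis using False by (simp only: infsum_empty) simp
    qed
    finally show ?thesis .
  qed
  have int_B: "integrable m (\<lambda>x. indicator B x * u x)" by (rule Lq_integrable_ball[OF q u B])
  have int_phi: "integrable m (\<lambda>x. indicator B x * (phi F c x * u x))"
  proof (rule Bochner_Integration.integrable_bound[where f = "\<lambda>x. of_real M * (indicator B x * u x)"])
    have "norm (phi F c x) \<le> M" for x
    proof -
      have "0 \<le> (\<Sum>\<^sub>\<infinity>T\<in>{T \<in> ns_balls. x \<in> T}. norm (incr F T))" by (intro infsum_nonneg) auto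
      moreover have "(\<Sum>\<^sub>\<infinity>T\<in>{T \<in> ns_balls. x \<in> T}. norm (incr F T)) + norm (phi F c x) \<le> M"
        using adm by (simp add: admissible_def)
      ultimately show ?thesis by linarith
    qed
    thus "AE x in m. norm (indicator B x * (phi F c x * u x)) \<le> norm (of_real M * (indicator B x * u x))"
      using adm by (auto simp: admissible_def norm_mult indicator_def intro!: mult_right_mono)
  qed (use int_B in auto)

  have S1: "(\<Sum>\<^sub>\<infinity>T\<in>ns_balls. ?b T * (\<integral>x. indicator T x * u x \<partial>m))
      = F (lam_parent B) * (\<integral>x. indicator B x * u x \<partial>m) - (\<integral>x. indicator B x * (phi F c x * u x) \<partial>m)"
  proof -
    have "(\<Sum>\<^sub>\<infinity>T\<in>ns_balls. ?b T * (\<integral>x. indicator T x * u x \<partial>m))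
       = (\<integral>x. F (lam_parent B) * (indicator B x * u x) - indicator B x * (phi F c x * u x) \<partial>m)"
      using F2(2) Lq_measurable[OF u] by (simp add: inner algebra_simps)
    thus ?thesis using int_B int_phi by simp
  qed
  have sup: "(\<lambda>T. ?a T * mu B) summable_on up B"
    using multiplier_summable(2)[OF dominated_incr_summable[OF dom] bounded_above_mean[OF q u] B]
    by (rule summable_on_cmult_left)
  have S2: "(\<lambda>T. if T \<in> up B then ?a T * mu B else 0) summable_on ns_balls"
    "(\<Sum>\<^sub>\<infinity>T\<in>ns_balls. if T \<in> up B then ?a T * mu B else 0) = (\<Sum>\<^sub>\<infinity>T\<in>up B. ?a T) * mu B"
  proof -
    have "(\<lambda>T. if T \<in> up B then ?a T * mu B else 0) summable_on ns_balls \<longleftrightarrow> (\<lambda>T. ?a T * mu B) summable_on up B"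
      by (intro summable_on_cong_neutral) (auto simp: up_def)
    thus "(\<lambda>T. if T \<in> up B then ?a T * mu B else 0) summable_on ns_balls" using sup by simp
    have "(\<Sum>\<^sub>\<infinity>T\<in>ns_balls. if T \<in> up B then ?a T * mu B else 0) = (\<Sum>\<^sub>\<infinity>T\<in>up B. ?a T * mu B)"
      by (intro infsum_cong_neutral) (auto simp: up_def)
    thus "(\<Sum>\<^sub>\<infinity>T\<in>ns_balls. if T \<in> up B then ?a T * mu B else 0) = (\<Sum>\<^sub>\<infinity>T\<in>up B. ?a T) * mu B"
      by (simp add: infsum_cmult_left')
  qed
  have "(\<Sum>\<^sub>\<infinity>T\<in>ns_balls. ?a T * (\<integral>x. indicator T x * (indicator B x :: complex) \<partial>m))
     = (\<Sum>\<^sub>\<infinity>T\<in>ns_balls. ?b T * (\<integral>x. indicator T x * u x \<partial>m) + (if T \<in> up B then ?a T * mu B else 0))"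
  proof (rule infsum_cong)
    fix T :: "'a set" assume T: "T \<in> ns_balls"
    hence Ta: "T \<in> all_balls" by (rule ns_balls_all)
    consider "T \<subseteq> B" | "B \<subset> T" | "T \<inter> B = {}" using balls_nested[OF Ta B] by blast
    thus "?a T * (\<integral>x. indicator T x * (indicator B x :: complex) \<partial>m)
      = ?b T * (\<integral>x. indicator T x * u x \<partial>m) + (if T \<in> up B then ?a T * mu B else 0)"
    proof cases
      case 1
      hence "T \<notin> up B" "T \<inter> B = T" by (auto simp: up_def)
      thus ?thesis using 1 mean_times_mu[OF Ta, of u] by (simp add: integral_indicator_Int[OF Ta B])
    next
      case 2
      hence "T \<in> up B" "T \<inter> B = B" "\<not> T \<subseteq> B" using T by (auto simp: up_def)
      thus ?thesis by (simp add: integral_indicator_Int[OF Ta B])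
    next
      case 3
      have "\<not> T \<subseteq> B" using 3 balls_nonempty[OF Ta] by blast
      moreover have "T \<notin> up B" using 3 balls_nonempty[OF B] by (auto simp: up_def)
      ultimately show ?thesis using 3 by (simp add: integral_indicator_Int[OF Ta B] mu_def)
    qed
  qed
  also have "\<dots> = (\<Sum>\<^sub>\<infinity>T\<in>ns_balls. ?b T * (\<integral>x. indicator T x * u x \<partial>m)) + (\<Sum>\<^sub>\<infinity>T\<in>up B. ?a T) * mu B"
    using F2(3) Lq_measurable[OF u] S2 by (subst infsum_add) auto
  finally have E: "(\<integral>x. (\<Sum>\<^sub>\<infinity>T\<in>{T \<in> ns_balls. x \<in> T}. ?a T) * indicator B x \<partial>m)
      = F (lam_parent B) * (\<integral>x. indicator B x * u x \<partial>m) - (\<integral>x. indicator B x * (phi F c x * u x) \<partial>m)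
        + (\<Sum>\<^sub>\<infinity>T\<in>up B. ?a T) * mu B"
    using F1(2) S1 by simp
  have "mean (fcalc F c u) B * mu B = (\<integral>x. indicator B x * fcalc F c u x \<partial>m)" by (rule mean_times_mu[OF B])
  also have "\<dots> = (\<integral>x. (\<Sum>\<^sub>\<infinity>T\<in>{T \<in> ns_balls. x \<in> T}. ?a T) * indicator B x + indicator B x * (phi F c x * u x) \<partial>m)"
    by (simp add: fcalc_def algebra_simps)
  also have "\<dots> = (\<integral>x. (\<Sum>\<^sub>\<infinity>T\<in>{T \<in> ns_balls. x \<in> T}. ?a T) * indicator B x \<partial>m) + (\<integral>x. indicator B x * (phi F c x * u x) \<partial>m)"
    using F1(1) int_phi by (intro Bochner_Integration.integral_add) auto
  also have "\<dots> = F (lam_parent B) * (mean u B * mu B) + (\<Sum>\<^sub>\<infinity>T\<in>up B. ?a T) * mu B"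
    using E mean_times_mu[OF B, of u] by simp
  also have "\<dots> = multiplier F (mean u) B * mu B" by (simp add: multiplier_def algebra_simps)
  finally show ?thesis using mu_pos[OF B] by simp
qed

section \<open>Ball means determine functions; density of ball functions\<close>

text \<open>The space of test functions, by \<open>test_functions_eq\<close>. Adding one ball per
  step suits induction, and the balls need not be disjoint.\<close>

inductive_set ball_span :: "('a \<Rightarrow> complex) set" where
  ball_span_zero: "(\<lambda>x. 0) \<in> ball_span"
| ball_span_step: "d \<in> ball_span \<Longrightarrow> B \<in> all_balls \<Longrightarrow> (\<lambda>x. c * indicator B x + d x) \<in> ball_span"

lemma ball_span_lincomb: "d \<in> ball_span \<Longrightarrow> d' \<in> ball_span \<Longrightarrow> (\<lambda>x. c * d x + d' x) \<in> ball_span"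
proof (induction rule: ball_span.induct)
  case (ball_span_step d B k)
  from ball_span.ball_span_step[OF ball_span_step(3)[OF ball_span_step(4)] ball_span_step(2), of "c * k"]
  show ?case by (simp add: algebra_simps)
qed simp

lemma ball_span_indicator: "B \<in> all_balls \<Longrightarrow> (\<lambda>x. c * indicator B x) \<in> ball_span"
  using ball_span_step[OF ball_span_zero, of B c] by simp

lemma Lq_pow_indicator: "A \<in> sets m \<Longrightarrow> 0 < q \<Longrightarrow> Lq_pow m q (indicator A) = measure m A"
proof -
  assume "A \<in> sets m" "0 < q"
  have "(\<integral>x. norm (indicator A x :: complex) powr q \<partial>m) = (\<integral>x. indicat_real A x \<partial>m)"
    using \<open>0 < q\<close> by (intro Bochner_Integration.integral_cong) (auto simp: indicator_def)
  thus ?thesis using \<open>A \<in> sets m\<close> by (simp add: Lq_pow_def)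
qed

lemma Lq_indicator: assumes "A \<in> sets m" "emeasure m A < \<infinity>" "0 < q" shows "indicator A \<in> Lq m q"
proof -
  have "(\<lambda>x. norm (indicator A x :: complex) powr q) = indicat_real A"
    using assms(3) by (auto simp: indicator_def)
  thus ?thesis using assms by (simp add: Lq_def)
qed

lemma ball_span_Lq: assumes "1 \<le> q" shows "d \<in> ball_span \<Longrightarrow> d \<in> Lq m q"
proof (induction rule: ball_span.induct)
  case (ball_span_step d B c)
  have "indicator B \<in> Lq m q" using ball_span_step assms emeasure_ball_finite by (intro Lq_indicator) auto
  thus ?case using ball_span_step assms by (intro Lq_lincomb) auto
qed simp

section \<open>Ball means determine a function almost everywhere\<close>

definition nbhd :: "'a set \<Rightarrow> nat \<Rightarrow> 'a set" where
  "nbhd K n = (\<Union>x\<in>K. ball x (inverse (Suc n)))"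

text \<open>Balls of one fixed radius are equal or disjoint, and compactness leaves finitely many.
  So a statement about balls extends to \<open>nbhd K n\<close> by additivity, and to K as n
  grows.\<close>

lemma nbhd_decomp:
  assumes "compact K"
  obtains \<B> where "finite \<B>" "\<B> \<subseteq> all_balls" "disjoint \<B>" "nbhd K n = \<Union>\<B>"
proof (rule that)
  let ?\<B> = "(\<lambda>x. ball x (inverse (Suc n))) ` K"
  show "finite ?\<B>" by (rule compact_cover_balls[OF assms]) simp
  show "?\<B> \<subseteq> all_balls" by auto
  show "disjoint ?\<B>" by (rule balls_same_radius_disjoint)
  show "nbhd K n = \<Union>?\<B>" by (simp add: nbhd_def)
qed

lemma indicator_Union_disjoint:
  assumes "finite \<B>" "disjoint \<B>"
  shows "indicator (\<Union>\<B>) x = (\<Sum>B\<in>\<B>. indicator B x :: complex)"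
  using indicator_UN_disjoint[of \<B> id x] assms
  by (simp add: disjoint_family_on_def disjoint_def)

lemma nbhd_Inter: assumes "compact K" shows "(\<Inter>n. nbhd K n) = K"
proof
  show "K \<subseteq> (\<Inter>n. nbhd K n)" by (auto simp: nbhd_def intro!: bexI)
  show "(\<Inter>n. nbhd K n) \<subseteq> K"
  proof
    fix y assume y: "y \<in> (\<Inter>n. nbhd K n)"
    have "y \<in> closure K"
    proof (subst closure_approachable, intro allI impI)
      fix e :: real assume "0 < e"
      then obtain n where "inverse (real (Suc n)) < e" using reals_Archimedean by blast
      moreover have "y \<in> nbhd K n" using y by blast
      ultimately show "\<exists>x\<in>K. dist x y < e" by (force simp: nbhd_def)
    qed
    thus "y \<in> K" using assms compact_imp_closed closure_closed by metis
  qed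
qed

lemma nbhd_decseq: "decseq (nbhd K)"
proof (rule decseq_SucI)
  fix n
  have "inverse (real (Suc (Suc n))) \<le> inverse (real (Suc n))" by simp
  hence "ball x (inverse (real (Suc (Suc n)))) \<subseteq> ball x (inverse (real (Suc n)))" for x :: 'a
    by (rule subset_ball)
  thus "nbhd K (Suc n) \<subseteq> nbhd K n" unfolding nbhd_def by (intro UN_mono) auto
qed

lemma nbhd_sub_ball: assumes "compact K" obtains N where "N \<in> all_balls" "\<And>n. nbhd K n \<subseteq> N"
proof -
  obtain a :: 'a where True by blast
  obtain R where R: "R > 0" "K \<subseteq> ball a R" using compact_imp_bounded[OF assms] bounded_subset_ballD by metis
  have "nbhd K n \<subseteq> ball a (R + 1)" for n
  proof
    fix y assume "y \<in> nbhd K n"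
    then obtain x where x: "x \<in> K" "dist x y < inverse (real (Suc n))" by (auto simp: nbhd_def)
    have "inverse (real (Suc n)) \<le> 1" by (simp add: inverse_le_1_iff)
    moreover have "dist a x < R" using R x by auto
    ultimately show "y \<in> ball a (R + 1)" using dist_triangle[of a y x] x by simp
  qed
  thus thesis using that[of "ball a (R + 1)"] R by simp
qed

lemma nbhd_sets: assumes "compact K" shows "nbhd K n \<in> sets m"
proof -
  have "open (nbhd K n)" unfolding nbhd_def by auto
  thus ?thesis by (simp add: sets_m)
qed

lemma compact_sets: "compact K \<Longrightarrow> K \<in> sets m"
  by (simp add: sets_m borel_compact)

lemma indicator_nbhd_tendsto:
  assumes "compact K" shows "(\<lambda>n. indicator (nbhd K n) x :: complex) \<longlonglongrightarrow> indicator K x"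
proof (cases "x \<in> K")
  case True
  hence "x \<in> nbhd K n" for n using nbhd_Inter[OF assms] by blast
  thus ?thesis using True by simp
next
  case False
  then obtain n where n: "x \<notin> nbhd K n" using nbhd_Inter[OF assms] by blast
  have "\<forall>\<^sub>F k in sequentially. indicator (nbhd K k) x = (0::complex)"
    using eventually_ge_at_top[of n]
  proof eventually_elim
    case (elim k)
    hence "nbhd K k \<subseteq> nbhd K n" using nbhd_decseq decseqD by metis
    thus ?case using n by (auto simp: indicator_def)
  qed
  thus ?thesis using False by (simp add: tendsto_eventually)
qed

text \<open>Additivity gives integral 0 over \<open>nbhd K n\<close>; dominated convergence inside
  one ball containing all these sets carries this to K.\<close>

lemma integral_compact_zero:
  assumes K: "compact K" and v: "\<And>B. B \<in> all_balls \<Longrightarrow> integrable m (\<lambda>x. indicator B x * v x :: complex)"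
    and z: "\<And>B. B \<in> all_balls \<Longrightarrow> (\<integral>x. indicator B x * v x \<partial>m) = 0" and vm: "v \<in> borel_measurable m"
  shows "(\<integral>x. indicator K x * v x \<partial>m) = 0" "integrable m (\<lambda>x. indicator K x * v x)"
proof -
  note [measurable] = vm nbhd_sets[OF K] compact_sets[OF K]
  obtain N where N: "N \<in> all_balls" "\<And>n. nbhd K n \<subseteq> N" using nbhd_sub_ball[OF K] by metis
  have KN: "K \<subseteq> N" using N(2)[of 0] nbhd_Inter[OF K] by blast
  have zero: "(\<integral>x. indicator (nbhd K n) x * v x \<partial>m) = 0" for n
  proof -
    obtain \<B> where \<B>: "finite \<B>" "\<B> \<subseteq> all_balls" "disjoint \<B>" "nbhd K n = \<Union>\<B>"
      using nbhd_decomp[OF K] by metis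
    have "(\<integral>x. indicator (nbhd K n) x * v x \<partial>m) = (\<integral>x. (\<Sum>B\<in>\<B>. indicator B x * v x) \<partial>m)"
      by (simp only: \<B>(4) indicator_Union_disjoint[OF \<B>(1,3)] sum_distrib_right)
    also have "\<dots> = (\<Sum>B\<in>\<B>. (\<integral>x. indicator B x * v x \<partial>m))"
      using v \<B> by (intro Bochner_Integration.integral_sum) auto
    also have "\<dots> = 0" using z \<B> by (intro sum.neutral) auto
    finally show ?thesis .
  qed
  have b: "AE x in m. norm (indicator (nbhd K n) x * v x) \<le> norm (indicator N x * v x)" for n
    using N(2)[of n] by (auto simp: indicator_def)
  have t: "AE x in m. (\<lambda>n. indicator (nbhd K n) x * v x) \<longlonglongrightarrow> indicator K x * v x"
    using indicator_nbhd_tendsto[OF K] by (intro AE_I2 tendsto_mult) auto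
  have i: "integrable m (\<lambda>x. norm (indicator N x * v x))" using v[OF N(1)] by (rule integrable_norm)
  have "(\<lambda>n. \<integral>x. indicator (nbhd K n) x * v x \<partial>m) \<longlonglongrightarrow> (\<integral>x. indicator K x * v x \<partial>m)"
    by (rule integral_dominated_convergence[OF _ _ i t b]) auto
  thus "(\<integral>x. indicator K x * v x \<partial>m) = 0" using zero by (simp add: LIMSEQ_const_iff)
  show "integrable m (\<lambda>x. indicator K x * v x)"
    by (rule integrable_dominated_convergence[OF _ _ i t b]) auto
qed

lemma inner_regular:
  "A \<in> sets m \<Longrightarrow> emeasure m A = (SUP K\<in>{K. compact K \<and> K \<subseteq> A}. emeasure m K)"
  using radon by (simp add: radon_measure_def sets_m)

text \<open>On a compact subset of {h > 0} a vanishing integral forces measure 0; inner regularity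
  then makes {h > 0} a null set.\<close>

lemma null_positive_part:
  fixes h :: "'a \<Rightarrow> real"
  assumes h: "h \<in> borel_measurable m"
    and i: "\<And>K. compact K \<Longrightarrow> integrable m (\<lambda>x. indicator K x * h x)"
    and z: "\<And>K. compact K \<Longrightarrow> (\<integral>x. indicator K x * h x \<partial>m) = 0"
  shows "AE x in m. h x \<le> 0"
proof -
  note [measurable] = h
  let ?A = "{x. h x > 0}"
  have "{x \<in> space m. 0 < h x} \<in> sets m" by measurable
  hence A: "?A \<in> sets m" by simp
  have "emeasure m K = 0" if K: "compact K" "K \<subseteq> ?A" for K
  proof -
    note [measurable] = compact_sets[OF K(1)]
    have nn: "AE x in m. 0 \<le> indicator K x * h x" 
      by (rule AE_I2) (use K in \<open>auto simp: indicator_def less_imp_le\<close>)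
    have "AE x in m. indicator K x * h x = 0"
      using integral_nonneg_eq_0_iff_AE[OF i[OF K(1)] nn] z[OF K(1)] by simp
    hence "AE x in m. x \<notin> K" by eventually_elim (use K in \<open>auto simp: indicator_def split: if_splits\<close>)
    thus ?thesis using AE_iff_measurable[of K m "\<lambda>x. x \<notin> K"] by auto
  qed
  hence "emeasure m ?A = 0" using inner_regular[OF A] by (simp add: SUP_eq_iff bot_ennreal)
      (metis (no_types, lifting) SUP_least bot.extremum_unique bot_ennreal le_zero_eq mem_Collect_eq)
  thus ?thesis using A AE_iff_measurable[of ?A m "\<lambda>x. h x \<le> 0"] by (auto simp: not_le)
qed

text \<open>Takes the place of a differentiation theorem: vanishing integrals pass from balls to
  compact sets, and inner regularity is applied to plus and minus the real and imaginary
  parts.\<close>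

lemma mean_zero_imp_AE_zero:
  assumes q: "1 \<le> q" and v: "v \<in> Lq m q" and z: "\<And>B. B \<in> all_balls \<Longrightarrow> mean v B = 0"
  shows "AE x in m. v x = 0"
proof -
  note [measurable] = Lq_measurable[OF v]
  have z': "(\<integral>x. indicator B x * v x \<partial>m) = 0" if "B \<in> all_balls" for B
    using z[OF that] mean_times_mu[OF that, of v] by simp
  note ic = integral_compact_zero[OF _ Lq_integrable_ball[OF q v] z' Lq_measurable[OF v]]
  have re: "indicator K x * Re v' = Re (indicator K x * v')" "indicator K x * Im v' = Im (indicator K x * v')"
    for K :: "'a set" and x v' by (auto simp: indicator_def)
  have R: "integrable m (\<lambda>x. indicator K x * Re (v x))" "(\<integral>x. indicator K x * Re (v x) \<partial>m) = 0"
    "integrable m (\<lambda>x. indicator K x * Im (v x))" "(\<integral>x. indicator K x * Im (v x) \<partial>m) = 0" if "compact K" for K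
    unfolding re
    by (simp_all only: integral_Re[OF ic(2)[OF that]] integral_Im[OF ic(2)[OF that]] ic(1)[OF that]
        integrable_Re[OF ic(2)[OF that]] integrable_Im[OF ic(2)[OF that]] zero_complex.sel)
  have "AE x in m. Re (v x) \<le> 0" by (rule null_positive_part) (use R in auto)
  moreover have "AE x in m. Im (v x) \<le> 0" by (rule null_positive_part) (use R in auto)
  moreover have "AE x in m. - Re (v x) \<le> 0" by (rule null_positive_part) (use R in auto)
  moreover have "AE x in m. - Im (v x) \<le> 0" by (rule null_positive_part) (use R in auto)
  ultimately show ?thesis by eventually_elim (simp add: complex_eq_iff)
qed

lemma mean_lincomb:
  assumes "1 \<le> q" "u \<in> Lq m q" "v \<in> Lq m q" "B \<in> all_balls"
  shows "mean (\<lambda>x. c * u x + v x) B = c * mean u B + mean v B"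
proof -
  note i = Lq_integrable_ball[OF assms(1,2,4)] Lq_integrable_ball[OF assms(1,3,4)]
  have "(\<integral>x. indicator B x * (c * u x + v x) \<partial>m) = (\<integral>x. c * (indicator B x * u x) + indicator B x * v x \<partial>m)"
    by (simp add: algebra_simps)
  also have "\<dots> = c * (\<integral>x. indicator B x * u x \<partial>m) + (\<integral>x. indicator B x * v x \<partial>m)" using i by simp
  finally show ?thesis by (simp add: mean_eq add_divide_distrib)
qed

lemma mean_diff:
  assumes "1 \<le> q" "u \<in> Lq m q" "v \<in> Lq m q" "B \<in> all_balls"
  shows "mean (\<lambda>x. u x - v x) B = mean u B - mean v B"
  using mean_lincomb[OF assms(1,3,2,4), of "-1"] by simp

lemma mean_cong_AE:
  assumes "u \<in> borel_measurable m" "v \<in> borel_measurable m" "AE x in m. u x = v x" "B \<in> all_balls"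
  shows "mean u B = mean v B"
proof -
  note [measurable] = assms(1,2) balls_sets[OF assms(4)]
  have "(\<integral>x. indicator B x * u x \<partial>m) = (\<integral>x. indicator B x * v x \<partial>m)"
    using assms(3) by (intro integral_cong_AE) auto
  thus ?thesis by (simp add: mean_eq)
qed

lemma means_determine:
  assumes q: "1 \<le> q" and u: "u \<in> Lq m q" and v: "v \<in> Lq m q" and e: "\<And>B. B \<in> all_balls \<Longrightarrow> mean u B = mean v B"
  shows "AE x in m. u x = v x"
proof -
  have "AE x in m. u x - v x = 0"
    using q by (intro mean_zero_imp_AE_zero[OF q]) (auto intro!: Lq_diff u v simp: mean_diff[OF q u v] e)
  thus ?thesis by simp
qed

section \<open>Density of ball functions in L^q\<close>

definition approximable :: "real \<Rightarrow> ('a \<Rightarrow> complex) \<Rightarrow> bool" where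
  "approximable q f \<longleftrightarrow> f \<in> Lq m q \<and> (\<forall>e>0. \<exists>d\<in>ball_span. Lq_pow m q (\<lambda>x. f x - d x) < e)"

text \<open>Allows density to be proved in stages: indicators of compact sets, of sets of finite
  measure, simple functions, all of L^q. The factor 2 * 2 powr q in e' pays for the quasi-triangle
  inequality.\<close>

lemma approximable_limit:
  assumes q: "1 \<le> q" and f: "f \<in> Lq m q"
    and g: "\<And>e. e > 0 \<Longrightarrow> \<exists>g. approximable q g \<and> Lq_pow m q (\<lambda>x. f x - g x) < e"
  shows "approximable q f"
  unfolding approximable_def
proof (intro conjI allI impI f)
  fix e :: real assume e: "e > 0"
  define e' where "e' = e / (2 * 2 powr q)"
  have e': "e' > 0" using e by (simp add: e'_def)
  obtain g where g: "approximable q g" "Lq_pow m q (\<lambda>x. f x - g x) < e'" using g[OF e'] by blast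
  obtain d where d: "d \<in> ball_span" "Lq_pow m q (\<lambda>x. g x - d x) < e'" using g(1) e' by (auto simp: approximable_def)
  have "Lq_pow m q (\<lambda>x. f x - d x) \<le> 2 powr q * (Lq_pow m q (\<lambda>x. f x - g x) + Lq_pow m q (\<lambda>x. g x - d x))"
    using q f g ball_span_Lq[OF q d(1)] by (intro Lq_pow_triangle) (auto simp: approximable_def)
  also have "\<dots> < 2 powr q * (e' + e')" using g(2) d(2) by (intro mult_strict_left_mono) auto
  also have "\<dots> = e" by (simp add: e'_def field_simps)
  finally show "\<exists>d\<in>ball_span. Lq_pow m q (\<lambda>x. f x - d x) < e" using d by blast
qed

lemma approximable_ball_span: "1 \<le> q \<Longrightarrow> d \<in> ball_span \<Longrightarrow> approximable q d"
  unfolding approximable_def using ball_span_Lq by (auto intro!: bexI[of _ d])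

lemma approximable_lincomb:
  assumes q: "1 \<le> q" and f: "approximable q f" and g: "approximable q g"
  shows "approximable q (\<lambda>x. c * f x + g x)"
proof (rule approximable_limit[OF q])
  have fL: "f \<in> Lq m q" and gL: "g \<in> Lq m q" using f g by (auto simp: approximable_def)
  show "(\<lambda>x. c * f x + g x) \<in> Lq m q" using q fL gL by (intro Lq_lincomb) auto
  fix e :: real assume e: "e > 0"
  define e' where "e' = e / (2 powr q * (norm c powr q + 1))"
  have p: "0 < 2 powr q * (norm c powr q + 1)" by (intro mult_pos_pos) (auto intro: add_nonneg_pos)
  have e': "e' > 0" using e p by (simp add: e'_def)
  obtain d where d: "d \<in> ball_span" "Lq_pow m q (\<lambda>x. f x - d x) < e'" using f e' by (auto simp: approximable_def)
  obtain d' where d': "d' \<in> ball_span" "Lq_pow m q (\<lambda>x. g x - d' x) < e'" using g e' by (auto simp: approximable_def)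
  note dL = ball_span_Lq[OF q d(1)] ball_span_Lq[OF q d'(1)]
  have i: "(\<lambda>x. f x - d x) \<in> Lq m q" "(\<lambda>x. g x - d' x) \<in> Lq m q" using q fL gL dL by (auto intro!: Lq_diff)
  have "Lq_pow m q (\<lambda>x. (c * f x + g x) - (c * d x + d' x)) = Lq_pow m q (\<lambda>x. c * (f x - d x) + (g x - d' x))"
    by (simp add: algebra_simps)
  also have "\<dots> \<le> 2 powr q * (Lq_pow m q (\<lambda>x. c * (f x - d x)) + Lq_pow m q (\<lambda>x. g x - d' x))"
    using q i by (intro Lq_add Lq_cmult) auto
  also have "\<dots> = 2 powr q * (norm c powr q * Lq_pow m q (\<lambda>x. f x - d x) + Lq_pow m q (\<lambda>x. g x - d' x))"
    using q by (simp add: Lq_pow_cmult)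
  also have "\<dots> < 2 powr q * (norm c powr q * e' + e')"
    using d d' by (intro mult_strict_left_mono add_le_less_mono mult_left_mono) auto
  also have "\<dots> = e' * (2 powr q * (norm c powr q + 1))" by (simp add: algebra_simps)
  also have "\<dots> = e" 
    unfolding e'_def by (simp only: times_divide_eq_left nonzero_mult_div_cancel_right less_imp_neq[OF p, symmetric] not_False_eq_True)
  finally show "\<exists>h. approximable q h \<and> Lq_pow m q (\<lambda>x. (c * f x + g x) - h x) < e"
    using approximable_ball_span[OF q ball_span_lincomb[OF d(1) d'(1), of c]] by blast
qed

lemma Lq_pow_indicator_diff:
  assumes "A \<subseteq> A'" "A \<in> sets m" "A' \<in> sets m" "0 < q"
  shows "Lq_pow m q (\<lambda>x. indicator A' x - indicator A x) = measure m (A' - A)"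
    "Lq_pow m q (\<lambda>x. indicator A x - indicator A' x) = measure m (A' - A)"
proof -
  have "(\<lambda>x. indicator A' x - indicator A x :: complex) = indicator (A' - A)"
    by (intro ext) (use assms(1) in \<open>auto simp: indicator_def\<close>)
  thus "Lq_pow m q (\<lambda>x. indicator A' x - indicator A x) = measure m (A' - A)"
    using Lq_pow_indicator[of "A' - A" q] assms by simp
  thus "Lq_pow m q (\<lambda>x. indicator A x - indicator A' x) = measure m (A' - A)" by (subst Lq_pow_minus)
qed

lemma approximable_compact:
  assumes q: "1 \<le> q" and K: "compact K" shows "approximable q (indicator K)"
proof (rule approximable_limit[OF q])
  note sets = nbhd_sets[OF K] compact_sets[OF K]
  show "indicator K \<in> Lq m q" using q K emeasure_compact sets by (intro Lq_indicator) auto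
  fix e :: real assume e: "e > 0"
  obtain N where N: "N \<in> all_balls" "\<And>n. nbhd K n \<subseteq> N" using nbhd_sub_ball[OF K] by metis
  have fin: "emeasure m (nbhd K n) \<noteq> \<infinity>" for n
    using emeasure_mono[OF N(2) balls_sets[OF N(1)]] emeasure_ball_finite[OF N(1)] by (metis leD top.not_eq_extremum infinity_ennreal_def)
  have "(\<lambda>n. measure m (nbhd K n)) \<longlonglongrightarrow> measure m (\<Inter>n. nbhd K n)"
    using sets(1) nbhd_decseq fin by (intro Lim_measure_decseq) auto
  hence "(\<lambda>n. measure m (nbhd K n) - measure m K) \<longlonglongrightarrow> 0"
    using LIM_zero_iff by (simp add: nbhd_Inter[OF K] LIM_zero)
  hence "\<forall>\<^sub>F n in sequentially. measure m (nbhd K n) - measure m K < e" using e by (rule order_tendstoD)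
  then obtain n where n: "measure m (nbhd K n) - measure m K < e" by (auto simp: eventually_sequentially)
  have sub: "K \<subseteq> nbhd K n" using nbhd_Inter[OF K] by blast
  obtain \<B> where \<B>: "finite \<B>" "\<B> \<subseteq> all_balls" "disjoint \<B>" "nbhd K n = \<Union>\<B>"
    using nbhd_decomp[OF K] by metis
  have "(\<lambda>x. \<Sum>B\<in>\<B>. indicator B x :: complex) \<in> ball_span"
    using \<B>(1,2)
  proof (induction rule: finite_induct)
    case empty show ?case using ball_span_zero by simp
  next
    case (insert B \<B>)
    thus ?case using ball_span_step[of "\<lambda>x. \<Sum>B\<in>\<B>. indicator B x" B 1] by simp
  qed
  hence "indicator (nbhd K n) \<in> ball_span"
    by (simp add: \<B>(4) indicator_Union_disjoint[OF \<B>(1,3), abs_def])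
  moreover have "measure m (nbhd K n - K) < e" using n sub sets fin by (subst measure_Diff) auto
  ultimately show "\<exists>g. approximable q g \<and> Lq_pow m q (\<lambda>x. indicator K x - g x) < e"
    using Lq_pow_indicator_diff(2)[OF sub sets(2) sets(1)] q approximable_ball_span[OF q] by (metis less_le_trans zero_less_one)
qed

lemma approximable_indicator:
  assumes q: "1 \<le> q" and A: "A \<in> sets m" "emeasure m A < \<infinity>" shows "approximable q (indicator A)"
proof (rule approximable_limit[OF q])
  show "indicator A \<in> Lq m q" using q A by (intro Lq_indicator) auto
  fix e :: real assume e: "e > 0"
  have "\<exists>K. compact K \<and> K \<subseteq> A \<and> measure m A - measure m K < e"
  proof (cases "measure m A < e")
    case True thus ?thesis by (intro exI[of _ "{}"]) auto
  next
    case False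
    \<comment> \<open>In this case \<open>measure m A - e\<close> is nonnegative, so no truncation
      occurs in \<open>ennreal\<close>.\<close>
    have "ennreal (measure m A - e) < emeasure m A"
      using A False e by (simp add: emeasure_eq_ennreal_measure less_top ennreal_less_iff)
    then obtain K where K: "compact K" "K \<subseteq> A" "ennreal (measure m A - e) < emeasure m K"
      unfolding inner_regular[OF A(1)] less_SUP_iff by auto
    have "emeasure m K = ennreal (measure m K)"
      using emeasure_compact[OF K(1)] by (simp add: emeasure_eq_ennreal_measure less_top)
    hence "measure m A - e < measure m K" using K(3) False by (simp add: ennreal_less_iff)
    thus ?thesis using K by (intro exI[of _ K]) auto
  qed
  then obtain K where K: "compact K" "K \<subseteq> A" "measure m A - measure m K < e" by blast
  have "measure m (A - K) < e" using K A compact_sets by (subst measure_Diff) (auto simp: less_top)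
  thus "\<exists>g. approximable q g \<and> Lq_pow m q (\<lambda>x. indicator A x - g x) < e"
    using Lq_pow_indicator_diff(1)[OF K(2) compact_sets[OF K(1)] A(1)] q approximable_compact[OF q K(1)]
    by (metis less_le_trans zero_less_one)
qed

lemma approximable_simple:
  assumes q: "1 \<le> q" and s: "simple_function m s" and L: "s \<in> Lq m q"
  shows "approximable q s"
proof -
  have fin: "finite (range s)" using simple_functionD(1)[OF s] by simp
  have sets: "s -` {y} \<in> sets m" for y using simple_functionD(2)[OF s, of "{y}"] by simp
  have ap: "approximable q (\<lambda>x. y * indicator (s -` {y}) x)" for y
  \<comment> \<open>The zero set of s may have infinite measure; the other level sets have finite
    measure by integrability.\<close>
  proof (cases "y = 0")
    case True thus ?thesis using approximable_ball_span[OF q ball_span_zero] by simp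
  next
    case False
    have "ennreal (norm y powr q) * emeasure m (s -` {y})
        = (\<integral>\<^sup>+x. ennreal (norm y powr q) * indicator (s -` {y}) x \<partial>m)"
      using sets by (simp add: nn_integral_cmult_indicator)
    also have "\<dots> \<le> (\<integral>\<^sup>+x. ennreal (norm (s x) powr q) \<partial>m)"
      by (intro nn_integral_mono) (auto simp: indicator_def)
    also have "\<dots> < \<infinity>" using nn_integral_Lq[OF L] by simp
    finally have "emeasure m (s -` {y}) < \<infinity>" using False by (auto simp: ennreal_mult_less_top)
    hence "approximable q (indicator (s -` {y}))" using approximable_indicator[OF q sets] by blast
    from approximable_lincomb[OF q this approximable_ball_span[OF q ball_span_zero]] show ?thesis by simp
  qed
  have "approximable q (\<lambda>x. \<Sum>y\<in>Y. y * indicator (s -` {y}) x)" if "finite Y" for Y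
    using that
  proof (induction rule: finite_induct)
    case empty show ?case using approximable_ball_span[OF q ball_span_zero] by simp
  next
    case (insert y Y)
    have "approximable q (\<lambda>x. 1 * (y * indicator (s -` {y}) x) + (\<Sum>y\<in>Y. y * indicator (s -` {y}) x))"
      by (rule approximable_lincomb[OF q ap insert(3)])
    thus ?case by (simp only: sum.insert[OF insert(1,2)] mult_1_left)
  qed
  moreover have "s x = (\<Sum>y\<in>range s. y * indicator (s -` {y}) x)" for x
  proof -
    have "(\<Sum>y\<in>range s. y * indicator (s -` {y}) x) = (\<Sum>y\<in>{s x}. y * indicator (s -` {y}) x)"
      using fin by (intro sum.mono_neutral_right) (auto simp: indicator_def)
    thus ?thesis by simp
  qed
  ultimately show ?thesis using fin by (metis (no_types, lifting) ext)
qed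

lemma ball_span_dense:
  assumes q: "1 \<le> q" and f: "f \<in> Lq m q" shows "approximable q f"
proof (rule approximable_limit[OF q f])
  fix e :: real assume e: "e > 0"
  note [measurable] = Lq_measurable[OF f]
  obtain s where s: "\<And>i. simple_function m (s i)" "\<And>x. (\<lambda>i. s i x) \<longlonglongrightarrow> f x"
    "\<And>i x. norm (s i x) \<le> 2 * norm (f x)"
    using borel_measurable_implies_sequence_metric[OF Lq_measurable[OF f], of 0] by (auto simp: dist_norm)
  note [measurable] = borel_measurable_simple_function[OF s(1)]
  have sL: "s i \<in> Lq m q" for i
  proof -
    have "integrable m (\<lambda>x. norm (s i x) powr q)"
    proof (rule Bochner_Integration.integrable_bound)
      show "integrable m (\<lambda>x. 2 powr q * norm (f x) powr q)" using Lq_integrable[OF f] by simp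
      have "norm (s i x) powr q \<le> (2 * norm (f x)) powr q" for x using s(3) q by (intro powr_mono2) auto
      thus "AE x in m. norm (norm (s i x) powr q) \<le> norm (2 powr q * norm (f x) powr q)"
        by (simp add: powr_mult)
    qed auto
    thus ?thesis by (simp add: Lq_def)
  qed
  have "(\<lambda>i. \<integral>x. norm (f x - s i x) powr q \<partial>m) \<longlonglongrightarrow> (\<integral>x. 0 \<partial>m)"
  proof (rule integral_dominated_convergence[where w="\<lambda>x. 3 powr q * norm (f x) powr q"])
    show "integrable m (\<lambda>x. 3 powr q * norm (f x) powr q)" using Lq_integrable[OF f] by simp
    show "AE x in m. (\<lambda>i. norm (f x - s i x) powr q) \<longlonglongrightarrow> 0"
    proof (rule AE_I2)
      fix x
      have "(\<lambda>i. norm (f x - s i x)) \<longlonglongrightarrow> norm (f x - f x)" by (intro tendsto_intros s(2))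
      hence "(\<lambda>i. norm (f x - s i x) powr q) \<longlonglongrightarrow> 0 powr q" using q by (intro tendsto_powr') auto
      thus "(\<lambda>i. norm (f x - s i x) powr q) \<longlonglongrightarrow> 0" using q by simp
    qed
    fix i
    have "norm (f x - s i x) powr q \<le> 3 powr q * norm (f x) powr q" for x
    proof -
      have "norm (f x - s i x) \<le> 3 * norm (f x)"
        using norm_triangle_ineq4[of "f x" "s i x"] s(3)[of i x] by linarith
      hence "norm (f x - s i x) powr q \<le> (3 * norm (f x)) powr q" using q by (intro powr_mono2) auto
      thus ?thesis by (simp add: powr_mult)
    qed
    thus "AE x in m. norm (norm (f x - s i x) powr q) \<le> 3 powr q * norm (f x) powr q" by simp
  qed auto
  hence "(\<lambda>i. Lq_pow m q (\<lambda>x. f x - s i x)) \<longlonglongrightarrow> 0" by (simp add: Lq_pow_def)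
  hence "\<forall>\<^sub>F i in sequentially. Lq_pow m q (\<lambda>x. f x - s i x) < e" using e by (rule order_tendstoD)
  then obtain i where "Lq_pow m q (\<lambda>x. f x - s i x) < e" by (auto simp: eventually_sequentially)
  thus "\<exists>g. approximable q g \<and> Lq_pow m q (\<lambda>x. f x - g x) < e"
    using approximable_simple[OF q s(1) sL] by blast
qed

section \<open>The hierarchical Laplacian on ball functions\<close>

lemma mu_nonzero [simp]: "B \<in> all_balls \<Longrightarrow> mu B \<noteq> 0"
  using mu_pos by (metis less_irrefl)

text \<open>Unlike \<open>multiplier_bound\<close> it asks for summable increments above B only, and
  so applies to the unbounded \<open>lam_id\<close>.\<close>

lemma multiplier_norm_le:
  assumes "incr_summable F" "B \<in> all_balls" "\<And>T. T \<in> all_balls \<Longrightarrow> B \<subseteq> T \<Longrightarrow> norm (p T) \<le> K"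
  shows "norm (multiplier F p B) \<le> (norm (F (lam_parent B)) + (\<Sum>\<^sub>\<infinity>T\<in>up B. norm (incr F T))) * K"
proof -
  have p: "norm (p B) \<le> K" using assms(2,3) by simp
  have s1: "(\<lambda>T. norm (incr F T) * K) summable_on up B"
    using assms(1,2) by (intro summable_on_cmult_left) (simp add: incr_summable_def)
  have le: "norm (incr F T * p T) \<le> norm (incr F T) * K" if "T \<in> up B" for T
    using assms(3)[OF up_all[OF that] up_le[OF that]] by (auto simp: norm_mult intro!: mult_left_mono)
  have s2: "(\<lambda>T. norm (incr F T * p T)) summable_on up B"
    using s1 by (rule summable_on_comparison_test) (use le in auto)
  have "norm (\<Sum>\<^sub>\<infinity>T\<in>up B. incr F T * p T) \<le> (\<Sum>\<^sub>\<infinity>T\<in>up B. norm (incr F T * p T))"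
    by (rule norm_infsum_bound[OF s2])
  also have "\<dots> \<le> (\<Sum>\<^sub>\<infinity>T\<in>up B. norm (incr F T) * K)" using s1 s2 le by (intro infsum_mono) auto
  also have "\<dots> = (\<Sum>\<^sub>\<infinity>T\<in>up B. norm (incr F T)) * K" by (simp add: infsum_cmult_left')
  finally have "norm (\<Sum>\<^sub>\<infinity>T\<in>up B. incr F T * p T) \<le> (\<Sum>\<^sub>\<infinity>T\<in>up B. norm (incr F T)) * K" .
  moreover have "norm (F (lam_parent B) * p B) \<le> norm (F (lam_parent B)) * K"
    using p by (simp add: norm_mult mult_left_mono)
  ultimately show ?thesis unfolding multiplier_def distrib_right
    by (intro order_trans[OF norm_triangle_ineq] add_mono)
qed

text \<open>Derived from ball means, where all series converge absolutely; at a single point the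
  series defining \<open>fcalc\<close> may diverge, hence the identity almost everywhere.\<close>

lemma fcalc_linear_AE:
  assumes "admissible F c M" "1 \<le> q" "u \<in> Lq m q" "v \<in> Lq m q"
  shows "AE x in m. fcalc F c (\<lambda>y. a * u y + v y) x = a * fcalc F c u x + fcalc F c v x"
proof (rule means_determine[OF assms(2)])
  have q: "0 \<le> q" using assms by simp
  note uv = Lq_lincomb[OF q assms(3,4), of a]
  note Fu = fcalc_Lq(1)[OF assms(1,2,3)] and Fv = fcalc_Lq(1)[OF assms(1,2,4)]
  show "fcalc F c (\<lambda>y. a * u y + v y) \<in> Lq m q" by (rule fcalc_Lq(1)[OF assms(1,2) uv])
  show "(\<lambda>x. a * fcalc F c u x + fcalc F c v x) \<in> Lq m q" by (rule Lq_lincomb[OF q Fu Fv])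
  fix B :: "'a set" assume B: "B \<in> all_balls"
  have "mean (fcalc F c (\<lambda>y. a * u y + v y)) B = multiplier F (\<lambda>T. a * mean u T + mean v T) B"
    unfolding mean_fcalc[OF assms(1,2) uv B]
    by (rule multiplier_cong[OF B]) (auto intro: mean_lincomb[OF assms(2,3,4)])
  also have "\<dots> = a * multiplier F (mean u) B + multiplier F (mean v) B"
    using assms by (intro multiplier_linear admissible_incr_summable bounded_above_mean B)
  finally show "mean (fcalc F c (\<lambda>y. a * u y + v y)) B = mean (\<lambda>x. a * fcalc F c u x + fcalc F c v x) B"
    by (simp add: mean_lincomb[OF assms(2) Fu Fv B] mean_fcalc[OF assms(1,2) _ B] assms(3,4))
qed

lemma fcalc_bounded_operator:
  assumes "admissible F c M" "1 \<le> q"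
  shows "bounded_operator m q (fcalc F c)"
  unfolding bounded_operator_def
proof (intro conjI ballI allI)
  show "fcalc F c f \<in> Lq m q" if "f \<in> Lq m q" for f using fcalc_Lq(1)[OF assms that] .
  show "AE x in m. fcalc F c (\<lambda>y. a * f y + g y) x = a * fcalc F c f x + fcalc F c g x"
    if "f \<in> Lq m q" "g \<in> Lq m q" for a f g using fcalc_linear_AE[OF assms that] .
  have "0 \<le> M" using assms by (simp add: admissible_def)
  thus "\<exists>K. \<forall>f\<in>Lq m q. Lq_norm m q (fcalc F c f) \<le> K * Lq_norm m q f"
    using Lq_norm_le[OF fcalc_Lq(2)[OF assms] assms(2)] by blast
qed

text \<open>\<open>F(L)\<close> applied to the indicator of \<open>S\<close>; this also makes sense for the unbounded \<open>F = lam_id\<close>,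
  for which \<open>fcalc\<close> is not available.\<close>

definition ball_image :: "(real \<Rightarrow> complex) \<Rightarrow> 'a set \<Rightarrow> 'a \<Rightarrow> complex" where
  "ball_image F S x = F (lam_parent S) * indicator S x
     + (\<Sum>\<^sub>\<infinity>T\<in>{T \<in> up S. x \<in> T}. incr F T * mean (indicator S) T)"

lemma mean_indicator:
  assumes "S \<in> all_balls" "T \<in> all_balls"
  shows "mean (indicator S) T = of_real (mu (S \<inter> T) / mu T)"
  using integral_indicator_Int[OF assms(2,1)] by (simp add: mean_eq Int_commute)

lemma mean_indicator_sub: "S \<in> all_balls \<Longrightarrow> T \<in> all_balls \<Longrightarrow> T \<subseteq> S \<Longrightarrow> mean (indicator S) T = 1"
  using mu_pos[of T] by (simp add: mean_indicator Int_absorb1)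

lemma mean_indicator_disj: "S \<in> all_balls \<Longrightarrow> T \<in> all_balls \<Longrightarrow> T \<inter> S = {} \<Longrightarrow> mean (indicator S) T = 0"
  by (simp add: mean_indicator Int_commute[of S] mu_def)

lemma mean_indicator_sup: "S \<in> all_balls \<Longrightarrow> T \<in> all_balls \<Longrightarrow> S \<subseteq> T \<Longrightarrow> mean (indicator S) T = of_real (mu S / mu T)"
  by (simp add: mean_indicator Int_absorb2)

lemma mu_mono: assumes "S \<subseteq> T" "T \<in> all_balls" "S \<in> all_balls" shows "mu S \<le> mu T"
  using emeasure_mono[OF assms(1) balls_sets[OF assms(2)]] emeasure_mu assms(2,3)
  by (simp add: ennreal_le_iff)

lemma norm_mean_indicator_le:
  assumes "S \<in> all_balls" "T \<in> all_balls" shows "norm (mean (indicator S) T) \<le> 1"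
proof -
  have "mu (S \<inter> T) \<le> mu T"
    unfolding mu_def using assms emeasure_ball_finite[OF assms(2)]
    by (intro measure_mono_fmeasurable) (auto simp: fmeasurable_def less_top)
  thus ?thesis using mu_pos[OF assms(2)] by (simp add: mean_indicator[OF assms] norm_divide)
qed

lemma ball_trichotomy:
  assumes "S \<in> all_balls" "T \<in> ns_balls"
  obtains "T \<subseteq> S" "T \<notin> up S" | "T \<in> up S" "\<not> T \<subseteq> S" | "T \<inter> S = {}" "T \<notin> up S" "\<not> T \<subseteq> S"
proof -
  consider "T \<subseteq> S" | "S \<subset> T" | "T \<inter> S = {}"
    using balls_nested[OF ns_balls_all[OF assms(2)] assms(1)] by blast
  thus thesis
    using that assms balls_nonempty[OF assms(1)] balls_nonempty[OF ns_balls_all[OF assms(2)]]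
    by cases (auto simp: up_def)
qed

text \<open>Balls inside S average the indicator to 1 and telescope against the diagonal part; balls
  disjoint from S contribute 0.\<close>

lemma fcalc_indicator:
  assumes adm: "admissible F c M" and S: "S \<in> all_balls"
  shows "fcalc F c (indicator S) x = ball_image F S x"
proof -
  obtain G where dom: "dominated F G" using adm by (auto simp: admissible_def)
  have lim: "(F \<longlongrightarrow> c) at_top" using adm by (simp add: admissible_def)
  let ?f = "\<lambda>T. incr F T * mean (indicator S) T"
  show ?thesis
  proof (cases "x \<in> S")
    case True
    have eq: "{T \<in> ns_balls. x \<in> T} = {T \<in> ns_balls. x \<in> T \<and> T \<subseteq> S} \<union> up S"
    proof -
      have "T \<subseteq> S \<or> T \<in> up S" if "T \<in> ns_balls" "x \<in> T" for T
        using S that(1) by (rule ball_trichotomy) (use that True in auto)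
      thus ?thesis using True by (auto simp: up_def)
    qed
    have "(incr F has_sum (F (lam_parent S) - phi F c x)) {T \<in> ns_balls. x \<in> T \<and> T \<subseteq> S}"
      by (rule has_sum_incr_point[OF dom lim S True])
    hence h1: "(?f has_sum (F (lam_parent S) - phi F c x)) {T \<in> ns_balls. x \<in> T \<and> T \<subseteq> S}"
      using S by (subst has_sum_cong[of _ _ "incr F"]) (auto simp: mean_indicator_sub ns_balls_all)
    have "?f summable_on up S"
    proof -
      have "bounded_above (mean (indicator S))"
        unfolding bounded_above_def using norm_mean_indicator_le[OF S] by blast
      thus ?thesis using multiplier_summable(2)[OF dominated_incr_summable[OF dom] _ S] by blast
    qed
    hence h2: "(?f has_sum infsum ?f (up S)) (up S)" by simp
    have "(?f has_sum (F (lam_parent S) - phi F c x + infsum ?f (up S))) {T \<in> ns_balls. x \<in> T}"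
      unfolding eq by (rule has_sum_Un_disjoint[OF h1 h2]) (auto simp: up_def)
    moreover have "{T \<in> up S. x \<in> T} = up S" using True by (auto simp: up_def)
    ultimately show ?thesis using True by (simp add: fcalc_def ball_image_def infsumI)
  next
    case False
    have "(\<Sum>\<^sub>\<infinity>T\<in>{T \<in> ns_balls. x \<in> T}. ?f T) = (\<Sum>\<^sub>\<infinity>T\<in>{T \<in> up S. x \<in> T}. ?f T)"
    proof (rule infsum_cong_neutral)
      fix T assume T: "T \<in> {T \<in> ns_balls. x \<in> T} - {T \<in> up S. x \<in> T}"
      hence "T \<in> ns_balls" by simp
      with S show "?f T = 0"
        by (rule ball_trichotomy) (use T False S in \<open>auto simp: mean_indicator_disj ns_balls_all\<close>)
    qed (auto simp: up_def)
    thus ?thesis using False by (simp add: fcalc_def ball_image_def)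
  qed
qed

section \<open>The Laplacian of indicators of balls\<close>

definition lam_id :: "real \<Rightarrow> complex" where "lam_id s = of_real s"

lemma incr_lam_id: "T \<in> ns_balls \<Longrightarrow> incr lam_id T = - of_real (C T)"
  using lam_eq[of T] by (simp add: incr_def lam_id_def)

lemma norm_incr_lam_id: "T \<in> ns_balls \<Longrightarrow> norm (incr lam_id T) = C T"
  using C_pos[of T] by (simp add: incr_lam_id)

lemma incr_summable_lam_id: "incr_summable lam_id"
  unfolding incr_summable_def
proof
  fix B :: "'a set" assume "B \<in> all_balls"
  hence "C summable_on up B" by (rule C_summable_up)
  thus "(\<lambda>T. norm (incr lam_id T)) summable_on up B"
    by (subst summable_on_cong[of _ _ C]) (auto simp: norm_incr_lam_id up_ns)
qed

lemma infsum_norm_incr_lam_id: "B \<in> all_balls \<Longrightarrow> (\<Sum>\<^sub>\<infinity>T\<in>up B. norm (incr lam_id T)) = lam_parent B"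
  unfolding lam_parent_def by (intro infsum_cong) (auto simp: norm_incr_lam_id up_ns)

definition lap_term :: "('a \<Rightarrow> complex) \<Rightarrow> 'a \<Rightarrow> 'a set \<Rightarrow> complex" where
  "lap_term f x B = C B *\<^sub>R (mean f B - f x)"

text \<open>Since x lies in T, the mean over T and the value at x agree, both being 1 or both 0,
  unless S is properly below T.\<close>

lemma lap_term_indicator:
  assumes "S \<in> all_balls" "T \<in> ns_balls" "x \<in> T"
  shows "lap_term (indicator S) x T = (if T \<in> up S then C T *\<^sub>R (mean (indicator S) T - indicator S x) else 0)"
  using assms(1,2)
  by (rule ball_trichotomy)
    (use assms in \<open>auto simp: lap_term_def mean_indicator_sub mean_indicator_disj ns_balls_all indicator_def\<close>)

lemma lap_term_indicator_summable:
  assumes "S \<in> all_balls" shows "lap_term (indicator S) x summable_on {T \<in> ns_balls. x \<in> T}"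
proof -
  have "(\<lambda>T. C T * 2) summable_on up S" by (intro summable_on_cmult_left C_summable_up assms)
  hence "(\<lambda>T. C T * 2) summable_on {T \<in> up S. x \<in> T}" by (rule summable_on_subset_banach) auto
  hence "(\<lambda>T. norm (lap_term (indicator S) x T)) summable_on {T \<in> up S. x \<in> T}"
  proof (rule summable_on_comparison_test)
    fix T assume T: "T \<in> {T \<in> up S. x \<in> T}"
    hence a: "T \<in> all_balls" "C T > 0" using up_all up_ns C_pos by auto
    have "norm (mean (indicator S) T - indicator S x) \<le> 1 + 1"
      using norm_mean_indicator_le[OF assms a(1)]
      by (intro order_trans[OF norm_triangle_ineq4] add_mono) (auto simp: indicator_def)
    thus "norm (lap_term (indicator S) x T) \<le> C T * 2"
      using a by (simp add: lap_term_def mult_left_mono)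
  qed auto
  hence "lap_term (indicator S) x summable_on {T \<in> up S. x \<in> T}" by (rule abs_summable_summable)
  moreover have "lap_term (indicator S) x summable_on {T \<in> ns_balls. x \<in> T} \<longleftrightarrow>
      lap_term (indicator S) x summable_on {T \<in> up S. x \<in> T}"
    using assms by (intro summable_on_cong_neutral) (auto simp: lap_term_indicator up_ns)
  ultimately show ?thesis by simp
qed

text \<open>As \<open>incr lam_id T\<close> is - C T, the averages match term by term, and the
  weights of the subtracted value at x add up to \<open>lam_parent S\<close>.\<close>

lemma laplacian_indicator:
  assumes S: "S \<in> all_balls"
  shows "hier_Laplacian m C (indicator S) x = ball_image lam_id S x"
proof -
  have sC: "C summable_on {T \<in> up S. x \<in> T}"
    using C_summable_up[OF S] by (rule summable_on_subset_banach) auto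
  have "bounded_above (mean (indicator S))"
    unfolding bounded_above_def using norm_mean_indicator_le[OF S] by blast
  hence "(\<lambda>T. incr lam_id T * mean (indicator S) T) summable_on up S"
    using multiplier_summable(2)[OF incr_summable_lam_id _ S] by blast
  hence sw: "(\<lambda>T. incr lam_id T * mean (indicator S) T) summable_on {T \<in> up S. x \<in> T}"
    by (rule summable_on_subset_banach) auto
  have "hier_Laplacian m C (indicator S) x = - infsum (lap_term (indicator S) x) {T \<in> ns_balls. x \<in> T}"
    by (simp add: hier_Laplacian_def lap_term_def[abs_def])
  also have "infsum (lap_term (indicator S) x) {T \<in> ns_balls. x \<in> T}
      = (\<Sum>\<^sub>\<infinity>T\<in>{T \<in> up S. x \<in> T}. C T *\<^sub>R (mean (indicator S) T - indicator S x))"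
    by (intro infsum_cong_neutral) (auto simp: lap_term_indicator[OF S] up_ns)
  also have "\<dots> = (\<Sum>\<^sub>\<infinity>T\<in>{T \<in> up S. x \<in> T}. - (incr lam_id T * mean (indicator S) T) + of_real (C T) * (- indicator S x))"
    by (intro infsum_cong) (auto simp: incr_lam_id up_ns scaleR_conv_of_real algebra_simps)
  also have "\<dots> = - (\<Sum>\<^sub>\<infinity>T\<in>{T \<in> up S. x \<in> T}. incr lam_id T * mean (indicator S) T)
      + (\<Sum>\<^sub>\<infinity>T\<in>{T \<in> up S. x \<in> T}. of_real (C T)) * (- indicator S x)"
  proof -
    have s1: "(\<lambda>T. - (incr lam_id T * mean (indicator S) T)) summable_on {T \<in> up S. x \<in> T}"
      using sw by (simp only: summable_on_uminus)
    have s2: "(\<lambda>T. of_real (C T) * (- indicator S x) :: complex) summable_on {T \<in> up S. x \<in> T}"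
      using sC by (intro summable_on_cmult_left summable_on_of_real)
    show ?thesis using infsum_add[OF s1 s2] by (simp only: infsum_uminus infsum_cmult_left')
  qed
  also have "(\<Sum>\<^sub>\<infinity>T\<in>{T \<in> up S. x \<in> T}. of_real (C T)) * (- indicator S x :: complex) = - (lam_id (lam_parent S) * indicator S x)"
  proof (cases "x \<in> S")
    case True
    hence "{T \<in> up S. x \<in> T} = up S" by (auto simp: up_def)
    moreover have "(\<Sum>\<^sub>\<infinity>T\<in>up S. of_real (C T)) = complex_of_real (lam_parent S)"
      unfolding lam_parent_def using C_summable_up[OF S] by (intro infsumI has_sum_of_real) simp
    ultimately show ?thesis using True by (simp add: lam_id_def)
  qed simp
  finally show ?thesis by (simp add: ball_image_def)
qed

lemma lap_term_lincomb:
  assumes "f \<in> Lq m 1" "g \<in> Lq m 1" "T \<in> all_balls"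
  shows "lap_term (\<lambda>x. c * f x + g x) x T = c * lap_term f x T + lap_term g x T"
  using mean_lincomb[OF _ assms, of c] by (simp add: lap_term_def scaleR_conv_of_real algebra_simps)

lemma ball_span_laplacian:
  assumes "d \<in> ball_span"
  shows "lap_term d x summable_on {T \<in> ns_balls. x \<in> T}"
    "B \<in> all_balls \<Longrightarrow> hier_Laplacian m C (\<lambda>x. c * indicator B x + d x) x
      = c * ball_image lam_id B x + hier_Laplacian m C d x"
proof -
  have iL: "indicator B \<in> Lq m 1" if "B \<in> all_balls" for B
    using that emeasure_ball_finite by (intro Lq_indicator) auto
  have step: "lap_term (\<lambda>x. c * indicator B x + d x) x T = c * lap_term (indicator B) x T + lap_term d x T"
    if "d \<in> ball_span" "B \<in> all_balls" "T \<in> ns_balls" for c B d T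
    by (rule lap_term_lincomb[OF iL[OF that(2)] ball_span_Lq[OF _ that(1)] ns_balls_all[OF that(3)]]) simp
  have sm: "lap_term d x summable_on {T \<in> ns_balls. x \<in> T}" if "d \<in> ball_span" for d
    using that
  proof (induction rule: ball_span.induct)
    case ball_span_zero
    show ?case by (simp add: lap_term_def[abs_def] mean_eq)
  next
    case (ball_span_step d B c)
    have "(\<lambda>T. c * lap_term (indicator B) x T + lap_term d x T) summable_on {T \<in> ns_balls. x \<in> T}"
      using ball_span_step by (intro summable_on_add summable_on_cmult_right lap_term_indicator_summable)
    thus ?case by (subst summable_on_cong) (auto simp: step ball_span_step)
  qed
  show "lap_term d x summable_on {T \<in> ns_balls. x \<in> T}" by (rule sm[OF assms])
  assume B: "B \<in> all_balls"
  have "(\<Sum>\<^sub>\<infinity>T\<in>{T \<in> ns_balls. x \<in> T}. lap_term (\<lambda>x. c * indicator B x + d x) x T)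
     = (\<Sum>\<^sub>\<infinity>T\<in>{T \<in> ns_balls. x \<in> T}. c * lap_term (indicator B) x T + lap_term d x T)"
    by (intro infsum_cong) (simp add: step assms B)
  also have "\<dots> = c * (\<Sum>\<^sub>\<infinity>T\<in>{T \<in> ns_balls. x \<in> T}. lap_term (indicator B) x T)
      + (\<Sum>\<^sub>\<infinity>T\<in>{T \<in> ns_balls. x \<in> T}. lap_term d x T)"
    using lap_term_indicator_summable[OF B] sm[OF assms]
    by (subst infsum_add) (auto intro: summable_on_cmult_right simp: infsum_cmult_right')
  finally show "hier_Laplacian m C (\<lambda>x. c * indicator B x + d x) x
      = c * ball_image lam_id B x + hier_Laplacian m C d x"
    unfolding laplacian_indicator[OF B, symmetric]
    by (simp add: hier_Laplacian_def lap_term_def algebra_simps)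
qed

section \<open>Bounds, pairing and symmetry for images of indicators\<close>

lemma ball_image_measurable: "S \<in> all_balls \<Longrightarrow> ball_image F S \<in> borel_measurable m"
proof -
  assume [measurable]: "S \<in> all_balls"
  let ?a = "\<lambda>T. if T \<in> up S then incr F T * mean (indicator S) T else 0"
  have "(\<Sum>\<^sub>\<infinity>T\<in>{T \<in> ns_balls. x \<in> T}. ?a T) = (\<Sum>\<^sub>\<infinity>T\<in>{T \<in> up S. x \<in> T}. incr F T * mean (indicator S) T)" for x
    by (intro infsum_cong_neutral) (auto simp: up_def)
  with point_infsum_measurable[of ?a]
  have [measurable]: "(\<lambda>x. \<Sum>\<^sub>\<infinity>T\<in>{T \<in> up S. x \<in> T}. incr F T * mean (indicator S) T) \<in> borel_measurable m" by simp
  show ?thesis unfolding ball_image_def[abs_def] by measurable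
qed

text \<open>Subtracting k times the indicator serves two purposes: k = 0 gives the size of the
  image, k = 1 the distance of a Markov operator from the identity on this indicator.\<close>

lemma ball_image_Lq:
  assumes F: "incr_summable F" and S: "S \<in> all_balls" and q: "1 \<le> q"
    and M: "(\<Sum>\<^sub>\<infinity>T\<in>up S. norm (incr F T)) + norm (F (lam_parent S) - k) \<le> M" "0 < M"
  shows "(\<lambda>x. ball_image F S x - k * indicator S x) \<in> Lq m q"
    "Lq_pow m q (\<lambda>x. ball_image F S x - k * indicator S x) \<le> M powr q * mu S"
proof -
  let ?a = "\<lambda>T. if T \<in> up S then norm (incr F T) else 0"
  let ?b = "\<lambda>x::'a. ennreal (norm (F (lam_parent S) - k))"
  have sF: "(\<lambda>T. norm (incr F T)) summable_on up S" using F S by (simp add: incr_summable_def)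
  have s: "?a summable_on {T \<in> ns_balls. x \<in> T}" for x
  proof -
    have "(\<lambda>T. norm (incr F T)) summable_on {T \<in> up S. x \<in> T}" using sF by (rule summable_on_subset_banach) auto
    moreover have "?a summable_on {T \<in> ns_balls. x \<in> T} \<longleftrightarrow> (\<lambda>T. norm (incr F T)) summable_on {T \<in> up S. x \<in> T}"
      by (intro summable_on_cong_neutral) (auto simp: up_def)
    ultimately show ?thesis by simp
  qed
  have tot: "(\<integral>\<^sup>+T. ennreal (?a T) * indicator T x \<partial>count_space ns_balls) + ?b x \<le> ennreal M" for x
  proof -
    have "(\<Sum>\<^sub>\<infinity>T\<in>{T \<in> ns_balls. x \<in> T}. ?a T) \<le> (\<Sum>\<^sub>\<infinity>T\<in>up S. norm (incr F T))"
      using s sF by (intro infsum_mono_neutral) auto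
    hence "(\<Sum>\<^sub>\<infinity>T\<in>{T \<in> ns_balls. x \<in> T}. ?a T) + norm (F (lam_parent S) - k) \<le> M" using M(1) by linarith
    hence "ennreal ((\<Sum>\<^sub>\<infinity>T\<in>{T \<in> ns_balls. x \<in> T}. ?a T) + norm (F (lam_parent S) - k)) \<le> ennreal M"
      by (rule ennreal_leI)
    moreover have "(\<integral>\<^sup>+T. ennreal (?a T) * indicator T x \<partial>count_space ns_balls)
        = ennreal (\<Sum>\<^sub>\<infinity>T\<in>{T \<in> ns_balls. x \<in> T}. ?a T)" by (rule nn_point_sum[OF s]) simp
    moreover have "0 \<le> (\<Sum>\<^sub>\<infinity>T\<in>{T \<in> ns_balls. x \<in> T}. ?a T)" by (intro infsum_nonneg) auto
    ultimately show ?thesis by (simp only: ennreal_plus norm_ge_zero)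
  qed
  have le: "ennreal (norm (ball_image F S x - k * indicator S x))
      \<le> avg (\<lambda>T. ennreal (?a T)) ?b (\<lambda>y. ennreal (norm (indicator S y :: complex))) x" for x
  proof -
    let ?f = "\<lambda>T. incr F T * mean (indicator S) T"
    have "(\<Sum>\<^sub>\<infinity>T\<in>{T \<in> up S. x \<in> T}. ?f T) = (\<Sum>\<^sub>\<infinity>T\<in>ns_balls. (if T \<in> up S then ?f T else 0) * indicator T x)"
      by (intro infsum_cong_neutral) (auto simp: indicator_def up_def)
    hence "ennreal (norm (\<Sum>\<^sub>\<infinity>T\<in>{T \<in> up S. x \<in> T}. ?f T))
        \<le> (\<integral>\<^sup>+T. ennreal (norm ((if T \<in> up S then ?f T else 0) * indicator T x)) \<partial>count_space ns_balls)"
      by (simp only: norm_infsum_le_nn)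
    also have "\<dots> \<le> (\<integral>\<^sup>+T. ennreal (?a T) * indicator T x
        * nnmean (\<lambda>y. ennreal (norm (indicator S y :: complex))) T \<partial>count_space ns_balls)"
    proof (rule nn_integral_mono)
      fix T assume "T \<in> space (count_space (ns_balls :: 'a set set))"
      hence T: "T \<in> all_balls" using ns_balls_all by auto
      have "ennreal (norm (incr F T)) * ennreal (norm (mean (indicator S) T))
          \<le> ennreal (norm (incr F T)) * nnmean (\<lambda>y. ennreal (norm (indicator S y :: complex))) T"
        using norm_mean_le[OF T] by (intro mult_left_mono) auto
      thus "ennreal (norm ((if T \<in> up S then ?f T else 0) * indicator T x))
          \<le> ennreal (?a T) * indicator T x * nnmean (\<lambda>y. ennreal (norm (indicator S y :: complex))) T"
        by (auto simp: norm_mult ennreal_mult indicator_def)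
    qed
    finally have *: "ennreal (norm (\<Sum>\<^sub>\<infinity>T\<in>{T \<in> up S. x \<in> T}. ?f T)) + ennreal (norm ((F (lam_parent S) - k) * indicator S x))
        \<le> avg (\<lambda>T. ennreal (?a T)) ?b (\<lambda>y. ennreal (norm (indicator S y :: complex))) x"
      unfolding avg_def by (intro add_mono) (simp_all add: norm_mult ennreal_mult)
    have eq: "ball_image F S x - k * indicator S x = (\<Sum>\<^sub>\<infinity>T\<in>{T \<in> up S. x \<in> T}. ?f T) + (F (lam_parent S) - k) * indicator S x"
      by (simp add: ball_image_def algebra_simps)
    have "ennreal (norm (ball_image F S x - k * indicator S x)) \<le>
      ennreal (norm (\<Sum>\<^sub>\<infinity>T\<in>{T \<in> up S. x \<in> T}. ?f T)) + ennreal (norm ((F (lam_parent S) - k) * indicator S x))"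
      unfolding eq ennreal_plus[symmetric, OF norm_ge_zero norm_ge_zero]
      by (intro ennreal_leI norm_triangle_ineq)
    thus ?thesis using * by (rule order_trans)
  qed
  have iL: "indicator S \<in> Lq m q" using q emeasure_ball_finite[OF S] S by (intro Lq_indicator) auto
  note [measurable] = ball_image_measurable[OF S] balls_sets[OF S]
  have ms: "(\<lambda>x. ball_image F S x - k * indicator S x) \<in> borel_measurable m" by measurable
  note r = avg_Lq[OF q M(2) tot _ iL ms le]
  show "(\<lambda>x. ball_image F S x - k * indicator S x) \<in> Lq m q" using r by simp
  have "Lq_pow m q (indicator S) = mu S" using Lq_pow_indicator[of S q] q S by (simp add: mu_def)
  thus "Lq_pow m q (\<lambda>x. ball_image F S x - k * indicator S x) \<le> M powr q * mu S" using r by simp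
qed

text \<open>F(L) is moved from the indicator to u; this gives the means of \<open>ball_image\<close>
  as well as the adjoint in L^2.\<close>

lemma ball_image_pairing:
  assumes F: "incr_summable F" and S: "S \<in> all_balls" and q: "1 \<le> q" and u: "u \<in> Lq m q"
  shows "(\<integral>x. ball_image F S x * u x \<partial>m) = mu S * multiplier F (mean u) S"
proof -
  note [measurable] = Lq_measurable[OF u] balls_sets[OF S]
  let ?a = "\<lambda>T. if T \<in> up S then incr F T * mean (indicator S) T else 0"
  \<comment> \<open>The mean of the indicator contributes m(S) / m(T), which compensates the term
    m(T) arising from norm (u x) <= norm (u x) powr q + 1 on T.\<close>
  define K where "K = Lq_pow m q u / mu S + 1"
  have sF: "(\<lambda>T. norm (incr F T)) summable_on up S" using F S by (simp add: incr_summable_def)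
  have bound: "ennreal (norm (?a T)) * (\<integral>\<^sup>+x. indicator T x * ennreal (norm (u x)) \<partial>m)
      \<le> ennreal ((if T \<in> up S then norm (incr F T) else 0) * (mu S * K))" if "T \<in> ns_balls" for T
  proof (cases "T \<in> up S")
    case True
    have T: "T \<in> all_balls" "S \<subseteq> T" using True up_all up_le by auto
    note [measurable] = balls_sets[OF T(1)]
    have i: "integrable m (\<lambda>x. indicator T x * u x)" by (rule Lq_integrable_ball[OF q u T(1)])
    have "(\<integral>\<^sup>+x. indicator T x * ennreal (norm (u x)) \<partial>m) = (\<integral>\<^sup>+x. ennreal (norm (indicator T x * u x)) \<partial>m)"
      by (intro nn_integral_cong) (auto simp: indicator_def)
    also have "\<dots> \<le> (\<integral>\<^sup>+x. ennreal (norm (u x) powr q) + indicator T x \<partial>m)"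
    proof (rule nn_integral_mono)
      fix x
      have "norm (u x) \<le> norm (u x) powr q + 1" by (simp add: le_powr_add_one q)
      hence "ennreal (norm (u x)) \<le> ennreal (norm (u x) powr q) + 1"
        using ennreal_leI[of "norm (u x)" "norm (u x) powr q + 1"] by simp
      thus "ennreal (norm (indicator T x * u x)) \<le> ennreal (norm (u x) powr q) + indicator T x"
        by (auto simp: indicator_def)
    qed
    also have "\<dots> = ennreal (Lq_pow m q u + mu T)"
      using T by (subst nn_integral_add) (auto simp: nn_integral_Lq[OF u] emeasure_mu ennreal_plus less_imp_le)
    finally have "ennreal (norm (?a T)) * (\<integral>\<^sup>+x. indicator T x * ennreal (norm (u x)) \<partial>m)
        \<le> ennreal (norm (?a T)) * ennreal (Lq_pow m q u + mu T)" by (intro mult_left_mono) auto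
    also have "\<dots> = ennreal (norm (incr F T) * (mu S / mu T * (Lq_pow m q u + mu T)))"
      using True T S mu_pos[OF T(1)] mu_pos[OF S]
      by (simp add: ennreal_mult[symmetric] norm_mult mean_indicator_sup norm_divide mult.assoc del: ennreal_plus)
    also have "\<dots> \<le> ennreal (norm (incr F T) * (mu S * K))"
    proof (intro ennreal_leI mult_left_mono)
      have "Lq_pow m q u / mu T \<le> Lq_pow m q u / mu S"
        using mu_mono[OF T(2,1) S] mu_pos[OF S] by (intro divide_left_mono) auto
      hence "mu S * (Lq_pow m q u / mu T + 1) \<le> mu S * K" unfolding K_def by (intro mult_left_mono) auto
      thus "mu S / mu T * (Lq_pow m q u + mu T) \<le> mu S * K" using mu_pos[OF T(1)] by (simp add: field_simps)
    qed simp
    finally show ?thesis using True by simp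
  qed simp
  have "(\<lambda>T. (if T \<in> up S then norm (incr F T) else 0) * (mu S * K)) summable_on ns_balls"
  proof -
    have "(\<lambda>T. if T \<in> up S then norm (incr F T) else 0) summable_on ns_balls \<longleftrightarrow> (\<lambda>T. norm (incr F T)) summable_on up S"
      by (intro summable_on_cong_neutral) (auto simp: up_def)
    thus ?thesis using sF by (intro summable_on_cmult_left) simp
  qed
  hence "(\<integral>\<^sup>+T. ennreal ((if T \<in> up S then norm (incr F T) else 0) * (mu S * K)) \<partial>count_space ns_balls) < \<infinity>"
    by (subst nn_integral_count_space_infsum) (auto simp: K_def)
  hence fin: "(\<integral>\<^sup>+T. ennreal (norm (?a T)) * (\<integral>\<^sup>+x. indicator T x * ennreal (norm (u x)) \<partial>m) \<partial>count_space ns_balls) < \<infinity>"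
    by (rule le_less_trans[rotated]) (intro nn_integral_mono, simp add: bound)
  note Fb = Fubini_balls[OF subset_refl _ fin]
  have e: "(\<Sum>\<^sub>\<infinity>T\<in>{T \<in> ns_balls. x \<in> T}. ?a T) = (\<Sum>\<^sub>\<infinity>T\<in>{T \<in> up S. x \<in> T}. incr F T * mean (indicator S) T)" for x
    by (intro infsum_cong_neutral) (auto simp: up_def)
  have "(\<integral>x. ball_image F S x * u x \<partial>m) =
      (\<integral>x. F (lam_parent S) * (indicator S x * u x) + (\<Sum>\<^sub>\<infinity>T\<in>{T \<in> ns_balls. x \<in> T}. ?a T) * u x \<partial>m)"
    by (simp add: ball_image_def e algebra_simps)
  also have "\<dots> = F (lam_parent S) * (\<integral>x. indicator S x * u x \<partial>m) + (\<Sum>\<^sub>\<infinity>T\<in>ns_balls. ?a T * (\<integral>x. indicator T x * u x \<partial>m))"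
    using Fb(1,2) Lq_integrable_ball[OF q u S] by (subst Bochner_Integration.integral_add) auto
  also have "(\<Sum>\<^sub>\<infinity>T\<in>ns_balls. ?a T * (\<integral>x. indicator T x * u x \<partial>m)) = (\<Sum>\<^sub>\<infinity>T\<in>up S. mu S * (incr F T * mean u T))"
  proof (rule infsum_cong_neutral)
    fix T assume "T \<in> ns_balls \<inter> up S"
    hence T: "T \<in> up S" "T \<in> all_balls" "S \<subseteq> T" using up_all up_le by auto
    thus "?a T * (\<integral>x. indicator T x * u x \<partial>m) = mu S * (incr F T * mean u T)"
      using mu_pos[OF T(2)] S by (simp add: mean_indicator_sup mean_times_mu[symmetric])
  qed (auto simp: up_def)
  also have "\<dots> = mu S * (\<Sum>\<^sub>\<infinity>T\<in>up S. incr F T * mean u T)" by (simp add: infsum_cmult_right')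
  finally show ?thesis using mean_times_mu[OF S, of u] by (simp add: multiplier_def algebra_simps)
qed

text \<open>If S lies in B, the balls of the chain from S to B have mean 1 for the indicator of B
  and telescope F from \<open>lam_parent S\<close> to \<open>lam_parent B\<close>; above B the means
  of the two indicators are in the ratio of m(S) to m(B). If S and B are disjoint, only balls above
  both contribute.\<close>

lemma multiplier_symmetric:
  assumes F: "incr_summable F" and S: "S \<in> all_balls" and B: "B \<in> all_balls"
  shows "mu S * multiplier F (mean (indicator B)) S = mu B * multiplier F (mean (indicator S)) B"
proof -
  have sub: "mu S * multiplier F (mean (indicator B)) S = mu B * multiplier F (mean (indicator S)) B"
    if S: "S \<in> all_balls" and B: "B \<in> all_balls" and SB: "S \<subseteq> B" for S B
  proof -
    have up: "up S = chain S B \<union> up B"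
    proof
      have "T \<in> chain S B \<or> T \<in> up B" if T: "T \<in> up S" for T
        using chain_subset[OF S up_all[OF T] B up_le[OF T] SB] T by (auto simp: chain_def up_def)
      thus "up S \<subseteq> chain S B \<union> up B" by blast
    qed (use SB in \<open>auto simp: chain_def up_def\<close>)
    have "bounded_above (mean (indicator B))"
      unfolding bounded_above_def using norm_mean_indicator_le[OF B] by blast
    hence s: "(\<lambda>T. incr F T * mean (indicator B) T) summable_on up B"
      using multiplier_summable(2)[OF F _ B] by blast
    have "(\<Sum>\<^sub>\<infinity>T\<in>up S. incr F T * mean (indicator B) T)
        = (\<Sum>\<^sub>\<infinity>T\<in>chain S B. incr F T * mean (indicator B) T) + (\<Sum>\<^sub>\<infinity>T\<in>up B. incr F T * mean (indicator B) T)"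
      unfolding up using s finite_chain[OF S B] by (intro infsum_Un_disjoint) (auto simp: chain_def up_def)
    also have "(\<Sum>\<^sub>\<infinity>T\<in>chain S B. incr F T * mean (indicator B) T) = (\<Sum>\<^sub>\<infinity>T\<in>chain S B. incr F T)"
      using B by (intro infsum_cong) (auto simp: chain_def mean_indicator_sub ns_balls_all)
    also have "\<dots> = F (lam_parent B) - F (lam_parent S)" using finite_chain[OF S B] sum_chain[OF S B SB, of F] by simp
    finally have "multiplier F (mean (indicator B)) S = F (lam_parent B) + (\<Sum>\<^sub>\<infinity>T\<in>up B. incr F T * mean (indicator B) T)"
      by (simp add: multiplier_def mean_indicator_sub[OF B S SB])
    moreover have "(\<Sum>\<^sub>\<infinity>T\<in>up B. mu S * (incr F T * mean (indicator B) T)) = (\<Sum>\<^sub>\<infinity>T\<in>up B. mu B * (incr F T * mean (indicator S) T))"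
    proof (rule infsum_cong)
      fix T assume T: "T \<in> up B"
      hence "S \<subseteq> T" "B \<subseteq> T" "T \<in> all_balls" using SB up_le up_all by blast+
      thus "mu S * (incr F T * mean (indicator B) T) = mu B * (incr F T * mean (indicator S) T)"
        using S B by (simp add: mean_indicator_sup)
    qed
    ultimately show ?thesis using mu_pos[OF B]
      by (simp add: multiplier_def mean_indicator_sup[OF S B SB] infsum_cmult_right' distrib_left)
  qed
  consider "S \<subseteq> B" | "B \<subseteq> S" | "S \<inter> B = {}" using balls_nested[OF S B] by blast
  thus ?thesis
  proof cases
    case 3
    have "(\<Sum>\<^sub>\<infinity>T\<in>up S. mu S * (incr F T * mean (indicator B) T)) = (\<Sum>\<^sub>\<infinity>T\<in>up B. mu B * (incr F T * mean (indicator S) T))"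
    proof (rule infsum_cong_neutral)
      fix T assume T: "T \<in> up B - up S"
      have T': "T \<in> all_balls" "T \<in> ns_balls" using T up_all up_ns by auto
      have "S \<inter> T = {}" using S T'(2)
        by (rule ball_trichotomy) (use T 3 balls_nonempty[OF B] in \<open>auto simp: up_def\<close>)
      thus "mu B * (incr F T * mean (indicator S) T) = 0" using T' S by (simp add: mean_indicator_disj Int_commute)
    next
      fix T assume T: "T \<in> up S - up B"
      have T': "T \<in> all_balls" "T \<in> ns_balls" using T up_all up_ns by auto
      have "B \<inter> T = {}" using B T'(2)
        by (rule ball_trichotomy) (use T 3 balls_nonempty[OF S] in \<open>auto simp: up_def\<close>)
      thus "mu S * (incr F T * mean (indicator B) T) = 0" using T' B by (simp add: mean_indicator_disj Int_commute)
    next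
      fix T assume "T \<in> up S \<inter> up B"
      hence "S \<subseteq> T" "B \<subseteq> T" "T \<in> all_balls" using up_le up_all by blast+
      thus "mu S * (incr F T * mean (indicator B) T) = mu B * (incr F T * mean (indicator S) T)"
        using S B by (simp add: mean_indicator_sup)
    qed
    thus ?thesis using 3 S B by (simp add: multiplier_def mean_indicator_disj Int_commute infsum_cmult_right')
  qed (use sub[OF S B] sub[OF B S] in auto)
qed

lemma mean_ball_image:
  assumes F: "incr_summable F" and S: "S \<in> all_balls" and B: "B \<in> all_balls"
  shows "mean (ball_image F S) B = multiplier F (mean (indicator S)) B"
proof -
  have "indicator B \<in> Lq m 1" using emeasure_ball_finite[OF B] B by (intro Lq_indicator) auto
  hence "(\<integral>x. ball_image F S x * indicator B x \<partial>m) = mu S * multiplier F (mean (indicator B)) S"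
    by (rule ball_image_pairing[OF F S, rotated]) simp
  hence "(\<integral>x. indicator B x * ball_image F S x \<partial>m) = mu B * multiplier F (mean (indicator S)) B"
    by (simp add: mult.commute multiplier_symmetric[OF F S B])
  thus ?thesis using mu_pos[OF B] by (simp add: mean_eq)
qed

section \<open>The closed operators\<close>

lemma incr_summable_affine: assumes "incr_summable F" shows "incr_summable (\<lambda>s. a * F s + b)"
  unfolding incr_summable_def
proof
  fix B :: "'a set" assume "B \<in> all_balls"
  hence "(\<lambda>T. norm a * norm (incr F T)) summable_on up B"
    using assms by (intro summable_on_cmult_right) (simp add: incr_summable_def)
  moreover have "norm (incr (\<lambda>s. a * F s + b) T) = norm a * norm (incr F T)" for T
    by (simp add: incr_def norm_mult[symmetric] right_diff_distrib)
  ultimately show "(\<lambda>T. norm (incr (\<lambda>s. a * F s + b) T)) summable_on up B" by simp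
qed

lemma multiplier_one:
  assumes "B \<in> all_balls" "\<And>s. s \<in> Lam \<Longrightarrow> F s = 1" shows "multiplier F p B = p B"
proof -
  have "multiplier F p B = multiplier (\<lambda>s. 0 * lam_id s + 1) p B"
    using assms by (intro multiplier_cong) auto
  thus ?thesis by (simp only: multiplier_affine) simp
qed

lemma bounded_above_multiplier_lam_id:
  assumes "bounded_above p" shows "bounded_above (multiplier lam_id p)"
  unfolding bounded_above_def
proof
  fix B :: "'a set" assume B: "B \<in> all_balls"
  obtain K where K: "0 \<le> K" "\<And>T. T \<in> all_balls \<Longrightarrow> B \<subseteq> T \<Longrightarrow> norm (p T) \<le> K"
    using bounded_aboveE[OF assms B] by metis
  have "norm (multiplier lam_id p T) \<le> (lam_parent B + lam_parent B) * K" if T: "T \<in> all_balls" "B \<subseteq> T" for T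
  proof -
    have "norm (multiplier lam_id p T) \<le> (norm (lam_id (lam_parent T)) + (\<Sum>\<^sub>\<infinity>S\<in>up T. norm (incr lam_id S))) * K"
      using T K(2) by (intro multiplier_norm_le[OF incr_summable_lam_id]) auto
    also have "\<dots> = (lam_parent T + lam_parent T) * K" using T by (simp add: infsum_norm_incr_lam_id lam_id_def)
    also have "\<dots> \<le> (lam_parent B + lam_parent B) * K" using lam_parent_mono[OF T(2) B T(1)] K(1) by (intro mult_right_mono) auto
    finally show ?thesis .
  qed
  thus "\<exists>K. \<forall>T\<in>all_balls. B \<subseteq> T \<longrightarrow> norm (multiplier lam_id p T) \<le> K" by blast
qed

text \<open>The operator is prescribed by its action on ball means, which makes it closed at once.\<close>

definition LC :: "real \<Rightarrow> 'a graph" where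
  "LC q = {(f, h). f \<in> Lq m q \<and> h \<in> Lq m q \<and> (\<forall>B\<in>all_balls. mean h B = multiplier lam_id (mean f) B)}"

lemma LC_D:
  assumes "(f, h) \<in> LC q"
  shows "f \<in> Lq m q" "h \<in> Lq m q" "B \<in> all_balls \<Longrightarrow> mean h B = multiplier lam_id (mean f) B"
  using assms by (auto simp: LC_def)

lemma LC_lincomb:
  assumes q: "1 \<le> q" and fg: "(f, g) \<in> LC q" "(f', g') \<in> LC q"
  shows "(\<lambda>x. c * f x + f' x, \<lambda>x. c * g x + g' x) \<in> LC q"
proof -
  have q0: "0 \<le> q" using q by simp
  note L = LC_D(1,2)[OF fg(1)] LC_D(1,2)[OF fg(2)]
  have "mean (\<lambda>x. c * g x + g' x) B = multiplier lam_id (mean (\<lambda>x. c * f x + f' x)) B" if B: "B \<in> all_balls" for B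
  proof -
    have "multiplier lam_id (mean (\<lambda>x. c * f x + f' x)) B = multiplier lam_id (\<lambda>T. c * mean f T + mean f' T) B"
      by (rule multiplier_cong[OF B]) (auto intro: mean_lincomb[OF q L(1,3)])
    also have "\<dots> = c * multiplier lam_id (mean f) B + multiplier lam_id (mean f') B"
      using q L by (intro multiplier_linear incr_summable_lam_id bounded_above_mean B)
    finally show ?thesis using LC_D(3)[OF fg(1) B] LC_D(3)[OF fg(2) B] by (simp add: mean_lincomb[OF q L(2,4) B])
  qed
  thus ?thesis using L q0 by (auto simp: LC_def intro!: Lq_lincomb)
qed

lemma LC_operator: assumes q: "1 \<le> q" shows "Lq_operator m q (LC q)"
  unfolding Lq_operator_def
proof (intro conjI allI impI)
  show "LC q \<subseteq> Lq m q \<times> Lq m q" by (auto simp: LC_def)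
  have "mean (\<lambda>x. 0) B = 0" for B :: "'a set" by (simp add: mean_eq)
  thus "(\<lambda>_. 0, \<lambda>_. 0) \<in> LC q" by (simp add: LC_def multiplier_def)
next
  fix c f g f' g' assume "(f, g) \<in> LC q \<and> (f', g') \<in> LC q"
  thus "(\<lambda>x. c * f x + f' x, \<lambda>x. c * g x + g' x) \<in> LC q" using LC_lincomb[OF q] by blast
next
  fix f g f' g'
  assume a: "(f, g) \<in> LC q \<and> f' \<in> Lq m q \<and> g' \<in> Lq m q \<and> (AE x in m. f' x = f x) \<and> (AE x in m. g' x = g x)"
  hence fg: "(f, g) \<in> LC q" by blast
  have "mean f' B = mean f B" "mean g' B = mean g B" if "B \<in> all_balls" for B
    using a LC_D(1,2)[OF fg] that by (auto intro!: mean_cong_AE Lq_measurable)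
  hence "mean g' B = multiplier lam_id (mean f') B" if "B \<in> all_balls" for B
    using LC_D(3)[OF fg that] multiplier_cong[OF that, of lam_id lam_id "mean f'" "mean f"] that by simp
  thus "(f', g') \<in> LC q" using a by (auto simp: LC_def)
next
  fix f g g' assume "(f, g) \<in> LC q \<and> (f, g') \<in> LC q"
  thus "AE x in m. g x = g' x" by (intro means_determine[OF q]) (auto simp: LC_def)
qed

lemma mean_tendsto:
  assumes q: "1 \<le> q" and u: "\<forall>\<^sub>F n in Fl. u n \<in> Lq m q" and B: "B \<in> all_balls" and l: "((\<lambda>n. Lq_pow m q (u n)) \<longlongrightarrow> 0) Fl"
  shows "((\<lambda>n. (Lq_pow m q (u n) / mu B) powr (1 / q)) \<longlongrightarrow> 0) Fl" "((\<lambda>n. mean (u n) B) \<longlongrightarrow> 0) Fl"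
proof -
  have "((\<lambda>n. Lq_pow m q (u n) / mu B) \<longlongrightarrow> 0 / mu B) Fl" using B by (intro tendsto_divide l tendsto_const) simp
  hence "((\<lambda>n. (Lq_pow m q (u n) / mu B) powr (1 / q)) \<longlongrightarrow> 0 powr (1 / q)) Fl"
    using q B by (intro tendsto_powr') (auto simp: less_imp_le)
  thus *: "((\<lambda>n. (Lq_pow m q (u n) / mu B) powr (1 / q)) \<longlongrightarrow> 0) Fl" by simp
  show "((\<lambda>n. mean (u n) B) \<longlongrightarrow> 0) Fl"
    by (rule Lim_null_comparison[OF _ *], rule eventually_mono[OF u]) (use mean_le[OF q _ B B] in auto)
qed

text \<open>Ball means are continuous on L^q, and \<open>multiplier lam_id\<close> at B is bounded
  by 2 * lam_parent B times a bound for the means above B. Hence the relation between the means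
  survives limits.\<close>

lemma LC_closed: assumes q: "1 \<le> q" shows "Lq_closure m q (LC q) \<subseteq> LC q"
proof (rule subrelI)
  fix f h assume "(f, h) \<in> Lq_closure m q (LC q)"
  then obtain u v where f: "f \<in> Lq m q" and h: "h \<in> Lq m q" and uv: "\<And>n. (u n, v n) \<in> LC q"
    and lu: "(\<lambda>n. Lq_norm m q (\<lambda>x. u n x - f x)) \<longlonglongrightarrow> 0" and lv: "(\<lambda>n. Lq_norm m q (\<lambda>x. v n x - h x)) \<longlonglongrightarrow> 0"
    unfolding Lq_closure_def by auto
  have q0: "0 \<le> q" using q by simp
  note uL = LC_D(1)[OF uv] and vL = LC_D(2)[OF uv]
  have duL: "(\<lambda>x. u n x - f x) \<in> Lq m q" and dvL: "(\<lambda>x. v n x - h x) \<in> Lq m q" for n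
    using uL vL f h q0 by (auto intro!: Lq_diff)
  note lu' = lu[unfolded Lq_norm_tendsto_iff[OF q]] and lv' = lv[unfolded Lq_norm_tendsto_iff[OF q]]
  have "mean h B = multiplier lam_id (mean f) B" if B: "B \<in> all_balls" for B
  proof -
    have e: "mean (v n) B - multiplier lam_id (mean f) B = multiplier lam_id (mean (\<lambda>x. u n x - f x)) B" for n
    proof -
      have "multiplier lam_id (mean (\<lambda>x. u n x - f x)) B = multiplier lam_id (\<lambda>T. (-1) * mean f T + mean (u n) T) B"
        by (rule multiplier_cong[OF B]) (auto simp: mean_diff[OF q uL f])
      also have "\<dots> = (-1) * multiplier lam_id (mean f) B + multiplier lam_id (mean (u n)) B"
        using q f uL by (intro multiplier_linear incr_summable_lam_id bounded_above_mean B)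
      finally show ?thesis using LC_D(3)[OF uv B] by simp
    qed
    have "norm (mean (v n) B - multiplier lam_id (mean f) B)
      \<le> (lam_parent B + lam_parent B) * (Lq_pow m q (\<lambda>x. u n x - f x) / mu B) powr (1 / q)" for n
    proof -
      have "norm (multiplier lam_id (mean (\<lambda>x. u n x - f x)) B)
        \<le> (norm (lam_id (lam_parent B)) + (\<Sum>\<^sub>\<infinity>T\<in>up B. norm (incr lam_id T))) * (Lq_pow m q (\<lambda>x. u n x - f x) / mu B) powr (1 / q)"
        using mean_le[OF q duL B] by (intro multiplier_norm_le[OF incr_summable_lam_id B])
      thus ?thesis using B by (simp add: e infsum_norm_incr_lam_id lam_id_def)
    qed
    note le = this
    have "(\<lambda>n. (lam_parent B + lam_parent B) * (Lq_pow m q (\<lambda>x. u n x - f x) / mu B) powr (1 / q)) \<longlonglongrightarrow> (lam_parent B + lam_parent B) * 0"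
      using mean_tendsto(1)[OF q _ B lu'] duL by (intro tendsto_mult tendsto_const) auto
    hence "(\<lambda>n. (lam_parent B + lam_parent B) * (Lq_pow m q (\<lambda>x. u n x - f x) / mu B) powr (1 / q)) \<longlonglongrightarrow> 0"
      by (simp only: mult_zero_right)
    hence "(\<lambda>n. mean (v n) B - multiplier lam_id (mean f) B) \<longlonglongrightarrow> 0"
      by (rule Lim_null_comparison[OF always_eventually, rotated]) (intro allI le)
    moreover have "(\<lambda>n. mean (\<lambda>x. v n x - h x) B) \<longlonglongrightarrow> 0"
      using mean_tendsto(2)[OF q _ B lv'] dvL by auto
    ultimately have "(\<lambda>n. (mean (v n) B - multiplier lam_id (mean f) B) - mean (\<lambda>x. v n x - h x) B) \<longlonglongrightarrow> 0 - 0"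
      by (rule tendsto_diff)
    moreover have "(mean (v n) B - multiplier lam_id (mean f) B) - mean (\<lambda>x. v n x - h x) B = mean h B - multiplier lam_id (mean f) B" for n
      by (simp add: mean_diff[OF q vL h B])
    ultimately show ?thesis by (simp add: LIMSEQ_const_iff)
  qed
  thus "(f, h) \<in> LC q" using f h by (simp add: LC_def)
qed

lemma ball_image_LC:
  assumes q: "1 \<le> q" and S: "S \<in> all_balls" shows "(indicator S, ball_image lam_id S) \<in> LC q"
proof -
  have "(\<lambda>x. ball_image lam_id S x - 0 * indicator S x) \<in> Lq m q"
    by (rule ball_image_Lq(1)[OF incr_summable_lam_id S q, of 0 "lam_parent S + lam_parent S + 1"])
      (auto simp: infsum_norm_incr_lam_id[OF S] lam_id_def intro: add_nonneg_pos)
  thus ?thesis using q S emeasure_ball_finite[OF S]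
    by (auto simp: LC_def mean_ball_image[OF incr_summable_lam_id S] intro!: Lq_indicator)
qed

lemma LC_zero: "1 \<le> q \<Longrightarrow> (\<lambda>_. 0, \<lambda>_. 0) \<in> LC q"
  using LC_operator by (simp add: Lq_operator_def)

lemma ball_span_LC:
  assumes q: "1 \<le> q" shows "d \<in> ball_span \<Longrightarrow> (d, hier_Laplacian m C d) \<in> LC q"
proof (induction rule: ball_span.induct)
  case ball_span_zero
  have "hier_Laplacian m C (\<lambda>x. 0) = (\<lambda>x. 0)" by (simp add: hier_Laplacian_def[abs_def] mean_eq)
  thus ?case using LC_zero[OF q] by simp
next
  case (ball_span_step d B c)
  have "hier_Laplacian m C (\<lambda>x. c * indicator B x + d x) = (\<lambda>x. c * ball_image lam_id B x + hier_Laplacian m C d x)"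
    by (rule ext) (rule ball_span_laplacian(2)[OF ball_span_step(1,2)])
  thus ?case using LC_lincomb[OF q ball_image_LC[OF q] ball_span_step(3)] ball_span_step(2) by simp
qed

section \<open>Test functions as combinations of balls\<close>

lemma ball_span_sum:
  assumes "finite \<B>" "\<B> \<subseteq> all_balls" shows "(\<lambda>x. \<Sum>B\<in>\<B>. c B * indicator B x) \<in> ball_span"
  using assms
proof (induction rule: finite_induct)
  case empty thus ?case by (simp add: ball_span_zero)
next
  case (insert B \<B>)
  have "(\<lambda>x. c B * indicator B x + (\<Sum>B\<in>\<B>. c B * indicator B x)) \<in> ball_span"
    using insert by (intro ball_span_step) auto
  thus ?case by (simp only: sum.insert[OF insert(1,2)])
qed

text \<open>The nonzero set is covered by open sets on which f is constant. A Lebesgue number e of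
  this cover yields finitely many disjoint balls of radius e, on each of which f is
  constant.\<close>

lemma test_functions_ball_span: assumes "f \<in> test_functions" shows "f \<in> ball_span"
proof -
  have loc: "\<And>x. \<forall>\<^sub>F y in nhds x. f y = f x" and comp: "compact (closure {x. f x \<noteq> 0})"
    using assms by (auto simp: test_functions_def)
  let ?Z = "{x. f x \<noteq> 0}"
  \<comment> \<open>Local constancy makes the nonzero set closed, so it coincides with the compact
    support.\<close>
  have "open (- ?Z)"
  proof (subst open_subopen, intro ballI)
    fix x assume x: "x \<in> - ?Z"
    obtain U where U: "open U" "x \<in> U" "\<And>y. y \<in> U \<Longrightarrow> f y = f x" using loc[of x] unfolding eventually_nhds by blast
    have "U \<subseteq> - ?Z"
    proof
      fix y assume "y \<in> U"
      from U(3)[OF this] show "y \<in> - ?Z" using x by simp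
    qed
    thus "\<exists>T. open T \<and> x \<in> T \<and> T \<subseteq> - ?Z" using U(1,2) by blast
  qed
  hence Z: "compact ?Z" using comp by (simp add: closed_def[symmetric])
  define \<G> where "\<G> = {U. open U \<and> (\<forall>x\<in>U. \<forall>y\<in>U. f x = f y)}"
  have Gop: "open U" if "U \<in> \<G>" for U using that by (simp add: \<G>_def)
  have cov: "?Z \<subseteq> \<Union>\<G>"
  proof
    fix x
    obtain U where U: "open U" "x \<in> U" "\<And>y. y \<in> U \<Longrightarrow> f y = f x" using loc[of x] unfolding eventually_nhds by blast
    have "f y = f z" if "y \<in> U" "z \<in> U" for y z using U(3)[OF that(1)] U(3)[OF that(2)] by (rule trans[OF _ sym])
    hence "U \<in> \<G>" using U(1) unfolding \<G>_def by blast
    thus "x \<in> \<Union>\<G>" using U(2) by blast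
  qed
  obtain e where e: "0 < e" "\<And>x. x \<in> ?Z \<Longrightarrow> \<exists>G\<in>\<G>. ball x e \<subseteq> G"
    by (rule Heine_Borel_lemma[OF Z cov Gop]) (assumption, rule that)
  define \<B> where "\<B> = (\<lambda>x. ball x e) ` ?Z"
  define c where "c B = f (SOME y. y \<in> B)" for B
  have cB: "f y = c B" if hB: "B \<in> \<B>" and hy: "y \<in> B" for B y
  proof -
    obtain x where x: "B = ball x e" "x \<in> ?Z" using hB unfolding \<B>_def by (rule imageE)
    obtain G where G: "G \<in> \<G>" "B \<subseteq> G" using e(2)[OF x(2)] x(1) by auto
    have "(SOME y. y \<in> B) \<in> B" using hy by (rule someI)
    hence "(SOME y. y \<in> B) \<in> G" "y \<in> G" using G(2) hy by auto
    moreover have "\<forall>x\<in>G. \<forall>y\<in>G. f x = f y" using G(1) unfolding \<G>_def mem_Collect_eq by (rule conjunct2)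
    ultimately show ?thesis unfolding c_def by blast
  qed
  have fin: "finite \<B>" unfolding \<B>_def by (rule compact_cover_balls[OF Z e(1)])
  have disj: "disjoint \<B>" unfolding \<B>_def by (rule balls_same_radius_disjoint)
  have all: "\<B> \<subseteq> all_balls" using e(1) by (auto simp: \<B>_def)
  have "f x = (\<Sum>B\<in>\<B>. c B * indicator B x)" for x
  proof (cases "f x = 0")
    case True
    \<comment> \<open>B is centred at a point where f is nonzero, and f is constant on B.\<close>
    have "x \<notin> B" if hB: "B \<in> \<B>" for B
    proof
      assume "x \<in> B"
      obtain z where z: "B = ball z e" "z \<in> ?Z" using hB unfolding \<B>_def by (rule imageE)
      hence "z \<in> B" using e(1) by simp
      thus False using cB[OF hB \<open>x \<in> B\<close>] cB[OF hB \<open>z \<in> B\<close>] True z by simp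
    qed
    thus ?thesis using True by simp
  next
    case False
    hence B: "ball x e \<in> \<B>" "x \<in> ball x e" using e(1) by (auto simp: \<B>_def)
    have "(\<Sum>B\<in>\<B>. c B * indicator B x) = (\<Sum>B\<in>{ball x e}. c B * indicator B x)"
    proof (rule sum.mono_neutral_right[OF fin])
      show "\<forall>B\<in>\<B> - {ball x e}. c B * indicator B x = 0"
      proof
        fix B assume "B \<in> \<B> - {ball x e}"
        hence "B \<inter> ball x e = {}" using disj B unfolding disjoint_def by blast
        thus "c B * indicator B x = 0" using B by (auto simp: indicator_def)
      qed
    qed (use B in auto)
    also have "\<dots> = c (ball x e) * indicator (ball x e) x" by (subst sum.insert) (simp_all only: finite.emptyI empty_iff not_False_eq_True sum.empty add_0_right)
    finally show ?thesis using B cB[OF B] by simp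
  qed
  hence "f = (\<lambda>x. \<Sum>B\<in>\<B>. c B * indicator B x)" by blast
  thus ?thesis using ball_span_sum[OF fin all] by simp
qed

lemma ball_span_test_functions: "d \<in> ball_span \<Longrightarrow> d \<in> test_functions"
proof (induction rule: ball_span.induct)
  case ball_span_zero thus ?case by (simp add: test_functions_def)
next
  case (ball_span_step d B c)
  have ind: "\<forall>\<^sub>F y in nhds x. indicator B y = (indicator B x :: complex)" for x
  proof (cases "x \<in> B")
    case True
    thus ?thesis using eventually_nhds_in_open[OF balls_open[OF ball_span_step(2)] True]
      by (auto elim: eventually_mono)
  next
    case False
    have "open (- B)" using ball_span_step(2) balls_compact compact_imp_closed by blast
    from eventually_nhds_in_open[OF this, of x] show ?thesis using False by (auto elim: eventually_mono)
  qed
  have dl: "\<forall>\<^sub>F y in nhds x. d y = d x" for x using ball_span_step(3) by (simp add: test_functions_def)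
  have "\<forall>\<^sub>F y in nhds x. c * indicator B y + d y = c * indicator B x + d x" for x
    using ind[of x] dl[of x] by eventually_elim simp
  moreover have "compact (closure {x. c * indicator B x + d x \<noteq> 0})"
  proof -
    let ?Z = "{x. c * indicator B x + d x \<noteq> 0}" and ?K = "B \<union> closure {x. d x \<noteq> 0}"
    have K: "compact ?K"
      using ball_span_step balls_compact by (intro compact_Un) (auto simp: test_functions_def)
    have "?Z \<subseteq> ?K"
      using closure_subset[of "{x. d x \<noteq> 0}"] by (auto simp: indicator_def)
    hence "closure ?Z \<subseteq> ?K" using compact_imp_closed[OF K] by (rule closure_minimal)
    hence "?K \<inter> closure ?Z = closure ?Z" by (rule Int_absorb1)
    thus ?thesis using compact_Int_closed[OF K closed_closure, of ?Z] by (simp only:)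
  qed
  ultimately show ?case by (simp add: test_functions_def)
qed

lemma test_functions_eq: "test_functions = ball_span"
  using test_functions_ball_span ball_span_test_functions by blast

lemma hier_graph_LC: "1 \<le> q \<Longrightarrow> hier_graph m C \<subseteq> LC q"
  using ball_span_LC by (auto simp: hier_graph_def test_functions_eq)

section \<open>Markov functions of the operator and their strong limits\<close>

definition markov_fn :: "(real \<Rightarrow> real) \<Rightarrow> real \<Rightarrow> bool" where
  "markov_fn G g \<longleftrightarrow> (\<forall>a\<in>Lam. g \<le> G a) \<and> (\<forall>a\<in>Lam. \<forall>b\<in>Lam. a \<le> b \<longrightarrow> G b \<le> G a) \<and> 0 \<le> g \<and>
     (G \<longlongrightarrow> g) at_top \<and> G 0 = 1"

abbreviation markov_calc :: "(real \<Rightarrow> real) \<Rightarrow> real \<Rightarrow> ('a \<Rightarrow> complex) \<Rightarrow> 'a \<Rightarrow> complex" where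
  "markov_calc G g \<equiv> fcalc (\<lambda>s. of_real (G s)) (of_real g)"

text \<open>Monotonicity makes all weights nonnegative, and with the diagonal value they add up to
  at most G 0 = 1; so the calculus contracts every L^q.\<close>

lemma markov_admissible: "markov_fn G g \<Longrightarrow> admissible (\<lambda>s. of_real (G s)) (of_real g) 1"
  using admissible_decreasing[of g G] by (simp add: markov_fn_def)

lemma markov_dominated: "markov_fn G g \<Longrightarrow> dominated (\<lambda>s. of_real (G s) :: complex) G"
  by (intro dominated_decreasing) (auto simp: markov_fn_def intro: order_trans)

lemma markov_calc_contraction:
  assumes "markov_fn G g" "1 \<le> q" "f \<in> Lq m q"
  shows "markov_calc G g f \<in> Lq m q" "Lq_pow m q (markov_calc G g f) \<le> Lq_pow m q f"
  using fcalc_Lq[OF markov_admissible[OF assms(1)] assms(2,3)] by auto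

text \<open>The increments above B contribute at most 1 - G (lam_parent B) and the diagonal term the
  same amount again, whence the factor 2.\<close>

lemma markov_calc_indicator_diff:
  assumes G: "markov_fn G g" and q: "1 \<le> q" and B: "B \<in> all_balls" and M: "2 * (1 - G (lam_parent B)) \<le> M" "0 < M"
  shows "Lq_pow m q (\<lambda>x. markov_calc G g (indicator B) x - indicator B x) \<le> M powr q * mu B"
proof -
  note dom = markov_dominated[OF G]
  have G1: "G 0 = 1" "G (lam_parent B) \<le> 1" using G B by (auto simp: markov_fn_def dest: bspec[of _ _ 0])
  have "norm (complex_of_real (G (lam_parent B)) - 1) = 1 - G (lam_parent B)"
    using G1 by (metis abs_minus_commute abs_of_nonneg diff_ge_0_iff_ge norm_of_real of_real_1 of_real_diff)
  hence "(\<Sum>\<^sub>\<infinity>T\<in>up B. norm (incr (\<lambda>s. complex_of_real (G s)) T)) + norm (complex_of_real (G (lam_parent B)) - 1) \<le> M"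
    using summable_incr_up(4)[OF dom B] G1 M by simp
  from ball_image_Lq(2)[OF dominated_incr_summable[OF dom] B q this M(2)]
  show ?thesis by (simp add: fcalc_indicator[OF markov_admissible[OF G] B])
qed

text \<open>Contractions are uniformly bounded, so convergence on the dense \<open>ball_span\<close>
  suffices; for the indicator of B it depends on the single value G t (lam_parent B).\<close>

lemma strong_limit:
  assumes q: "1 \<le> q" and ev: "\<forall>\<^sub>F t in Fl. markov_fn (G t) (g t)"
    and pt: "\<And>a. a \<in> Lam \<Longrightarrow> ((\<lambda>t. G t a) \<longlongrightarrow> 1) Fl" and f: "f \<in> Lq m q"
  shows "((\<lambda>t. Lq_pow m q (\<lambda>x. markov_calc (G t) (g t) f x - f x)) \<longlongrightarrow> 0) Fl"
proof -
  have q0: "0 \<le> q" using q by simp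
  let ?R = "\<lambda>t. markov_calc (G t) (g t)"
  have ind: "((\<lambda>t. Lq_pow m q (\<lambda>x. ?R t (indicator B) x - indicator B x)) \<longlongrightarrow> 0) Fl" if B: "B \<in> all_balls" for B
  proof (rule tendstoI)
    fix e :: real assume e: "0 < e"
    define \<delta> where "\<delta> = (e / (2 * mu B)) powr (1 / q)"
    have \<delta>: "0 < \<delta>" using e mu_pos[OF B] by (simp add: \<delta>_def)
    have \<delta>q: "\<delta> powr q * mu B = e / 2" using e mu_pos[OF B] q by (simp add: \<delta>_def powr_powr)
    have "((\<lambda>t. 2 * (1 - G t (lam_parent B))) \<longlongrightarrow> 2 * (1 - 1)) Fl" using B by (intro tendsto_intros pt) simp
    hence "\<forall>\<^sub>F t in Fl. 2 * (1 - G t (lam_parent B)) < \<delta>" using \<delta> by (intro order_tendstoD) auto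
    with ev show "\<forall>\<^sub>F t in Fl. dist (Lq_pow m q (\<lambda>x. ?R t (indicator B) x - indicator B x)) 0 < e"
    proof eventually_elim
      case (elim t)
      have "Lq_pow m q (\<lambda>x. ?R t (indicator B) x - indicator B x) \<le> \<delta> powr q * mu B"
        using elim \<delta> by (intro markov_calc_indicator_diff[OF _ q B]) auto
      thus ?case using \<delta>q e by simp
    qed
  qed
  have span: "((\<lambda>t. Lq_pow m q (\<lambda>x. ?R t d x - d x)) \<longlongrightarrow> 0) Fl" if "d \<in> ball_span" for d
    using that
  proof (induction rule: ball_span.induct)
    case ball_span_zero
    have "?R t (\<lambda>x. 0) x = 0" for t x by (simp add: fcalc_def mean_eq)
    thus ?case by simp
  next
    case (ball_span_step d B c)
    have iL: "indicator B \<in> Lq m q" using q ball_span_step(2) emeasure_ball_finite by (intro Lq_indicator) auto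
    have dL: "d \<in> Lq m q" by (rule ball_span_Lq[OF q ball_span_step(1)])
    have le: "\<forall>\<^sub>F t in Fl. Lq_pow m q (\<lambda>x. ?R t (\<lambda>x. c * indicator B x + d x) x - (c * indicator B x + d x))
      \<le> 2 powr q * (norm c powr q * Lq_pow m q (\<lambda>x. ?R t (indicator B) x - indicator B x) + Lq_pow m q (\<lambda>x. ?R t d x - d x))"
      using ev
    proof eventually_elim
      case (elim t)
      note adm = markov_admissible[OF elim]
      note L1 = markov_calc_contraction(1)[OF elim q iL] and L2 = markov_calc_contraction(1)[OF elim q dL]
        and L3 = markov_calc_contraction(1)[OF elim q Lq_lincomb[OF q0 iL dL, of c]]
      note [measurable] = L1[THEN Lq_measurable] L2[THEN Lq_measurable] L3[THEN Lq_measurable]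
          iL[THEN Lq_measurable] dL[THEN Lq_measurable]
      have D1: "(\<lambda>x. ?R t (indicator B) x - indicator B x) \<in> Lq m q" by (rule Lq_diff(1)[OF q0 L1 iL])
      have D2: "(\<lambda>x. ?R t d x - d x) \<in> Lq m q" by (rule Lq_diff(1)[OF q0 L2 dL])
      have "Lq_pow m q (\<lambda>x. ?R t (\<lambda>x. c * indicator B x + d x) x - (c * indicator B x + d x))
         = Lq_pow m q (\<lambda>x. c * (?R t (indicator B) x - indicator B x) + (?R t d x - d x))"
      proof (rule Lq_pow_cong_AE)
        show "AE x in m. ?R t (\<lambda>x. c * indicator B x + d x) x - (c * indicator B x + d x)
            = c * (?R t (indicator B) x - indicator B x) + (?R t d x - d x)"
          using fcalc_linear_AE[OF adm q iL dL, of c] by eventually_elim (simp add: algebra_simps)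
      qed measurable
      also have "\<dots> \<le> 2 powr q * (Lq_pow m q (\<lambda>x. c * (?R t (indicator B) x - indicator B x)) + Lq_pow m q (\<lambda>x. ?R t d x - d x))"
        by (rule Lq_add(2)[OF q0 Lq_cmult[OF q0 D1] D2])
      finally show ?case by (simp add: Lq_pow_cmult[OF q0])
    qed
    have "((\<lambda>t. 2 powr q * (norm c powr q * Lq_pow m q (\<lambda>x. ?R t (indicator B) x - indicator B x)
        + Lq_pow m q (\<lambda>x. ?R t d x - d x))) \<longlongrightarrow> 2 powr q * (norm c powr q * 0 + 0)) Fl"
      by (intro tendsto_intros ind ball_span_step)
    hence lim: "((\<lambda>t. 2 powr q * (norm c powr q * Lq_pow m q (\<lambda>x. ?R t (indicator B) x - indicator B x)
        + Lq_pow m q (\<lambda>x. ?R t d x - d x))) \<longlongrightarrow> 0) Fl" by (simp only: mult_zero_right add_0_left)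
    show ?case
      by (rule tendsto_sandwich[OF _ le tendsto_const lim]) (simp add: always_eventually)
  qed
  show ?thesis
  proof (rule tendstoI)
    fix e :: real assume e: "0 < e"
    \<comment> \<open>The constant collects two nested uses of the quasi-triangle inequality, first
      through the image of d and then through d.\<close>
    define e' where "e' = e / (2 powr q * (1 + 2 powr q * 2))"
    have p: "0 < 2 powr q * (1 + 2 powr q * 2)" by (intro mult_pos_pos add_pos_nonneg) auto
    have e': "0 < e'" using e p by (simp add: e'_def)
    obtain d where d: "d \<in> ball_span" "Lq_pow m q (\<lambda>x. f x - d x) < e'"
      using ball_span_dense[OF q f] e' by (auto simp: approximable_def)
    have dL: "d \<in> Lq m q" by (rule ball_span_Lq[OF q d(1)])
    have "\<forall>\<^sub>F t in Fl. Lq_pow m q (\<lambda>x. ?R t d x - d x) < e'"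
      using span[OF d(1)] e' by (rule order_tendstoD)
    with ev show "\<forall>\<^sub>F t in Fl. dist (Lq_pow m q (\<lambda>x. ?R t f x - f x)) 0 < e"
    proof eventually_elim
      case (elim t)
      note adm = markov_admissible[OF elim(1)]
      have fd: "(\<lambda>x. f x - d x) \<in> Lq m q" by (rule Lq_diff(1)[OF q0 f dL])
      note Lf = markov_calc_contraction(1)[OF elim(1) q f] and Ld = markov_calc_contraction(1)[OF elim(1) q dL]
        and Lfd = markov_calc_contraction[OF elim(1) q fd]
      note [measurable] = Lf[THEN Lq_measurable] Ld[THEN Lq_measurable] Lfd(1)[THEN Lq_measurable]
      have "AE x in m. ?R t f x - ?R t d x = ?R t (\<lambda>x. f x - d x) x"
        using fcalc_linear_AE[OF adm q dL fd, of 1] by eventually_elim simp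
      hence "Lq_pow m q (\<lambda>x. ?R t f x - ?R t d x) = Lq_pow m q (?R t (\<lambda>x. f x - d x))"
        by (rule Lq_pow_cong_AE[rotated 2]) measurable
      hence 1: "Lq_pow m q (\<lambda>x. ?R t f x - ?R t d x) < e'" using Lfd(2) d(2) by simp
      have 2: "Lq_pow m q (\<lambda>x. ?R t d x - f x) \<le> 2 powr q * (Lq_pow m q (\<lambda>x. ?R t d x - d x) + Lq_pow m q (\<lambda>x. d x - f x))"
        by (rule Lq_pow_triangle[OF q0 Ld dL f])
      also have "\<dots> \<le> 2 powr q * (e' + e')"
        using elim(2) d(2) by (intro mult_left_mono add_mono) (auto simp: Lq_pow_minus[of m q d])
      finally have 2: "Lq_pow m q (\<lambda>x. ?R t d x - f x) \<le> 2 powr q * (e' + e')" .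
      have "Lq_pow m q (\<lambda>x. ?R t f x - f x) \<le> 2 powr q * (Lq_pow m q (\<lambda>x. ?R t f x - ?R t d x) + Lq_pow m q (\<lambda>x. ?R t d x - f x))"
        by (rule Lq_pow_triangle[OF q0 Lf Ld f])
      also have "\<dots> < 2 powr q * (e' + 2 powr q * (e' + e'))"
        using 1 2 by (intro mult_strict_left_mono add_less_le_mono) auto
      also have "\<dots> = e' * (2 powr q * (1 + 2 powr q * 2))" by (simp add: algebra_simps)
      also have "\<dots> = e"
        unfolding e'_def by (simp only: times_divide_eq_left nonzero_mult_div_cancel_right less_imp_neq[OF p, symmetric] not_False_eq_True)
      finally show ?case by simp
    qed
  qed
qed

section \<open>The heat semigroup and the resolvent\<close>

text \<open>At t = 0 the exponential is constantly 1, so its limit at infinity is 1 instead of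
  0.\<close>

definition heat :: "'a semigroup" where
  "heat t = markov_calc (\<lambda>s. exp (- t * s)) (if t = 0 then 1 else 0)"

text \<open>Chosen so that \<open>heat t - 1 = - t * heat_quot t (L) * L\<close>; being a decreasing function of \<open>s\<close>, it
  gives a contraction in every \<open>L\<^sup>q\<close>.\<close>

definition heat_quot :: "real \<Rightarrow> real \<Rightarrow> real" where
  "heat_quot t s = (if s = 0 then 1 else (1 - exp (- t * s)) / (t * s))"

lemma markov_heat: assumes "0 \<le> t" shows "markov_fn (\<lambda>s. exp (- t * s)) (if t = 0 then 1 else 0)"
  unfolding markov_fn_def
proof (intro conjI ballI impI)
  show "((\<lambda>s. exp (- t * s)) \<longlongrightarrow> (if t = 0 then 1 else 0)) at_top"
  proof (cases "t = 0")
    case False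
    hence "filterlim (\<lambda>s. - t * s) at_bot at_top"
      using assms by (intro filterlim_tendsto_neg_mult_at_bot[OF tendsto_const] filterlim_ident) auto
    from filterlim_compose[OF exp_at_bot this] show ?thesis using False by simp
  qed simp
qed (use assms in \<open>auto intro: mult_left_mono\<close>)

text \<open>Convexity of exp, as - x is the convex combination of 0 and - y with weight x / y on -
  y.\<close>

lemma one_minus_exp_div_decreasing:
  fixes x y :: real assumes "0 < x" "x \<le> y" shows "(1 - exp (- y)) / y \<le> (1 - exp (- x)) / x"
proof -
  let ?l = "x / y"
  have l: "0 \<le> ?l" "?l \<le> 1" using assms by auto
  have "exp ((1 - ?l) *\<^sub>R 0 + ?l *\<^sub>R (- y)) \<le> (1 - ?l) * exp 0 + ?l * exp (- y)"
    by (rule convex_onD[OF exp_convex]) (use l in auto)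
  moreover have "?l * y = x" using assms by simp
  ultimately have "exp (- x) \<le> 1 - ?l + ?l * exp (- y)" by simp
  hence "?l * (1 - exp (- y)) \<le> 1 - exp (- x)" by (simp add: algebra_simps)
  hence "?l * (1 - exp (- y)) / x \<le> (1 - exp (- x)) / x" using assms by (intro divide_right_mono) auto
  moreover have "?l * (1 - exp (- y)) / x = (1 - exp (- y)) / y" using assms by simp
  ultimately show ?thesis by simp
qed

lemma markov_heat_quot: assumes t: "0 < t" shows "markov_fn (heat_quot t) 0"
  unfolding markov_fn_def
proof (intro conjI ballI impI)
  show "0 \<le> heat_quot t a" if "a \<in> Lam" for a
    using Lam_nonneg[OF that] t by (auto simp: heat_quot_def)
  show "heat_quot t b \<le> heat_quot t a" if "a \<in> Lam" "b \<in> Lam" "a \<le> b" for a b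
  proof (cases "a = 0")
    case True
    have "(1 - exp (- t * b)) / (t * b) \<le> 1" if "b \<noteq> 0"
    proof -
      have "0 < t * b" using that t Lam_nonneg[OF \<open>b \<in> Lam\<close>] by simp
      moreover have "1 - exp (- (t * b)) \<le> t * b" using exp_ge_add_one_self[of "- (t * b)"] by simp
      ultimately show ?thesis by simp
    qed
    thus ?thesis using True by (simp add: heat_quot_def)
  next
    case False
    hence "0 < a" using Lam_nonneg[OF that(1)] by simp
    thus ?thesis using one_minus_exp_div_decreasing[of "t * a" "t * b"] t that(3)
      by (simp add: heat_quot_def)
  qed
  have "((\<lambda>s. 1 / (t * s)) \<longlongrightarrow> 0) at_top"
    using t by (intro tendsto_divide_0[OF tendsto_const] filterlim_at_top_imp_at_infinity
        filterlim_tendsto_pos_mult_at_top[OF tendsto_const] filterlim_ident) auto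
  moreover have "\<forall>\<^sub>F s in at_top. norm (heat_quot t s) \<le> 1 / (t * s)"
    using eventually_gt_at_top[of 0]
  proof eventually_elim
    case (elim s)
    thus ?case using t by (simp add: heat_quot_def divide_right_mono)
  qed
  ultimately show "(heat_quot t \<longlongrightarrow> 0) at_top" by (rule Lim_null_comparison[rotated])
qed (auto simp: heat_quot_def)

lemma heat_quot_tendsto: "((\<lambda>t. heat_quot t s) \<longlongrightarrow> 1) (at_right 0)"
proof (cases "s = 0")
  case False
  have "((\<lambda>t. exp (- t * s)) has_field_derivative - s) (at 0)"
    by (auto intro!: derivative_eq_intros)
  hence "((\<lambda>t. (exp (- t * s) - 1) / t) \<longlongrightarrow> - s) (at 0)" by (simp add: DERIV_def)
  hence "((\<lambda>t. (exp (- t * s) - 1) / t) \<longlongrightarrow> - s) (at_right 0)" by (rule tendsto_mono[rotated]) (simp add: at_le)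
  hence "((\<lambda>t. ((exp (- t * s) - 1) / t) / (- s)) \<longlongrightarrow> (- s) / (- s)) (at_right 0)"
    using False by (intro tendsto_divide tendsto_const) auto
  moreover have "(1 - exp (- (t * s))) / (t * s) = - ((exp (- (t * s)) - 1) / (t * s))" for t
    by (simp add: diff_divide_distrib)
  ultimately show ?thesis using False by (simp add: heat_quot_def)
qed (simp add: heat_quot_def)

lemma exp_heat_quot: "t \<noteq> 0 \<Longrightarrow> complex_of_real (exp (- t * s)) = (- of_real t) * (of_real (heat_quot t s) * lam_id s) + 1"
  by (simp add: heat_quot_def lam_id_def)

lemma eventually_pos_at_right: "\<forall>\<^sub>F t in at_right (0::real). 0 < t"
  by (simp add: eventually_at_right_less)

lemma mean_zero: "mean (\<lambda>x. 0) B = 0" by (simp add: mean_eq)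

lemma mean_markov_calc:
  "markov_fn G g \<Longrightarrow> 1 \<le> q \<Longrightarrow> f \<in> Lq m q \<Longrightarrow> B \<in> all_balls \<Longrightarrow>
    mean (markov_calc G g f) B = multiplier (\<lambda>s. of_real (G s)) (mean f) B"
  using mean_fcalc markov_admissible by blast

lemma mean_heat:
  "0 \<le> t \<Longrightarrow> 1 \<le> q \<Longrightarrow> f \<in> Lq m q \<Longrightarrow> B \<in> all_balls \<Longrightarrow>
    mean (heat t f) B = multiplier (\<lambda>s. of_real (exp (- t * s))) (mean f) B"
  unfolding heat_def by (rule mean_markov_calc[OF markov_heat])

lemma heat_Lq:
  assumes "0 \<le> t" "1 \<le> q" "f \<in> Lq m q"
  shows "heat t f \<in> Lq m q" "Lq_pow m q (heat t f) \<le> Lq_pow m q f"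
  unfolding heat_def using markov_calc_contraction[OF markov_heat[OF assms(1)] assms(2,3)] by auto

lemma heat_bounded: "0 \<le> t \<Longrightarrow> 1 \<le> q \<Longrightarrow> bounded_operator m q (heat t)"
  unfolding heat_def using fcalc_bounded_operator[OF markov_admissible[OF markov_heat]] .

lemma heat_compose:
  assumes st: "0 \<le> s" "0 \<le> t" and q: "1 \<le> q" and f: "f \<in> Lq m q"
  shows "AE x in m. heat (s + t) f x = heat s (heat t f) x"
proof (rule means_determine[OF q])
  note tf = heat_Lq(1)[OF st(2) q f]
  show "heat (s + t) f \<in> Lq m q" using st by (intro heat_Lq(1)[OF _ q f]) auto
  show "heat s (heat t f) \<in> Lq m q" by (rule heat_Lq(1)[OF st(1) q tf])
  fix B :: "'a set" assume B: "B \<in> all_balls"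
  note ws = admissible_incr_summable[OF markov_admissible[OF markov_heat]]
  have "mean (heat s (heat t f)) B = multiplier (\<lambda>r. of_real (exp (- s * r))) (mean (heat t f)) B"
    by (rule mean_heat[OF st(1) q tf B])
  also have "\<dots> = multiplier (\<lambda>r. of_real (exp (- s * r))) (multiplier (\<lambda>r. of_real (exp (- t * r))) (mean f)) B"
    using mean_heat[OF st(2) q f] by (intro multiplier_cong[OF B]) auto
  also have "\<dots> = multiplier (\<lambda>r. of_real (exp (- s * r)) * of_real (exp (- t * r))) (mean f) B"
    by (rule multiplier_compose[OF ws[OF st(1)] ws[OF st(2)] bounded_above_mean[OF q f] B])
  also have "\<dots> = multiplier (\<lambda>r. of_real (exp (- (s + t) * r))) (mean f) B"
    by (intro multiplier_cong[OF B]) (auto simp flip: exp_add of_real_mult simp: algebra_simps)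
  also have "\<dots> = mean (heat (s + t) f) B" using mean_heat[OF _ q f B, of "s + t"] st by simp
  finally show "mean (heat (s + t) f) B = mean (heat s (heat t f)) B" by simp
qed

lemma heat_zero: assumes q: "1 \<le> q" and f: "f \<in> Lq m q" shows "AE x in m. heat 0 f x = f x"
proof (rule means_determine[OF q heat_Lq(1)[OF order_refl q f] f])
  fix B :: "'a set" assume B: "B \<in> all_balls"
  show "mean (heat 0 f) B = mean f B"
    unfolding mean_heat[OF order_refl q f B] by (rule multiplier_one[OF B]) simp
qed

lemma heat_C0: assumes q: "1 \<le> q" shows "C0_semigroup m q heat"
  unfolding C0_semigroup_def
proof (intro conjI allI impI ballI)
  fix f assume f: "f \<in> Lq m q"
  have "((\<lambda>t. Lq_pow m q (\<lambda>x. markov_calc (\<lambda>s. exp (- t * s)) (if t = 0 then 1 else 0) f x - f x)) \<longlongrightarrow> 0) (at_right 0)"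
  proof (rule strong_limit[OF q _ _ f])
    show "\<forall>\<^sub>F t in at_right 0. markov_fn (\<lambda>s. exp (- t * s)) (if t = 0 then 1 else 0)"
      using eventually_pos_at_right by eventually_elim (rule markov_heat, simp)
    fix a :: real
    have "((\<lambda>t. exp (- t * a)) \<longlongrightarrow> exp (- 0 * a)) (at_right 0)" by (intro tendsto_intros)
    thus "((\<lambda>t. exp (- t * a)) \<longlongrightarrow> 1) (at_right 0)" by simp
  qed
  thus "((\<lambda>t. Lq_norm m q (\<lambda>x. heat t f x - f x)) \<longlongrightarrow> 0) (at_right 0)"
    by (subst Lq_norm_tendsto_iff[OF q]) (simp only: heat_def)
qed (use heat_bounded heat_compose heat_zero q in auto)

lemma heat_C0_contraction: assumes q: "1 \<le> q" shows "C0_contraction_semigroup m q heat"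
  unfolding C0_contraction_semigroup_def
proof (intro conjI allI impI ballI heat_C0 q)
  fix t :: real and f assume "0 \<le> t" "f \<in> Lq m q"
  thus "Lq_norm m q (heat t f) \<le> Lq_norm m q f"
    using Lq_norm_le[of m q "heat t f" 1 f] heat_Lq(2)[OF _ q] q by simp
qed

lemma integral_unit_interval:
  fixes f :: "'a \<Rightarrow> complex"
  assumes f: "f \<in> borel_measurable m" and AEf: "AE x in m. f x \<in> complex_of_real ` {0..1}" and B: "B \<in> all_balls"
  shows "mean f B \<in> complex_of_real ` {0..1}"
proof -
  note [measurable] = f balls_sets[OF B]
  have "(\<integral>x. indicator B x * f x \<partial>m) = (\<integral>x. complex_of_real (indicator B x * Re (f x)) \<partial>m)"
    using AEf by (intro integral_cong_AE) (auto elim!: eventually_mono simp: indicator_def)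
  also have "\<dots> = of_real (\<integral>x. indicator B x * Re (f x) \<partial>m)" by (rule integral_complex_of_real)
  finally have e: "mean f B = of_real ((\<integral>x. indicator B x * Re (f x) \<partial>m) / mu B)" by (simp add: mean_eq)
  have "(\<integral>x. indicator B x * Re (f x) \<partial>m) \<le> (\<integral>x. indicator B x \<partial>m)"
  proof (rule integral_mono_AE')
    show "integrable m (indicat_real B)" using B emeasure_ball_finite[OF B] by (simp add: less_top)
    show "AE x in m. indicator B x * Re (f x) \<le> indicat_real B x"
      using AEf by eventually_elim (auto simp: indicator_def)
    show "AE x in m. 0 \<le> indicat_real B x" by simp
  qed
  hence "(\<integral>x. indicator B x * Re (f x) \<partial>m) \<le> mu B" by (simp add: mu_def)
  moreover have "0 \<le> (\<integral>x. indicator B x * Re (f x) \<partial>m)"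
    using AEf by (intro integral_nonneg_AE) (auto elim!: eventually_mono simp: indicator_def)
  ultimately show ?thesis unfolding e using mu_pos[OF B] by (intro imageI) auto
qed

text \<open>The value is a combination of numbers in [0,1] with nonnegative weights of total at most
  1, the diagonal weight \<open>phi G g x\<close> included.\<close>

lemma markov_calc_unit_interval:
  assumes G: "markov_fn G g" and f: "\<And>B. B \<in> all_balls \<Longrightarrow> mean f B \<in> complex_of_real ` {0..1}"
    and fx: "f x \<in> complex_of_real ` {0..1}"
  shows "markov_calc G g f x \<in> complex_of_real ` {0..1}"
proof -
  note dom = markov_dominated[OF G]
  have gG: "\<And>a. a \<in> Lam \<Longrightarrow> g \<le> G a" and G0: "G 0 = 1" and g: "0 \<le> g" using G by (auto simp: markov_fn_def)
  let ?I = "{T \<in> ns_balls. x \<in> T}"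
  let ?r = "\<lambda>T. Re (mean f T)"
  have r: "mean f T = of_real (?r T)" "0 \<le> ?r T" "?r T \<le> 1" if "T \<in> ?I" for T
    using f[OF ns_balls_all, of T] that by auto
  have wn: "norm (incr (\<lambda>s. complex_of_real (G s)) T) = incr G T" if "T \<in> ?I" for T
  proof -
    have "incr (\<lambda>s. complex_of_real (G s)) T = of_real (incr G T)" by (simp add: incr_def)
    moreover have "0 \<le> incr G T" using dominated_incr_nonneg[OF dom] that by simp
    ultimately show ?thesis by simp
  qed
  have "(\<lambda>T. norm (incr (\<lambda>s. complex_of_real (G s)) T)) summable_on ?I" by (rule point_summable(1)[OF dom])
  hence sG: "incr G summable_on ?I" by (subst (asm) summable_on_cong[OF wn]) auto
  have tot: "infsum (incr G) ?I \<le> 1 - phi G g x"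
  proof -
    have "(\<Sum>\<^sub>\<infinity>T\<in>?I. norm (incr (\<lambda>s. complex_of_real (G s)) T)) = infsum (incr G) ?I" by (rule infsum_cong) (rule wn)
    thus ?thesis using point_sum_decreasing[OF dom, of g x] gG G0 by simp
  qed
  have wnn: "0 \<le> incr G T" if "T \<in> ?I" for T using dominated_incr_nonneg[OF dom] that by simp
  have sr: "(\<lambda>T. incr G T * ?r T) summable_on ?I"
    using sG by (rule summable_on_comparison_test) (use r wnn in \<open>auto intro: mult_left_le\<close>)
  have le: "(\<Sum>\<^sub>\<infinity>T\<in>?I. incr G T * ?r T) \<le> infsum (incr G) ?I"
    using sr sG by (rule infsum_mono) (use r wnn in \<open>auto intro: mult_left_le\<close>)
  have nn: "0 \<le> (\<Sum>\<^sub>\<infinity>T\<in>?I. incr G T * ?r T)" using r wnn by (intro infsum_nonneg) auto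
  have "(\<Sum>\<^sub>\<infinity>T\<in>?I. incr (\<lambda>s. complex_of_real (G s)) T * mean f T) = (\<Sum>\<^sub>\<infinity>T\<in>?I. complex_of_real (incr G T * ?r T))"
    by (intro infsum_cong) (subst r(1), auto simp: incr_def)
  also have "\<dots> = of_real (\<Sum>\<^sub>\<infinity>T\<in>?I. incr G T * ?r T)"
    using sr by (intro infsumI has_sum_of_real) simp
  finally have e1: "(\<Sum>\<^sub>\<infinity>T\<in>?I. incr (\<lambda>s. complex_of_real (G s)) T * mean f T) = of_real (\<Sum>\<^sub>\<infinity>T\<in>?I. incr G T * ?r T)" .
  obtain y where y: "f x = of_real y" "0 \<le> y" "y \<le> 1" using fx by auto
  have "0 \<le> G a" if "a \<in> Lam" for a using gG[OF that] g by simp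
  hence p: "0 \<le> phi G g x" using g isolated_lam_Lam[of x] by (simp add: phi_def)
  have e2: "markov_calc G g f x = of_real ((\<Sum>\<^sub>\<infinity>T\<in>?I. incr G T * ?r T) + phi G g x * y)"
    by (simp add: fcalc_def e1 y(1) phi_of_real)
  have "phi G g x * y \<le> phi G g x" "0 \<le> phi G g x * y" using p y by (auto intro: mult_left_le)
  thus ?thesis unfolding e2 using le tot nn by (intro imageI) auto
qed

lemma heat_markov: assumes q: "1 \<le> q" shows "markov_semigroup m q heat"
  unfolding markov_semigroup_def
proof (intro conjI allI ballI impI heat_C0_contraction q)
  fix t :: real and f assume t: "0 \<le> t" and f: "f \<in> Lq m q" and a: "AE x in m. f x \<in> complex_of_real ` {0..1}"
  have mf: "mean f B \<in> complex_of_real ` {0..1}" if "B \<in> all_balls" for B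
    by (rule integral_unit_interval[OF Lq_measurable[OF f] a that])
  show "AE x in m. heat t f x \<in> complex_of_real ` {0..1}"
    using a
  proof (rule eventually_mono)
    fix x assume "f x \<in> complex_of_real ` {0..1}"
    thus "heat t f x \<in> complex_of_real ` {0..1}"
      unfolding heat_def using markov_calc_unit_interval[OF markov_heat[OF t] mf] by simp
  qed
qed

lemma heat_difference:
  assumes t: "0 < t" and q: "1 \<le> q" and fh: "(f, h) \<in> LC q"
  shows "AE x in m. (heat t f x - f x) / of_real t = - markov_calc (heat_quot t) 0 h x"
proof -
  have q0: "0 \<le> q" and t0: "0 \<le> t" using q t by auto
  note f = LC_D(1)[OF fh] and h = LC_D(2)[OF fh]
  note Uh = markov_calc_contraction(1)[OF markov_heat_quot[OF t] q h]
  have "AE x in m. heat t f x = (- of_real t) * markov_calc (heat_quot t) 0 h x + f x"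
  proof (rule means_determine[OF q heat_Lq(1)[OF t0 q f] Lq_lincomb[OF q0 Uh f]])
    fix B :: "'a set" assume B: "B \<in> all_balls"
    note ws = admissible_incr_summable[OF markov_admissible[OF markov_heat_quot[OF t]]]
    have "mean (heat t f) B = multiplier (\<lambda>s. of_real (exp (- t * s))) (mean f) B" by (rule mean_heat[OF t0 q f B])
    also have "\<dots> = multiplier (\<lambda>s. (- of_real t) * (of_real (heat_quot t s) * lam_id s) + 1) (mean f) B"
      using t by (intro multiplier_cong[OF B]) (auto simp only: exp_heat_quot)
    also have "\<dots> = (- of_real t) * multiplier (\<lambda>s. of_real (heat_quot t s) * lam_id s) (mean f) B + 1 * mean f B"
      by (rule multiplier_affine)
    also have "multiplier (\<lambda>s. of_real (heat_quot t s) * lam_id s) (mean f) B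
        = multiplier (\<lambda>s. of_real (heat_quot t s)) (multiplier lam_id (mean f)) B"
      by (rule multiplier_compose[OF ws incr_summable_lam_id bounded_above_mean[OF q f] B, symmetric])
    also have "\<dots> = multiplier (\<lambda>s. of_real (heat_quot t s)) (mean h) B"
      using LC_D(3)[OF fh] by (intro multiplier_cong[OF B]) auto
    also have "\<dots> = mean (markov_calc (heat_quot t) 0 h) B" by (rule mean_markov_calc[OF markov_heat_quot[OF t] q h B, symmetric])
    finally show "mean (heat t f) B = mean (\<lambda>x. (- of_real t) * markov_calc (heat_quot t) 0 h x + f x) B"
      by (simp only: mean_lincomb[OF q Uh f B] mult_1)
  qed
  thus ?thesis by eventually_elim (use t in simp)
qed

lemma heat_quot_strong_limit:
  assumes q: "1 \<le> q" and h: "h \<in> Lq m q"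
  shows "((\<lambda>t. Lq_pow m q (\<lambda>x. markov_calc (heat_quot t) 0 h x - h x)) \<longlongrightarrow> 0) (at_right 0)"
proof (rule strong_limit[OF q _ _ h])
  show "\<forall>\<^sub>F t in at_right 0. markov_fn (heat_quot t) 0"
    using eventually_pos_at_right by eventually_elim (rule markov_heat_quot)
qed (rule heat_quot_tendsto)

lemma LC_generator:
  assumes q: "1 \<le> q" and fh: "(f, h) \<in> LC q"
  shows "(f, \<lambda>x. - h x) \<in> generator m q heat"
proof -
  note f = LC_D(1)[OF fh] and h = LC_D(2)[OF fh]
  have "\<forall>\<^sub>F t in at_right 0. Lq_pow m q (\<lambda>x. markov_calc (heat_quot t) 0 h x - h x)
      = Lq_pow m q (\<lambda>x. (heat t f x - f x) / of_real t - (- h x))"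
    using eventually_pos_at_right
  proof eventually_elim
    case (elim t)
    note [measurable] = Lq_measurable[OF f] Lq_measurable[OF h] Lq_measurable[OF heat_Lq(1)[OF less_imp_le[OF elim] q f]]
      Lq_measurable[OF markov_calc_contraction(1)[OF markov_heat_quot[OF elim] q h]]
    have "Lq_pow m q (\<lambda>x. h x - markov_calc (heat_quot t) 0 h x) = Lq_pow m q (\<lambda>x. (heat t f x - f x) / of_real t - (- h x))"
    proof (rule Lq_pow_cong_AE)
      show "AE x in m. h x - markov_calc (heat_quot t) 0 h x = (heat t f x - f x) / of_real t - (- h x)"
        using heat_difference[OF elim q fh] by eventually_elim simp
    qed measurable
    thus ?case by (simp only: Lq_pow_minus[of m q h])
  qed
  with heat_quot_strong_limit[OF q h]
  have "((\<lambda>t. Lq_pow m q (\<lambda>x. (heat t f x - f x) / of_real t - (- h x))) \<longlongrightarrow> 0) (at_right 0)"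
    by (simp only: tendsto_cong)
  thus ?thesis using f Lq_minus[OF h] by (simp add: generator_def Lq_norm_tendsto_iff[OF q])
qed

text \<open>On the mean over a fixed ball the difference quotient of f is minus
  \<open>heat_quot t\<close> applied to \<open>?p\<close>, before f is known to lie in the domain.
  It converges there as t tends to 0, and comparison with g gives the defining relation of
  \<open>LC\<close>.\<close>

lemma generator_LC:
  assumes q: "1 \<le> q" and fg: "(f, g) \<in> generator m q heat"
  shows "(f, \<lambda>x. - g x) \<in> LC q"
proof -
  have q0: "0 \<le> q" using q by simp
  have f: "f \<in> Lq m q" and g: "g \<in> Lq m q"
    and lim: "((\<lambda>t. Lq_pow m q (\<lambda>x. (heat t f x - f x) / of_real t - g x)) \<longlongrightarrow> 0) (at_right 0)"
    using fg by (auto simp: generator_def Lq_norm_tendsto_iff[OF q])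
  let ?p = "multiplier lam_id (mean f)"
  have dq: "(\<lambda>x. (heat t f x - f x) / of_real t) \<in> Lq m q" if "0 < t" for t
    using Lq_cmult[OF q0 Lq_diff(1)[OF q0 heat_Lq(1)[OF less_imp_le[OF that] q f] f], of "1 / of_real t"] by simp
  have "mean (\<lambda>x. - g x) B = ?p B" if B: "B \<in> all_balls" for B
  proof -
    have "((\<lambda>t. mean (\<lambda>x. (heat t f x - f x) / of_real t - g x) B) \<longlongrightarrow> 0) (at_right 0)"
      using eventually_pos_at_right
      by (intro mean_tendsto(2)[OF q _ B lim]) (auto elim!: eventually_mono intro!: Lq_diff[OF q0] dq g)
    moreover have "\<forall>\<^sub>F t in at_right 0. mean (\<lambda>x. (heat t f x - f x) / of_real t - g x) B
        = - multiplier (\<lambda>s. of_real (heat_quot t s)) ?p B - mean g B"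
      using eventually_pos_at_right
    proof eventually_elim
      case (elim t)
      hence t0: "0 \<le> t" by simp
      note tf = heat_Lq(1)[OF t0 q f]
      note ws = admissible_incr_summable[OF markov_admissible[OF markov_heat_quot[OF elim]]]
      have "mean (\<lambda>x. (heat t f x - f x) / of_real t) B = (1 / of_real t) * (mean (heat t f) B - mean f B)"
      proof -
        have "mean (\<lambda>x. (1 / of_real t) * (heat t f x - f x) + 0) B
          = (1 / of_real t) * mean (\<lambda>x. heat t f x - f x) B + mean (\<lambda>x. 0) B"
          by (rule mean_lincomb[OF q Lq_diff(1)[OF q0 tf f] Lq_zero B])
        thus ?thesis by (simp add: mean_diff[OF q tf f B] mean_zero)
      qed
      also have "mean (heat t f) B = multiplier (\<lambda>s. (- of_real t) * (of_real (heat_quot t s) * lam_id s) + 1) (mean f) B"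
        unfolding mean_heat[OF t0 q f B] using elim by (intro multiplier_cong[OF B]) (auto simp only: exp_heat_quot)
      also have "\<dots> = (- of_real t) * multiplier (\<lambda>s. of_real (heat_quot t s) * lam_id s) (mean f) B + 1 * mean f B"
        by (rule multiplier_affine)
      also have "multiplier (\<lambda>s. of_real (heat_quot t s) * lam_id s) (mean f) B = multiplier (\<lambda>s. of_real (heat_quot t s)) ?p B"
        by (rule multiplier_compose[OF ws incr_summable_lam_id bounded_above_mean[OF q f] B, symmetric])
      finally have "mean (\<lambda>x. (heat t f x - f x) / of_real t) B = - multiplier (\<lambda>s. of_real (heat_quot t s)) ?p B"
        using elim by simp
      thus ?case by (simp add: mean_diff[OF q dq[OF elim] g B])
    qed
    ultimately have l1: "((\<lambda>t. - multiplier (\<lambda>s. of_real (heat_quot t s)) ?p B - mean g B) \<longlongrightarrow> 0) (at_right 0)"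
      by (simp only: tendsto_cong)
    have l2: "((\<lambda>t. multiplier (\<lambda>s. of_real (heat_quot t s)) ?p B) \<longlongrightarrow> ?p B) (at_right 0)"
    proof -
      obtain K where K: "0 \<le> K" "\<And>T. T \<in> all_balls \<Longrightarrow> B \<subseteq> T \<Longrightarrow> norm (?p T) \<le> K"
        using bounded_aboveE[OF bounded_above_multiplier_lam_id[OF bounded_above_mean[OF q f]] B] by metis
      have "((\<lambda>t. (1 - heat_quot t (lam_parent B)) * K) \<longlongrightarrow> (1 - 1) * K) (at_right 0)"
        by (intro tendsto_intros heat_quot_tendsto)
      hence z: "((\<lambda>t. (1 - heat_quot t (lam_parent B)) * K) \<longlongrightarrow> 0) (at_right 0)" by simp
      have "((\<lambda>t. multiplier (\<lambda>s. of_real (heat_quot t s)) ?p B - of_real (heat_quot t (lam_parent B)) * ?p B) \<longlongrightarrow> 0) (at_right 0)"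
        using eventually_pos_at_right
      proof (rule Lim_null_comparison[OF eventually_mono z])
        fix t :: real assume t: "0 < t"
        show "norm (multiplier (\<lambda>s. of_real (heat_quot t s)) ?p B - of_real (heat_quot t (lam_parent B)) * ?p B) \<le> (1 - heat_quot t (lam_parent B)) * K"
        proof -
          have "heat_quot t 0 = 1" by (simp add: heat_quot_def)
          thus ?thesis using multiplier_bound[OF markov_dominated[OF markov_heat_quot[OF t]] B, of ?p K] K(2) by simp
        qed
      qed
      moreover have "((\<lambda>t. of_real (heat_quot t (lam_parent B)) * ?p B) \<longlongrightarrow> of_real 1 * ?p B) (at_right 0)"
        by (intro tendsto_intros heat_quot_tendsto)
      ultimately have "((\<lambda>t. (multiplier (\<lambda>s. of_real (heat_quot t s)) ?p B - of_real (heat_quot t (lam_parent B)) * ?p B)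
          + of_real (heat_quot t (lam_parent B)) * ?p B) \<longlongrightarrow> 0 + of_real 1 * ?p B) (at_right 0)" by (rule tendsto_add)
      thus ?thesis by simp
    qed
    have "((\<lambda>t. - multiplier (\<lambda>s. of_real (heat_quot t s)) ?p B - mean g B) \<longlongrightarrow> - ?p B - mean g B) (at_right 0)"
      by (intro tendsto_intros l2)
    from tendsto_unique[OF _ this l1] have "- ?p B - mean g B = 0" by simp
    hence "mean g B = - ?p B" by simp
    moreover have "mean (\<lambda>x. - g x) B = - mean g B"
      using mean_diff[OF q Lq_zero g B] by (simp add: mean_zero)
    ultimately show ?thesis by simp
  qed
  thus ?thesis using f Lq_minus[OF g] by (simp add: LC_def)
qed

lemma heat_generator: assumes q: "1 \<le> q" shows "generator m q heat = neg_op (LC q)"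
proof
  show "generator m q heat \<subseteq> neg_op (LC q)"
  proof (rule subrelI)
    fix f g assume "(f, g) \<in> generator m q heat"
    hence L: "(f, \<lambda>x. - g x) \<in> LC q" by (rule generator_LC[OF q])
    show "(f, g) \<in> neg_op (LC q)"
      unfolding neg_op_def mem_Collect_eq by (intro exI[of _ f] exI[of _ "\<lambda>x. - g x"] conjI L) simp
  qed
  show "neg_op (LC q) \<subseteq> generator m q heat" using LC_generator[OF q] by (auto simp: neg_op_def)
qed

section \<open>The resolvent\<close>

lemma resolvent_admissible:
  fixes z :: complex
  assumes c: "0 < c" and lb: "\<And>a. a \<in> Lam \<Longrightarrow> c * (1 + a) \<le> norm (z - of_real a)"
  shows "admissible (\<lambda>s. 1 / (z - lam_id s)) 0 (1 / c\<^sup>2 + 1 / c)"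
proof -
  \<comment> \<open>The values of 1 / (z - s) at a <= b differ by (a - b) / ((z - a) (z - b)), of
    modulus at most (b - a) / (c^2 (1 + a) (1 + b)), which is precisely the drop of
    \<open>?G\<close>. So the increments sum to at most \<open>?G 0\<close>, that is 1 / c^2, and
    the diagonal value is at most 1 / c.\<close>
  let ?F = "\<lambda>s. 1 / (z - lam_id s)" and ?G = "\<lambda>s. 1 / (c\<^sup>2 * (1 + s))"
  have nz: "z - of_real a \<noteq> 0" if "a \<in> Lam" for a
  proof -
    have "0 < c * (1 + a)" using c Lam_nonneg[OF that] by simp
    thus ?thesis using lb[OF that] by auto
  qed
  have dom: "dominated ?F ?G"
    unfolding dominated_def
  proof (intro conjI ballI impI)
    fix a assume "a \<in> Lam" thus "0 \<le> ?G a" using c Lam_nonneg by simp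
  next
    fix a b assume a: "a \<in> Lam" and b: "b \<in> Lam" and ab: "a \<le> b"
    have pa: "0 < 1 + a" "0 < 1 + b" using Lam_nonneg[OF a] Lam_nonneg[OF b] by auto
    have "?F a - ?F b = of_real (a - b) / ((z - of_real a) * (z - of_real b))"
      using nz[OF a] nz[OF b] by (simp add: lam_id_def field_simps)
    hence "norm (?F a - ?F b) = (b - a) / (norm (z - of_real a) * norm (z - of_real b))"
      using ab by (simp only: norm_divide norm_mult norm_of_real) simp
    also have "\<dots> \<le> (b - a) / ((c * (1 + a)) * (c * (1 + b)))"
      using c pa ab lb[OF a] lb[OF b] by (intro frac_le mult_mono mult_pos_pos) auto
    also have "\<dots> = ?G a - ?G b"
    proof -
      have "(v - u) / ((c * u) * (c * v)) = 1 / (c\<^sup>2 * u) - 1 / (c\<^sup>2 * v)" if "0 < u" "0 < v" for u v :: real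
        using that c by (simp add: field_simps power2_eq_square)
      from this[OF pa] show ?thesis by simp
    qed
    finally show "norm (?F a - ?F b) \<le> ?G a - ?G b" .
  qed
  have lim: "(?F \<longlongrightarrow> 0) at_top"
  proof -
    have "filterlim (\<lambda>s. s - norm z) at_top at_top"
      using filterlim_tendsto_add_at_top[OF tendsto_const[of "- norm z"] filterlim_ident] by (simp add: add.commute)
    hence inv: "((\<lambda>s. 1 / (s - norm z)) \<longlongrightarrow> 0) at_top"
      by (intro tendsto_divide_0[OF tendsto_const] filterlim_at_top_imp_at_infinity)
    have "\<forall>\<^sub>F s in at_top. norm (?F s) \<le> 1 / (s - norm z)"
      using eventually_gt_at_top[of "norm z"]
    proof eventually_elim
      case (elim s)
      have "0 \<le> s" using elim norm_ge_zero[of z] by linarith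
      hence "s = norm (complex_of_real s)" by simp
      hence "s - norm z \<le> norm (z - of_real s)" using norm_triangle_ineq2[of "of_real s" z] by (simp add: norm_minus_commute)
      thus ?case using elim by (simp add: norm_divide lam_id_def frac_le)
    qed
    thus ?thesis using inv by (rule Lim_null_comparison)
  qed
  have "norm (?F a) \<le> 1 / c" if a: "a \<in> Lam" for a
  proof -
    have "c * 1 \<le> c * (1 + a)" using c Lam_nonneg[OF a] by (intro mult_left_mono) auto
    hence "c \<le> norm (z - of_real a)" using lb[OF a] by simp
    thus ?thesis using c by (simp add: norm_divide lam_id_def frac_le)
  qed
  hence "norm (phi ?F 0 x) \<le> 1 / c" for x
    using c isolated_lam_Lam[of x] by (simp add: phi_def)
  moreover have "(\<Sum>\<^sub>\<infinity>T\<in>{T \<in> ns_balls. x \<in> T}. norm (incr ?F T)) \<le> 1 / c\<^sup>2" for x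
    using point_summable(2)[OF dom, of x] by simp
  ultimately have "(\<Sum>\<^sub>\<infinity>T\<in>{T \<in> ns_balls. x \<in> T}. norm (incr ?F T)) + norm (phi ?F 0 x) \<le> 1 / c\<^sup>2 + 1 / c" for x
    by (intro add_mono)
  moreover have "0 < 1 / c\<^sup>2 + 1 / c" using c by (intro add_pos_pos) auto
  ultimately show ?thesis unfolding admissible_def using dom lim by blast
qed

text \<open>Both inverse identities are checked on ball means, where they are the scalar identities
  s / (z - s) = z / (z - s) - 1 and (z - s) / (z - s) = 1 on \<open>Lam\<close>. The condition on z
  does not involve q.\<close>

lemma resolvent_setI:
  fixes z :: complex
  assumes q: "1 \<le> q" and c: "0 < c" and lb: "\<And>a. a \<in> Lam \<Longrightarrow> c * (1 + a) \<le> norm (z - of_real a)"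
  shows "z \<in> resolvent_set m q (LC q)"
proof -
  have q0: "0 \<le> q" using q by simp
  let ?F = "\<lambda>s. 1 / (z - lam_id s)"
  note adm = resolvent_admissible[OF c lb]
  note ws = admissible_incr_summable[OF adm]
  let ?R = "fcalc ?F 0"
  have nz: "z - lam_id a \<noteq> 0" if "a \<in> Lam" for a
  proof -
    have "0 < c * (1 + a)" using c Lam_nonneg[OF that] by simp
    thus ?thesis using lb[OF that] by (auto simp: lam_id_def)
  qed
  have R1: "\<exists>h. (?R g, h) \<in> LC q \<and> (AE x in m. z * ?R g x - h x = g x)" if g: "g \<in> Lq m q" for g
  proof (intro exI[of _ "\<lambda>x. z * ?R g x - g x"] conjI)
    note Rg = fcalc_Lq(1)[OF adm q g]
    have mR: "mean (?R g) T = multiplier ?F (mean g) T" if "T \<in> all_balls" for T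
      by (rule mean_fcalc[OF adm q g that])
    have hL: "(\<lambda>x. z * ?R g x - g x) \<in> Lq m q" by (rule Lq_diff(1)[OF q0 Lq_cmult[OF q0 Rg] g])
    have "mean (\<lambda>x. z * ?R g x - g x) B = multiplier lam_id (mean (?R g)) B" if B: "B \<in> all_balls" for B
    proof -
      have "multiplier lam_id (mean (?R g)) B = multiplier lam_id (multiplier ?F (mean g)) B"
        using mR by (intro multiplier_cong[OF B]) auto
      also have "\<dots> = multiplier (\<lambda>s. lam_id s * ?F s) (mean g) B"
        by (rule multiplier_compose[OF incr_summable_lam_id ws bounded_above_mean[OF q g] B])
      also have "\<dots> = multiplier (\<lambda>s. z * ?F s + (-1)) (mean g) B"
        using nz by (intro multiplier_cong[OF B]) (auto simp: field_simps)
      also have "\<dots> = z * multiplier ?F (mean g) B + (-1) * mean g B" by (rule multiplier_affine)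
      also have "\<dots> = mean (\<lambda>x. z * ?R g x - g x) B"
      proof -
        have "mean (\<lambda>x. z * ?R g x + - g x) B = z * mean (?R g) B + mean (\<lambda>x. - g x) B"
          by (rule mean_lincomb[OF q Rg Lq_minus[OF g] B])
        moreover have "mean (\<lambda>x. - g x) B = - mean g B"
          using mean_diff[OF q Lq_zero g B] by (simp add: mean_zero)
        ultimately show ?thesis using mR[OF B] by simp
      qed
      finally show ?thesis by simp
    qed
    thus "(?R g, \<lambda>x. z * ?R g x - g x) \<in> LC q" using Rg hL by (simp add: LC_def)
  qed simp
  have R2: "AE x in m. ?R (\<lambda>y. z * f y - h y) x = f x" if fh: "(f, h) \<in> LC q" for f h
  proof -
    note f = LC_D(1)[OF fh] and h = LC_D(2)[OF fh]
    have k: "(\<lambda>y. z * f y - h y) \<in> Lq m q" by (rule Lq_diff(1)[OF q0 Lq_cmult[OF q0 f] h])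
    have wz: "incr_summable (\<lambda>s. (-1) * lam_id s + z)" by (rule incr_summable_affine[OF incr_summable_lam_id])
    have mk: "mean (\<lambda>y. z * f y - h y) T = multiplier (\<lambda>s. (-1) * lam_id s + z) (mean f) T" if T: "T \<in> all_balls" for T
    proof -
      have "mean (\<lambda>x. z * f x + - h x) T = z * mean f T + mean (\<lambda>x. - h x) T"
        by (rule mean_lincomb[OF q f Lq_minus[OF h] T])
      moreover have "mean (\<lambda>x. - h x) T = - mean h T"
        using mean_diff[OF q Lq_zero h T] by (simp add: mean_zero)
      ultimately show ?thesis unfolding multiplier_affine using LC_D(3)[OF fh T] by simp
    qed
    show ?thesis
    proof (rule means_determine[OF q fcalc_Lq(1)[OF adm q k] f])
      fix B :: "'a set" assume B: "B \<in> all_balls"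
      have "mean (?R (\<lambda>y. z * f y - h y)) B = multiplier ?F (mean (\<lambda>y. z * f y - h y)) B"
        by (rule mean_fcalc[OF adm q k B])
      also have "\<dots> = multiplier ?F (multiplier (\<lambda>s. (-1) * lam_id s + z) (mean f)) B"
        using mk by (intro multiplier_cong[OF B]) auto
      also have "\<dots> = multiplier (\<lambda>s. ?F s * ((-1) * lam_id s + z)) (mean f) B"
        by (rule multiplier_compose[OF ws wz bounded_above_mean[OF q f] B])
      also have "\<dots> = mean f B" using nz by (intro multiplier_one[OF B]) (auto simp: field_simps)
      finally show "mean (?R (\<lambda>y. z * f y - h y)) B = mean f B" .
    qed
  qed
  show ?thesis
    unfolding resolvent_set_def mem_Collect_eq
  proof (intro exI[of _ ?R] conjI)
    show "bounded_operator m q ?R" by (rule fcalc_bounded_operator[OF adm q])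
    show "\<forall>g\<in>Lq m q. \<exists>h. (?R g, h) \<in> LC q \<and> (AE x in m. z * ?R g x - h x = g x)" using R1 by blast
    show "\<forall>(f, h)\<in>LC q. AE x in m. ?R (\<lambda>y. z * f y - h y) x = f x" using R2 by blast
  qed
qed

text \<open>By the triangle inequality 1 + a is at most (1 + norm z) + norm (z - a), and a lower
  bound \<delta> for the distances to \<open>Lam\<close> absorbs 1 + norm z into a multiple of norm
  (z - a). This gives k, and c is 1 / k.\<close>

lemma resolvent_bound_exists:
  assumes z: "z \<notin> complex_of_real ` (closure (lam C ` ns_balls) \<union> {0})"
  obtains c where "0 < c" "\<And>a. a \<in> Lam \<Longrightarrow> c * (1 + a) \<le> norm (z - of_real a)"
proof -
  let ?S = "complex_of_real ` (closure (lam C ` ns_balls) \<union> {0})"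
  have "closed ?S"
  proof -
    have "?S = {z. Im z = 0} \<inter> Re -` (closure (lam C ` ns_balls) \<union> {0})"
    proof
      show "{z. Im z = 0} \<inter> Re -` (closure (lam C ` ns_balls) \<union> {0}) \<subseteq> ?S"
      proof
        fix y assume y: "y \<in> {z. Im z = 0} \<inter> Re -` (closure (lam C ` ns_balls) \<union> {0})"
        hence "y = complex_of_real (Re y)" by (simp add: complex_eq_iff)
        moreover have "Re y \<in> closure (lam C ` ns_balls) \<union> {0}" using y by simp
        ultimately show "y \<in> ?S" by (rule image_eqI)
      qed
    qed auto
    moreover have "closed {z. Im z = 0}" by (intro closed_Collect_eq continuous_intros)
    moreover have "closed (Re -` (closure (lam C ` ns_balls) \<union> {0}))"
      by (intro closed_vimage closed_Un closed_closure closed_insert closed_empty continuous_intros)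
    ultimately show ?thesis by (simp only: closed_Int)
  qed
  hence "open (- ?S)" by (simp add: closed_def)
  then obtain \<delta> where \<delta>: "0 < \<delta>" "ball z \<delta> \<subseteq> - ?S" using z open_contains_ball by blast
  have far: "\<delta> \<le> norm (z - of_real a)" if "a \<in> Lam" for a
  proof -
    have "a \<in> closure (lam C ` ns_balls) \<union> {0}" using that closure_subset[of "lam C ` ns_balls"] by (auto simp: Lam_def)
    hence "complex_of_real a \<notin> ball z \<delta>" using \<delta>(2) by blast
    thus ?thesis by (simp add: dist_norm)
  qed
  define k where "k = (1 + norm z) / \<delta> + 1"
  have k: "0 < k" using \<delta>(1) by (simp add: k_def add_nonneg_pos)
  have "(1 / k) * (1 + a) \<le> norm (z - of_real a)" if a: "a \<in> Lam" for a
  proof -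
    have "a = norm (complex_of_real a)" using Lam_nonneg[OF a] by simp
    also have "\<dots> \<le> norm z + norm (z - of_real a)" using norm_triangle_ineq4[of z "z - of_real a"] by simp
    finally have "1 + a \<le> (1 + norm z) + norm (z - of_real a)" by simp
    also have "1 + norm z = (1 + norm z) / \<delta> * \<delta>" using \<delta> by simp
    also have "\<dots> \<le> (1 + norm z) / \<delta> * norm (z - of_real a)" using far[OF a] \<delta>(1) by (intro mult_left_mono) auto
    finally have "1 + a \<le> k * norm (z - of_real a)" by (simp add: k_def algebra_simps)
    thus ?thesis using k by (simp add: field_simps)
  qed
  thus thesis using that[of "1 / k"] k by simp
qed

section \<open>Spectrum\<close>

lemma laplacian_lincomb:
  assumes d: "d \<in> ball_span" and d': "d' \<in> ball_span"
  shows "hier_Laplacian m C (\<lambda>x. c * d x + d' x) x = c * hier_Laplacian m C d x + hier_Laplacian m C d' x"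
proof -
  let ?I = "{T \<in> ns_balls. x \<in> T}"
  have s: "lap_term d x summable_on ?I" "lap_term d' x summable_on ?I"
    using ball_span_laplacian(1) d d' by auto
  have "(\<Sum>\<^sub>\<infinity>T\<in>?I. lap_term (\<lambda>x. c * d x + d' x) x T) = (\<Sum>\<^sub>\<infinity>T\<in>?I. c * lap_term d x T + lap_term d' x T)"
    using ball_span_Lq[OF order_refl d] ball_span_Lq[OF order_refl d']
    by (intro infsum_cong lap_term_lincomb) (auto simp: ns_balls_all)
  also have "\<dots> = c * (\<Sum>\<^sub>\<infinity>T\<in>?I. lap_term d x T) + (\<Sum>\<^sub>\<infinity>T\<in>?I. lap_term d' x T)"
    using s by (subst infsum_add) (auto intro: summable_on_cmult_right simp: infsum_cmult_right')
  finally show ?thesis by (simp add: hier_Laplacian_def lap_term_def algebra_simps)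
qed

lemma laplacian_zero: "hier_Laplacian m C (\<lambda>x. 0) x = 0"
  by (simp add: hier_Laplacian_def mean_zero)

text \<open>Normalized so that the mean over a ball T containing S is 1 / m(T), whatever S is; hence
  averages over common larger balls cancel in differences.\<close>

definition ball_density :: "'a set \<Rightarrow> 'a \<Rightarrow> complex" where "ball_density S x = (1 / of_real (mu S)) * indicator S x"

lemma ball_density_ball_span: "S \<in> all_balls \<Longrightarrow> ball_density S \<in> ball_span"
  using ball_span_indicator[of S "1 / of_real (mu S)"] by (simp add: ball_density_def[abs_def])

lemma laplacian_ball_density: "S \<in> all_balls \<Longrightarrow> hier_Laplacian m C (ball_density S) x = (1 / of_real (mu S)) * ball_image lam_id S x"
  using ball_span_laplacian(2)[OF ball_span_zero, of S "1 / of_real (mu S)" x]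
  by (simp add: ball_density_def[abs_def] laplacian_zero)

lemma laplacian_ball_density_sum:
  assumes S: "S \<in> all_balls"
  shows "hier_Laplacian m C (ball_density S) x = complex_of_real (lam_parent S) * ball_density S x - (\<Sum>\<^sub>\<infinity>T\<in>{T \<in> up S. x \<in> T}. complex_of_real (C T / mu T))"
proof -
  have "(\<Sum>\<^sub>\<infinity>T\<in>{T \<in> up S. x \<in> T}. incr lam_id T * mean (indicator S) T)
      = (\<Sum>\<^sub>\<infinity>T\<in>{T \<in> up S. x \<in> T}. (- of_real (mu S)) * of_real (C T / mu T))"
    using S by (intro infsum_cong) (auto simp: incr_lam_id mean_indicator_sup up_ns up_all up_le)
  hence "ball_image lam_id S x = complex_of_real (lam_parent S) * indicator S x - of_real (mu S) * (\<Sum>\<^sub>\<infinity>T\<in>{T \<in> up S. x \<in> T}. complex_of_real (C T / mu T))"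
    unfolding ball_image_def infsum_cmult_right' lam_id_def by (simp only: mult_minus_left diff_conv_add_uminus)
  thus ?thesis using S by (simp add: laplacian_ball_density ball_density_def field_simps)
qed

text \<open>The balls above N' are N and those above N, so the two series differ by the single term
  \<open>C N\<close> times the density of N. With
  \<open>lam_parent N' = lam C N = lam_parent N + C N\<close> everything collects to the
  eigenvalue.\<close>

lemma laplacian_eigen:
  assumes N': "N' \<in> all_balls" and N: "N \<in> all_balls" and sub: "N' \<subset> N"
    and pred: "\<And>T. T \<in> all_balls \<Longrightarrow> N' \<subset> T \<longleftrightarrow> N \<subseteq> T"
  shows "hier_Laplacian m C (ball_density N') x - hier_Laplacian m C (ball_density N) x = complex_of_real (lam C N) * (ball_density N' x - ball_density N x)"
proof -
  have Nns: "N \<in> ns_balls" using not_singleton_ball[OF N' N sub] .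
  have up: "up N' = insert N (up N)"
    using pred Nns ns_balls_all unfolding up_def by blast
  have lam_parent': "lam_parent N' = lam C N" by (rule lam_parent_pred) (rule pred)
  let ?f = "\<lambda>T. complex_of_real (C T / mu T)"
  have "(\<lambda>T. C T * (1 / mu N)) summable_on up N" by (intro summable_on_cmult_left C_summable_up N)
  hence "(\<lambda>T. C T / mu T) summable_on up N"
  proof (rule summable_on_comparison_test)
    fix T assume T: "T \<in> up N"
    have "1 / mu T \<le> 1 / mu N" using mu_mono[OF up_le[OF T] up_all[OF T] N] mu_pos[OF N] by (intro divide_left_mono) auto
    from mult_left_mono[OF this, of "C T"] show "C T / mu T \<le> C T * (1 / mu N)"
      using C_pos[OF up_ns[OF T]] by simp
    show "0 \<le> C T / mu T" using C_pos[OF up_ns[OF T]] by (simp add: less_imp_le)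
  qed
  hence "(\<lambda>T. C T / mu T) summable_on {T \<in> up N. x \<in> T}" by (rule summable_on_subset_banach) auto
  hence sm: "?f summable_on {T \<in> up N. x \<in> T}" by (rule summable_on_of_real)
  have "(\<Sum>\<^sub>\<infinity>T\<in>{T \<in> up N'. x \<in> T}. ?f T) = (\<Sum>\<^sub>\<infinity>T\<in>{T \<in> up N. x \<in> T}. ?f T) + complex_of_real (C N) * ball_density N x"
  proof (cases "x \<in> N")
    case True
    hence "{T \<in> up N'. x \<in> T} = insert N {T \<in> up N. x \<in> T}" using up by auto
    moreover have "N \<notin> {T \<in> up N. x \<in> T}" by (auto simp: up_def)
    ultimately show ?thesis using True infsum_insert[OF sm, of N] by (simp add: ball_density_def)
  next
    case False
    hence "{T \<in> up N'. x \<in> T} = {T \<in> up N. x \<in> T}" using up by auto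
    thus ?thesis using False by (simp add: ball_density_def)
  qed
  thus ?thesis unfolding laplacian_ball_density_sum[OF N'] laplacian_ball_density_sum[OF N] lam_parent' lam_eq[OF Nns]
    by (simp add: algebra_simps)
qed

lemma Lq_pow_pos:
  assumes q: "1 \<le> q" and f: "f \<in> Lq m q" and T: "T \<in> all_balls" "\<And>x. x \<in> T \<Longrightarrow> f x \<noteq> 0"
  shows "0 < Lq_pow m q f"
proof (rule ccontr)
  assume "\<not> 0 < Lq_pow m q f"
  hence "Lq_pow m q f = 0" using Lq_pow_nonneg[of m q f] by linarith
  hence "AE x in m. f x = 0" by (rule Lq_pow_zero_AE[OF f])
  hence "AE x in m. x \<notin> T" by eventually_elim (use T(2) in blast)
  hence "emeasure m T = 0" using AE_iff_measurable[OF balls_sets[OF T(1)], of "\<lambda>x. x \<notin> T"] by auto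
  thus False using emeasure_ball_pos[OF T(1)] by simp
qed

text \<open>The eigenfunction belongs to a child N' of B. It is nonzero on the open set B - N',
  which contains a ball and so has positive measure.\<close>

lemma eigenvector:
  assumes q: "1 \<le> q" and B: "B \<in> ns_balls"
  obtains f where "(f, \<lambda>x. complex_of_real (lam C B) * f x) \<in> LC q" "0 < Lq_pow m q f"
proof -
  have Ba: "B \<in> all_balls" using B by (rule ns_balls_all)
  obtain x where x: "x \<in> B" using balls_nonempty[OF Ba] by blast
  obtain y where y: "y \<in> B" "y \<noteq> x"
  proof -
    have "B \<noteq> {x}" using B by (auto simp: ns_balls_def)
    thus thesis using that x by blast
  qed
  obtain r where r: "0 < r" "B = ball x r" using all_balls_centered[OF Ba x] by metis
  \<comment> \<open>The open ball of radius dist x y about x omits y, so it lies properly inside B;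
    this provides the descent to a child.\<close>
  have "ball x (dist x y) \<subseteq> B" unfolding r(2) using y(1) r(2) by (intro subset_ball) simp
  moreover have "y \<notin> ball x (dist x y)" by simp
  ultimately have sub: "ball x (dist x y) \<subset> B" using y by blast
  have xa: "ball x (dist x y) \<in> all_balls" using y by simp
  obtain N' where N': "N' \<in> all_balls" "ball x (dist x y) \<subseteq> N'" "N' \<subset> B"
    "\<And>T. T \<in> all_balls \<Longrightarrow> N' \<subset> T \<longleftrightarrow> B \<subseteq> T"
    using predecessor[OF xa Ba sub] by metis
  define f where "f = (\<lambda>x. (-1) * ball_density B x + ball_density N' x)"
  have fb: "f \<in> ball_span" unfolding f_def by (intro ball_span_lincomb ball_density_ball_span Ba N'(1))
  have "hier_Laplacian m C f z = complex_of_real (lam C B) * f z" for z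
    using laplacian_eigen[OF N'(1) Ba N'(3,4), of z]
      laplacian_lincomb[OF ball_density_ball_span[OF Ba] ball_density_ball_span[OF N'(1)], of "-1" z]
    by (simp add: f_def)
  hence e: "hier_Laplacian m C f = (\<lambda>x. complex_of_real (lam C B) * f x)" by blast
  have L: "(f, \<lambda>x. complex_of_real (lam C B) * f x) \<in> LC q" using ball_span_LC[OF q fb] by (simp add: e)
  obtain p where p: "p \<in> B" "p \<notin> N'" using N'(3) by blast
  have "open (B - N')" using balls_open[OF Ba] balls_compact[OF N'(1)] by (intro open_Diff compact_imp_closed)
  then obtain s where s: "0 < s" "ball p s \<subseteq> B - N'" using p open_contains_ball[of "B - N'"] by auto
  have "f z \<noteq> 0" if "z \<in> ball p s" for z
  proof -
    have "z \<in> B" "z \<notin> N'" using s that by auto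
    thus ?thesis using Ba by (simp add: f_def ball_density_def)
  qed
  hence "0 < Lq_pow m q f" using s by (intro Lq_pow_pos[OF q LC_D(1)[OF L], of "ball p s"]) auto
  thus thesis using that L by blast
qed

text \<open>An inverse of z - L with bound K would satisfy norm f <= K * norm (z - a) * norm f on
  eigenfunctions; eigenvalues a closer to z than 1 / (\<bar>K\<bar> + 1) rule this out.\<close>

lemma spectrumI:
  assumes q: "1 \<le> q"
    and ap: "\<And>e. 0 < e \<Longrightarrow> \<exists>f a. (f, \<lambda>x. a * f x) \<in> LC q \<and> 0 < Lq_pow m q f \<and> norm (z - a) < e"
  shows "z \<in> spectrum m q (LC q)"
proof (rule ccontr)
  assume "z \<notin> spectrum m q (LC q)"
  then obtain R where R: "bounded_operator m q R" "\<forall>(f, h)\<in>LC q. AE x in m. R (\<lambda>y. z * f y - h y) x = f x"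
    by (auto simp: spectrum_def resolvent_set_def)
  obtain K where K: "\<And>f. f \<in> Lq m q \<Longrightarrow> Lq_norm m q (R f) \<le> K * Lq_norm m q f"
    using R(1) unfolding bounded_operator_def by blast
  have q0: "0 \<le> q" using q by simp
  define e where "e = 1 / (\<bar>K\<bar> + 1)"
  have e: "0 < e" by (simp add: e_def add_nonneg_pos)
  obtain f a where f: "(f, \<lambda>x. a * f x) \<in> LC q" "0 < Lq_pow m q f" "norm (z - a) < e" using ap[OF e] by blast
  note fL = LC_D(1)[OF f(1)]
  have "AE x in m. R (\<lambda>y. z * f y - a * f y) x = f x" using bspec[OF R(2) f(1)] by simp
  hence ae: "AE x in m. R (\<lambda>y. (z - a) * f y) x = f x" by (simp add: left_diff_distrib)
  have kL: "(\<lambda>y. (z - a) * f y) \<in> Lq m q" by (rule Lq_cmult[OF q0 fL])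
  have RL: "R (\<lambda>y. (z - a) * f y) \<in> Lq m q" using R(1) kL by (simp add: bounded_operator_def)
  have pos: "0 < Lq_norm m q f" using f(2) by (simp add: Lq_norm_eq)
  have "Lq_norm m q f = Lq_norm m q (R (\<lambda>y. (z - a) * f y))"
    using Lq_pow_cong_AE[OF Lq_measurable[OF RL] Lq_measurable[OF fL] ae] by (simp add: Lq_norm_eq)
  also have "\<dots> \<le> K * Lq_norm m q (\<lambda>y. (z - a) * f y)" by (rule K[OF kL])
  also have "Lq_norm m q (\<lambda>y. (z - a) * f y) = norm (z - a) * Lq_norm m q f"
    using q by (simp add: Lq_norm_eq Lq_pow_cmult powr_mult powr_powr)
  also have "K * (norm (z - a) * Lq_norm m q f) \<le> \<bar>K\<bar> * (norm (z - a) * Lq_norm m q f)"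
    using pos by (intro mult_right_mono) auto
  also have "\<dots> \<le> \<bar>K\<bar> * (e * Lq_norm m q f)" using f(3) pos by (intro mult_left_mono mult_right_mono) auto
  also have "\<dots> = (\<bar>K\<bar> / (\<bar>K\<bar> + 1)) * Lq_norm m q f" by (simp add: e_def)
  also have "\<dots> < 1 * Lq_norm m q f" using pos by (intro mult_strict_right_mono) (auto simp: divide_less_eq_1)
  finally show False by simp
qed

text \<open>A finite part of the series for \<open>lam_parent B\<close> with remainder below e lies
  in the chain up to its largest ball N, and this chain sums to lam_parent B - lam_parent N.\<close>

lemma lam_parent_small:
  assumes B: "B \<in> all_balls" and e: "0 < e"
  obtains N where "N \<in> all_balls" "B \<subseteq> N" "lam_parent N < e"
proof -
  have s: "C summable_on up B" by (rule C_summable_up[OF B])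
  obtain \<F> where F: "finite \<F>" "\<F> \<subseteq> up B" "dist (sum C \<F>) (infsum C (up B)) \<le> e / 2"
    using infsum_finite_approximation[OF s, of "e / 2"] e by auto
  have close: "lam_parent B - sum C \<F> < e" using F(3) e unfolding lam_parent_def dist_real_def by linarith
  show thesis
  proof (cases "\<F> = {}")
    case True
    thus thesis using that[OF B] close by simp
  next
    case False
    obtain x where x: "x \<in> B" using balls_nonempty[OF B] by blast
    obtain N where N: "N \<in> \<F>" "\<And>T. T \<in> \<F> \<Longrightarrow> T \<subseteq> N"
    proof (rule finite_chain_top[OF F(1) False, of x])
      show "\<F> \<subseteq> all_balls" using F(2) up_all by auto
      show "x \<in> T" if "T \<in> \<F>" for T using F(2) that up_le x by (meson subsetD)
    qed (rule that)
    have NU: "N \<in> up B" using N F by auto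
    note Na = up_all[OF NU] up_le[OF NU]
    have "sum C \<F> \<le> sum C (chain B N)"
    proof (rule sum_mono2[OF finite_chain[OF B Na(1)]])
      show "\<F> \<subseteq> chain B N" using N(2) F(2) by (auto simp: chain_def up_def)
      show "0 \<le> C T" if "T \<in> chain B N - \<F>" for T using that C_pos by (auto simp: chain_def less_imp_le)
    qed
    also have "sum C (chain B N) = (\<Sum>T\<in>chain B N. - incr (\<lambda>s. s) T)"
      by (intro sum.cong) (auto simp: incr_def chain_def lam_eq)
    also have "\<dots> = lam_parent B - lam_parent N" using sum_chain[OF B Na, of "\<lambda>s. s"] by (simp add: sum_negf)
    finally show thesis using that[OF Na] close by simp
  qed
qed

text \<open>Above a ball N with small \<open>lam_parent N\<close> there are either further balls,
  whose eigenvalues are below e, or none; then N is the whole space and its indicator is an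
  eigenfunction for 0.\<close>

lemma spectrum_zero:
  assumes q: "1 \<le> q" and e: "0 < (e::real)"
  shows "\<exists>f a. (f, \<lambda>x. a * f x) \<in> LC q \<and> 0 < Lq_pow m q f \<and> norm (0 - a) < e"
proof -
  obtain x :: 'a where True by blast
  obtain N where N: "N \<in> all_balls" "lam_parent N < e" using lam_parent_small[of "ball x 1", OF _ e] by auto
  show ?thesis
  proof (cases "up N = {}")
    case True
    have "lam_parent N = 0" using True by (simp add: lam_parent_def)
    hence "ball_image lam_id N = (\<lambda>x. 0 * indicator N x)" using True by (auto simp: ball_image_def lam_id_def)
    hence L: "(indicator N, \<lambda>x. 0 * indicator N x) \<in> LC q" using ball_image_LC[OF q N(1)] by simp
    have "0 < Lq_pow m q (indicator N)" by (rule Lq_pow_pos[OF q LC_D(1)[OF L] N(1)]) simp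
    thus ?thesis using L e by (intro exI[of _ "indicator N"] exI[of _ 0]) auto
  next
    case False
    then obtain T where T: "T \<in> up N" by blast
    obtain f where f: "(f, \<lambda>x. complex_of_real (lam C T) * f x) \<in> LC q" "0 < Lq_pow m q f" using eigenvector[OF q up_ns[OF T]] by metis
    have "lam C T \<le> lam_parent N" by (rule lam_le_lam_parent[OF up_sub[OF T] N(1) up_all[OF T]])
    thus ?thesis using f N(2) by (intro exI[of _ f] exI[of _ "complex_of_real (lam C T)"]) auto
  qed
qed

lemma spectrum_LC:
  assumes q: "1 \<le> q"
  shows "spectrum m q (LC q) = complex_of_real ` (closure (lam C ` ns_balls) \<union> {0})"
proof
  show "spectrum m q (LC q) \<subseteq> complex_of_real ` (closure (lam C ` ns_balls) \<union> {0})"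
  proof
    fix z assume z: "z \<in> spectrum m q (LC q)"
    show "z \<in> complex_of_real ` (closure (lam C ` ns_balls) \<union> {0})"
    proof (rule ccontr)
      assume n: "z \<notin> complex_of_real ` (closure (lam C ` ns_balls) \<union> {0})"
      obtain c where "0 < c" "\<And>a. a \<in> Lam \<Longrightarrow> c * (1 + a) \<le> norm (z - of_real a)"
        using resolvent_bound_exists[OF n] by metis
      thus False using resolvent_setI[OF q] z by (simp add: spectrum_def)
    qed
  qed
  show "complex_of_real ` (closure (lam C ` ns_balls) \<union> {0}) \<subseteq> spectrum m q (LC q)"
  proof
    fix z assume "z \<in> complex_of_real ` (closure (lam C ` ns_balls) \<union> {0})"
    then obtain s where s: "z = of_real s" "s \<in> closure (lam C ` ns_balls) \<or> s = 0" by blast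
    show "z \<in> spectrum m q (LC q)"
    proof (rule spectrumI[OF q])
      fix e :: real assume e: "0 < e"
      show "\<exists>f a. (f, \<lambda>x. a * f x) \<in> LC q \<and> 0 < Lq_pow m q f \<and> norm (z - a) < e"
      proof (cases "s = 0")
        case True thus ?thesis using spectrum_zero[OF q e] s by simp
      next
        case False
        then obtain B where B: "B \<in> ns_balls" "dist (lam C B) s < e"
          using s(2) e by (auto simp: closure_approachable)
        obtain f where f: "(f, \<lambda>x. complex_of_real (lam C B) * f x) \<in> LC q" "0 < Lq_pow m q f" using eigenvector[OF q B(1)] by metis
        have "norm (z - complex_of_real (lam C B)) < e"
          using B(2) unfolding s(1) of_real_diff[symmetric] norm_of_real dist_real_def by linarith
        thus ?thesis using f by blast
      qed
    qed
  qed
qed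

text \<open>As 1 / (1 + s) is a Markov function, the inverse of 1 + L is a contraction in every
  L^q.\<close>

lemma LC_bound:
  assumes q: "1 \<le> q" and fh: "(f, h) \<in> LC q"
  shows "Lq_pow m q f \<le> Lq_pow m q (\<lambda>x. f x + h x)"
proof -
  have q0: "0 \<le> q" using q by simp
  note f = LC_D(1)[OF fh] and h = LC_D(2)[OF fh]
  let ?G = "\<lambda>s::real. 1 / (1 + s)"
  have G: "markov_fn ?G 0"
    unfolding markov_fn_def
  proof (intro conjI ballI impI)
    show "(?G \<longlongrightarrow> 0) at_top"
      by (intro tendsto_divide_0[OF tendsto_const] filterlim_at_top_imp_at_infinity
        filterlim_tendsto_add_at_top[OF tendsto_const] filterlim_ident)
    show "?G b \<le> ?G a" if "a \<in> Lam" "b \<in> Lam" "a \<le> b" for a b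
      using that Lam_nonneg[of a] by (intro divide_left_mono) auto
  qed (auto dest: Lam_nonneg)
  have g: "(\<lambda>x. f x + h x) \<in> Lq m q" by (rule Lq_add(1)[OF q0 f h])
  note Gg = markov_calc_contraction[OF G q g]
  have wa: "incr_summable (\<lambda>s. 1 * lam_id s + 1)" by (rule incr_summable_affine[OF incr_summable_lam_id])
  have "AE x in m. markov_calc ?G 0 (\<lambda>x. f x + h x) x = f x"
  proof (rule means_determine[OF q Gg(1) f])
    fix B :: "'a set" assume B: "B \<in> all_balls"
    have mg: "mean (\<lambda>x. f x + h x) T = multiplier (\<lambda>s. 1 * lam_id s + 1) (mean f) T" if T: "T \<in> all_balls" for T
      unfolding multiplier_affine using mean_lincomb[OF q h f T, of 1] LC_D(3)[OF fh T] by (simp add: add.commute)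
    have "mean (markov_calc ?G 0 (\<lambda>x. f x + h x)) B = multiplier (\<lambda>s. of_real (?G s)) (mean (\<lambda>x. f x + h x)) B"
      by (rule mean_markov_calc[OF G q g B])
    also have "\<dots> = multiplier (\<lambda>s. of_real (?G s)) (multiplier (\<lambda>s. 1 * lam_id s + 1) (mean f)) B"
      using mg by (intro multiplier_cong[OF B]) auto
    also have "\<dots> = multiplier (\<lambda>s. of_real (?G s) * (1 * lam_id s + 1)) (mean f) B"
      by (rule multiplier_compose[OF admissible_incr_summable[OF markov_admissible[OF G]] wa bounded_above_mean[OF q f] B])
    also have "\<dots> = mean f B"
    proof (rule multiplier_one[OF B])
      fix s assume "s \<in> Lam"
      hence "1 + s \<noteq> 0" using Lam_nonneg[of s] by simp
      moreover have "complex_of_real (?G s) * (1 * lam_id s + 1) = of_real (?G s * (1 + s))"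
        by (simp only: of_real_mult of_real_add of_real_1 lam_id_def mult_1 add.commute)
      ultimately show "complex_of_real (?G s) * (1 * lam_id s + 1) = 1" by simp
    qed
    finally show "mean (markov_calc ?G 0 (\<lambda>x. f x + h x)) B = mean f B" .
  qed
  hence "Lq_pow m q (markov_calc ?G 0 (\<lambda>x. f x + h x)) = Lq_pow m q f"
    by (intro Lq_pow_cong_AE) (use Gg(1) f Lq_measurable in auto)
  thus ?thesis using Gg(2) by simp
qed

section \<open>The range of 1 + L on ball functions\<close>

lemma chain_resolvent:
  assumes B: "B \<in> all_balls" and N: "N \<in> all_balls" and BN: "B \<subseteq> N"
  shows "\<exists>d\<in>ball_span. \<forall>x. d x + hier_Laplacian m C d x = ball_density B x + hier_Laplacian m C (ball_density N) x"
  using assms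
proof (induction rule: ball_chain_induct)
  case base
  show ?case using ball_density_ball_span[OF B] by blast
next
  case (step N N')
  then obtain d where d: "d \<in> ball_span" "\<And>x. d x + hier_Laplacian m C d x = ball_density B x + hier_Laplacian m C (ball_density N') x" by blast
  define l where "l = lam C N"
  have l: "0 \<le> l" by (simp add: l_def)
  \<comment> \<open>1 + L multiplies the eigenfunction g by 1 + l, whereas passing from N' to N
    changes the right-hand side by L g = l * g.\<close>
  define k where "k = complex_of_real (l / (1 + l))"
  have "1 + l \<noteq> 0" using l by simp
  moreover have "k * (1 + of_real l) = of_real (l / (1 + l) * (1 + l))"
    by (simp only: k_def of_real_mult of_real_add of_real_1)
  ultimately have k: "k * (1 + of_real l) = of_real l" by simp
  have eN: "ball_density N \<in> ball_span" "ball_density N' \<in> ball_span" using step ball_density_ball_span by auto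
  define g where "g = (\<lambda>x. (-1) * ball_density N' x + ball_density N x)"
  have g: "g \<in> ball_span" unfolding g_def by (rule ball_span_lincomb[OF eN(2,1)])
  have eig: "hier_Laplacian m C (ball_density N') x - hier_Laplacian m C (ball_density N) x = complex_of_real l * (ball_density N' x - ball_density N x)" for x
    unfolding l_def using step by (intro laplacian_eigen) auto
  have Lg: "hier_Laplacian m C g x = - (hier_Laplacian m C (ball_density N') x - hier_Laplacian m C (ball_density N) x)" for x
    unfolding g_def laplacian_lincomb[OF eN(2,1)] by simp
  show ?case
  proof (intro bexI[of _ "\<lambda>x. k * g x + d x"] allI)
    show "(\<lambda>x. k * g x + d x) \<in> ball_span" by (rule ball_span_lincomb[OF g d(1)])
    fix x
    let ?D = "ball_density N' x - ball_density N x"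
    have "k * g x + d x + hier_Laplacian m C (\<lambda>x. k * g x + d x) x
       = (d x + hier_Laplacian m C d x) + (k * g x + k * hier_Laplacian m C g x)"
      unfolding laplacian_lincomb[OF g d(1)] by simp
    also have "k * g x + k * hier_Laplacian m C g x = - (k * (1 + of_real l) * ?D)"
      unfolding Lg eig by (simp add: g_def algebra_simps)
    also have "\<dots> = - (hier_Laplacian m C (ball_density N') x - hier_Laplacian m C (ball_density N) x)" unfolding k eig ..
    finally show "k * g x + d x + hier_Laplacian m C (\<lambda>x. k * g x + d x) x = ball_density B x + hier_Laplacian m C (ball_density N) x"
      unfolding d(2) by simp
  qed
qed

section \<open>Core and self-adjointness\<close>

text \<open>Up to sign the error is m(B) / m(N) times the image of the indicator of N, whose q-th
  power is at most \<delta> powr q * m(N). For q = 1 the two factors m(N) cancel, so smallness has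
  to come from \<open>lam_parent N\<close> and not from the growth of m.\<close>

lemma range_dense_ball:
  assumes q: "1 \<le> q" and B: "B \<in> all_balls" and e: "0 < e"
  shows "\<exists>d\<in>ball_span. Lq_pow m q (\<lambda>x. indicator B x - (d x + hier_Laplacian m C d x)) < e"
proof -
  define \<delta> where "\<delta> = (e / (2 * mu B)) powr (1 / q)"
  have \<delta>: "0 < \<delta>" using e mu_pos[OF B] by (simp add: \<delta>_def)
  have \<delta>q: "\<delta> powr q * mu B = e / 2" using e mu_pos[OF B] q by (simp add: \<delta>_def powr_powr)
  \<comment> \<open>\<open>lam_parent N\<close> enters twice, through the diagonal term and through
    the increments above N, hence \<delta> / 2.\<close>
  obtain N where N: "N \<in> all_balls" "B \<subseteq> N" "lam_parent N < \<delta> / 2" using lam_parent_small[OF B, of "\<delta> / 2"] \<delta> by auto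
  obtain d0 where d0: "d0 \<in> ball_span" "\<And>x. d0 x + hier_Laplacian m C d0 x = ball_density B x + hier_Laplacian m C (ball_density N) x"
    using chain_resolvent[OF B N(1,2)] by blast
  define d where "d = (\<lambda>x. complex_of_real (mu B) * d0 x + 0)"
  have d: "d \<in> ball_span" unfolding d_def by (rule ball_span_lincomb[OF d0(1) ball_span_zero])
  have Ld: "hier_Laplacian m C d x = of_real (mu B) * hier_Laplacian m C d0 x" for x
    unfolding d_def laplacian_lincomb[OF d0(1) ball_span_zero] laplacian_zero by simp
  have "indicator B x - (d x + hier_Laplacian m C d x) = (- of_real (mu B / mu N)) * ball_image lam_id N x" for x
  proof -
    have "d x + hier_Laplacian m C d x = of_real (mu B) * (d0 x + hier_Laplacian m C d0 x)"
      unfolding Ld by (simp add: d_def distrib_left)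
    thus ?thesis unfolding d0(2) laplacian_ball_density[OF N(1)] using B
      by (simp add: ball_density_def distrib_left)
  qed
  hence "Lq_pow m q (\<lambda>x. indicator B x - (d x + hier_Laplacian m C d x)) = (mu B / mu N) powr q * Lq_pow m q (ball_image lam_id N)"
    using Lq_pow_cmult[of q m "- of_real (mu B / mu N)" "ball_image lam_id N"] q by (simp add: norm_divide)
  also have "\<dots> \<le> (mu B / mu N) * (\<delta> powr q * mu N)"
  proof (intro mult_mono)
    have "(mu B / mu N) powr q \<le> (mu B / mu N) powr 1"
      using mu_mono[OF N(2,1) B] mu_pos[OF N(1)] mu_pos[OF B] q by (intro powr_mono') auto
    thus "(mu B / mu N) powr q \<le> mu B / mu N" using mu_pos[OF N(1)] mu_pos[OF B] by simp
    have "(\<Sum>\<^sub>\<infinity>T\<in>up N. norm (incr lam_id T)) + norm (lam_id (lam_parent N) - 0) \<le> \<delta>"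
      using N(3) by (simp add: infsum_norm_incr_lam_id[OF N(1)] lam_id_def)
    from ball_image_Lq(2)[OF incr_summable_lam_id N(1) q this \<delta>]
    show "Lq_pow m q (ball_image lam_id N) \<le> \<delta> powr q * mu N" by simp
  qed auto
  also have "\<dots> = \<delta> powr q * mu B" using mu_pos[OF N(1)] by simp
  also have "\<dots> = e / 2" by (rule \<delta>q)
  also have "\<dots> < e" using e by simp
  finally show ?thesis using d by blast
qed

lemma range_Lq:
  assumes "1 \<le> q" "d \<in> ball_span" shows "(\<lambda>x. d x + hier_Laplacian m C d x) \<in> Lq m q"
  using assms LC_D(1,2)[OF ball_span_LC[OF assms]] by (intro Lq_add) auto

lemma range_dense:
  assumes q: "1 \<le> q" and g: "g \<in> Lq m q" and e: "0 < e"
  shows "\<exists>d\<in>ball_span. Lq_pow m q (\<lambda>x. g x - (d x + hier_Laplacian m C d x)) < e"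
proof -
  have q0: "0 \<le> q" using q by simp
  have span: "\<exists>d\<in>ball_span. Lq_pow m q (\<lambda>x. g x - (d x + hier_Laplacian m C d x)) < e" if "g \<in> ball_span" "0 < e" for g e
    using that
  proof (induction arbitrary: e rule: ball_span.induct)
    case ball_span_zero
    thus ?case using ball_span.ball_span_zero by (intro bexI[of _ "\<lambda>x. 0"]) (simp add: laplacian_zero)
  next
    case (ball_span_step g B c)
    define e' where "e' = e / (2 powr q * (norm c powr q + 1))"
    have p: "0 < 2 powr q * (norm c powr q + 1)" by (intro mult_pos_pos) (auto intro: add_nonneg_pos)
    have e': "0 < e'" using ball_span_step p by (simp add: e'_def)
    obtain d1 where d1: "d1 \<in> ball_span" "Lq_pow m q (\<lambda>x. indicator B x - (d1 x + hier_Laplacian m C d1 x)) < e'"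
      using range_dense_ball[OF q ball_span_step(2) e'] by blast
    obtain d2 where d2: "d2 \<in> ball_span" "Lq_pow m q (\<lambda>x. g x - (d2 x + hier_Laplacian m C d2 x)) < e'"
      using ball_span_step(3)[OF e'] by blast
    have iL: "indicator B \<in> Lq m q" using q ball_span_step(2) emeasure_ball_finite by (intro Lq_indicator) auto
    have L1: "(\<lambda>x. indicator B x - (d1 x + hier_Laplacian m C d1 x)) \<in> Lq m q"
      by (rule Lq_diff(1)[OF q0 iL range_Lq[OF q d1(1)]])
    have L2: "(\<lambda>x. g x - (d2 x + hier_Laplacian m C d2 x)) \<in> Lq m q"
      by (rule Lq_diff(1)[OF q0 ball_span_Lq[OF q ball_span_step(1)] range_Lq[OF q d2(1)]])
    let ?d = "\<lambda>x. c * d1 x + d2 x"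
    have "Lq_pow m q (\<lambda>x. (c * indicator B x + g x) - (?d x + hier_Laplacian m C ?d x))
      = Lq_pow m q (\<lambda>x. c * (indicator B x - (d1 x + hier_Laplacian m C d1 x)) + (g x - (d2 x + hier_Laplacian m C d2 x)))"
      unfolding laplacian_lincomb[OF d1(1) d2(1)] by (simp add: algebra_simps)
    also have "\<dots> \<le> 2 powr q * (Lq_pow m q (\<lambda>x. c * (indicator B x - (d1 x + hier_Laplacian m C d1 x)))
        + Lq_pow m q (\<lambda>x. g x - (d2 x + hier_Laplacian m C d2 x)))"
      by (rule Lq_add(2)[OF q0 Lq_cmult[OF q0 L1] L2])
    also have "\<dots> < 2 powr q * (norm c powr q * e' + e')"
      unfolding Lq_pow_cmult[OF q0] using d1(2) d2(2) by (intro mult_strict_left_mono add_le_less_mono mult_left_mono) auto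
    also have "\<dots> = e' * (2 powr q * (norm c powr q + 1))" by (simp add: algebra_simps)
    also have "\<dots> = e"
      unfolding e'_def by (simp only: times_divide_eq_left nonzero_mult_div_cancel_right less_imp_neq[OF p, symmetric] not_False_eq_True)
    finally show ?case by (rule bexI[of _ ?d]) (rule ball_span_lincomb[OF d1(1) d2(1)])
  qed
  define e' where "e' = e / (2 * 2 powr q)"
  have e': "0 < e'" using e by (simp add: e'_def)
  obtain s where s: "s \<in> ball_span" "Lq_pow m q (\<lambda>x. g x - s x) < e'"
    using ball_span_dense[OF q g] e' by (auto simp: approximable_def)
  obtain d where d: "d \<in> ball_span" "Lq_pow m q (\<lambda>x. s x - (d x + hier_Laplacian m C d x)) < e'"
    using span[OF s(1) e'] by blast
  have "Lq_pow m q (\<lambda>x. g x - (d x + hier_Laplacian m C d x))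
    \<le> 2 powr q * (Lq_pow m q (\<lambda>x. g x - s x) + Lq_pow m q (\<lambda>x. s x - (d x + hier_Laplacian m C d x)))"
    by (rule Lq_pow_triangle[OF q0 g ball_span_Lq[OF q s(1)] range_Lq[OF q d(1)]])
  also have "\<dots> < 2 powr q * (e' + e')" using s d by (intro mult_strict_left_mono) auto
  also have "\<dots> = e" by (simp add: e'_def field_simps)
  finally show ?thesis using d by blast
qed

text \<open>Approximate f + h by (1 + L) d. Applied to the difference, \<open>LC_bound\<close> makes
  d close to f, and subtraction then makes L d close to h.\<close>

lemma ball_span_core:
  assumes q: "1 \<le> q" and fh: "(f, h) \<in> LC q" and e: "0 < e"
  obtains d where "d \<in> ball_span" "Lq_pow m q (\<lambda>x. d x - f x) < e" "Lq_pow m q (\<lambda>x. hier_Laplacian m C d x - h x) < e"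
proof -
  have q0: "0 \<le> q" using q by simp
  note f = LC_D(1)[OF fh] and h = LC_D(2)[OF fh]
  define e' where "e' = e / (2 * 2 powr q)"
  have e': "0 < e'" using e by (simp add: e'_def)
  have "1 \<le> (2::real) powr q" using powr_mono[of 0 q 2] q by simp
  hence e'e: "e' < e" using e by (simp add: e'_def divide_less_eq)
  obtain d where d: "d \<in> ball_span" "Lq_pow m q (\<lambda>x. (f x + h x) - (d x + hier_Laplacian m C d x)) < e'"
    using range_dense[OF q Lq_add(1)[OF q0 f h] e'] by blast
  note dL = LC_D(1,2)[OF ball_span_LC[OF q d(1)]]
  have D: "(\<lambda>x. (-1) * d x + f x, \<lambda>x. (-1) * hier_Laplacian m C d x + h x) \<in> LC q"
    by (rule LC_lincomb[OF q ball_span_LC[OF q d(1)] fh])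
  have 1: "Lq_pow m q (\<lambda>x. f x - d x) < e'"
    using LC_bound[OF q D] d(2) by (simp add: algebra_simps)
  have "Lq_pow m q (\<lambda>x. ((f x + h x) - (d x + hier_Laplacian m C d x)) - (f x - d x))
     \<le> 2 powr q * (Lq_pow m q (\<lambda>x. (f x + h x) - (d x + hier_Laplacian m C d x)) + Lq_pow m q (\<lambda>x. f x - d x))"
    by (intro Lq_diff Lq_add q0 f h dL)
  also have "\<dots> < 2 powr q * (e' + e')" using 1 d(2) by (intro mult_strict_left_mono add_strict_mono) auto
  also have "\<dots> = e" by (simp add: e'_def field_simps)
  finally have "Lq_pow m q (\<lambda>x. h x - hier_Laplacian m C d x) < e" by (simp add: algebra_simps)
  moreover have "Lq_pow m q (\<lambda>x. f x - d x) < e" using 1 e'e by simp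
  ultimately show thesis using that[OF d(1)] by (simp only: Lq_pow_minus[of m q d] Lq_pow_minus[of m q "hier_Laplacian m C d"])
qed

text \<open>Identifies the operator prescribed on ball means with the closure from test functions;
  for q = 2 this is the operator that essential self-adjointness is about.\<close>

lemma closure_hier_graph:
  assumes q: "1 \<le> q" shows "Lq_closure m q (hier_graph m C) = LC q"
proof
  have "Lq_closure m q (hier_graph m C) \<subseteq> Lq_closure m q (LC q)"
    using hier_graph_LC[OF q] unfolding Lq_closure_def by blast
  thus "Lq_closure m q (hier_graph m C) \<subseteq> LC q" using LC_closed[OF q] by (rule order_trans)
  show "LC q \<subseteq> Lq_closure m q (hier_graph m C)"
  proof (rule subrelI)
    fix f h assume fh: "(f, h) \<in> LC q"
    have "\<exists>d. d \<in> ball_span \<and> Lq_pow m q (\<lambda>x. d x - f x) < inverse (real (Suc n))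
        \<and> Lq_pow m q (\<lambda>x. hier_Laplacian m C d x - h x) < inverse (real (Suc n))" for n
      by (rule ball_span_core[OF q fh, of "inverse (real (Suc n))"]) auto
    then obtain d where d: "\<And>n. d n \<in> ball_span" "\<And>n. Lq_pow m q (\<lambda>x. d n x - f x) < inverse (real (Suc n))"
      "\<And>n. Lq_pow m q (\<lambda>x. hier_Laplacian m C (d n) x - h x) < inverse (real (Suc n))" by metis
    have z: "(\<lambda>n. a n) \<longlonglongrightarrow> 0" if "\<And>n. 0 \<le> a n" "\<And>n. a n < inverse (real (Suc n))" for a :: "nat \<Rightarrow> real"
      by (rule tendsto_sandwich[OF _ _ tendsto_const LIMSEQ_inverse_real_of_nat])
        (auto simp del: of_nat_Suc intro!: always_eventually less_imp_le that)
    have "(\<lambda>n. Lq_pow m q (\<lambda>x. d n x - f x)) \<longlonglongrightarrow> 0" "(\<lambda>n. Lq_pow m q (\<lambda>x. hier_Laplacian m C (d n) x - h x)) \<longlonglongrightarrow> 0"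
      using d by (auto intro!: z)
    moreover have "(d n, hier_Laplacian m C (d n)) \<in> hier_graph m C \<inter> (Lq m q \<times> Lq m q)" for n
      using d(1)[of n] LC_D(1,2)[OF ball_span_LC[OF q d(1)[of n]]] by (auto simp: hier_graph_def test_functions_eq)
    ultimately show "(f, h) \<in> Lq_closure m q (hier_graph m C)"
      unfolding Lq_closure_def Lq_norm_tendsto_iff[OF q] mem_Collect_eq prod.case using LC_D(1,2)[OF fh]
      by (intro exI[of _ d] exI[of _ "\<lambda>n. hier_Laplacian m C (d n)"] conjI allI)
  qed
qed

section \<open>Self-adjointness in L^2\<close>

lemma cnj_measurable [measurable]:
  assumes "u \<in> borel_measurable m" shows "(\<lambda>x. cnj (u x)) \<in> borel_measurable m"
  by (rule measurable_compose[OF assms borel_measurable_continuous_onI]) (intro continuous_intros)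

text \<open>The weighted arithmetic-geometric inequality takes the place of Cauchy-Schwarz and fits
  the powers of norms used throughout.\<close>

lemma L2_pairing:
  assumes f: "f \<in> Lq m 2" and g: "g \<in> Lq m 2"
  shows "integrable m (\<lambda>x. f x * cnj (g x))"
    "0 < \<delta> \<Longrightarrow> norm (\<integral>x. f x * cnj (g x) \<partial>m) \<le> Lq_pow m 2 f / \<delta> + \<delta> * Lq_pow m 2 g"
proof -
  note [measurable] = Lq_measurable[OF f] Lq_measurable[OF g]
  have amgm: "norm (f x * cnj (g x)) \<le> norm (f x) powr 2 / \<delta> + \<delta> * norm (g x) powr 2" if "0 < \<delta>" for \<delta> x
  proof -
    have "0 \<le> (norm (f x) - \<delta> * norm (g x))\<^sup>2 / \<delta>" using that by simp
    also have "\<dots> = (norm (f x))\<^sup>2 / \<delta> + \<delta> * (norm (g x))\<^sup>2 - 2 * (norm (f x) * norm (g x))"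
      using that by (simp add: field_simps power2_eq_square)
    finally have "2 * (norm (f x) * norm (g x)) \<le> norm (f x) powr 2 / \<delta> + \<delta> * norm (g x) powr 2" by (simp add: powr_numeral)
    moreover have "0 \<le> norm (f x) * norm (g x)" by simp
    ultimately show ?thesis unfolding norm_mult complex_mod_cnj by linarith
  qed
  have i: "integrable m (\<lambda>x. norm (f x) powr 2 / \<delta> + \<delta> * norm (g x) powr 2)" for \<delta>
    using Lq_integrable[OF f] Lq_integrable[OF g] by simp
  show int: "integrable m (\<lambda>x. f x * cnj (g x))"
    by (rule Bochner_Integration.integrable_bound[OF i[of 1]]) (use amgm[of 1] in \<open>auto intro!: AE_I2 order_trans[OF _ abs_ge_self]\<close>)
  assume \<delta>: "0 < \<delta>"
  have "norm (\<integral>x. f x * cnj (g x) \<partial>m) \<le> (\<integral>x. norm (f x * cnj (g x)) \<partial>m)" by (rule integral_norm_bound)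
  also have "\<dots> \<le> (\<integral>x. norm (f x) powr 2 / \<delta> + \<delta> * norm (g x) powr 2 \<partial>m)"
    using amgm[OF \<delta>] by (intro integral_mono integrable_norm int i)
  also have "\<dots> = Lq_pow m 2 f / \<delta> + \<delta> * Lq_pow m 2 g"
    using Lq_integrable[OF f] Lq_integrable[OF g] by (simp add: Lq_pow_def)
  finally show "norm (\<integral>x. f x * cnj (g x) \<partial>m) \<le> Lq_pow m 2 f / \<delta> + \<delta> * Lq_pow m 2 g" .
qed

lemma Lq_cnj: "u \<in> Lq m q \<Longrightarrow> (\<lambda>x. cnj (u x)) \<in> Lq m q" by (auto simp: Lq_def)

lemma mean_cnj: "mean (\<lambda>x. cnj (u x)) B = cnj (mean u B)"
proof -
  have "(\<lambda>x. indicator B x * cnj (u x)) = (\<lambda>x. cnj (indicator B x * u x))" by (auto simp: indicator_def)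
  thus ?thesis by (simp only: mean_eq Bochner_Integration.integral_cnj complex_cnj_divide complex_cnj_complex_of_real)
qed

lemma multiplier_lam_id_cnj: "multiplier lam_id (\<lambda>T. cnj (p T)) B = cnj (multiplier lam_id p B)"
proof -
  have "(\<Sum>\<^sub>\<infinity>T\<in>up B. incr lam_id T * cnj (p T)) = (\<Sum>\<^sub>\<infinity>T\<in>up B. cnj (incr lam_id T * p T))"
    by (intro infsum_cong) (simp add: incr_def lam_id_def)
  thus ?thesis by (simp only: multiplier_def infsum_cnj) (simp add: lam_id_def)
qed

lemma ball_image_pairing_cnj:
  assumes "S \<in> all_balls" "u \<in> Lq m 2"
  shows "(\<integral>x. ball_image lam_id S x * cnj (u x) \<partial>m) = mu S * cnj (multiplier lam_id (mean u) S)"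
proof -
  have "(\<integral>x. ball_image lam_id S x * cnj (u x) \<partial>m) = mu S * multiplier lam_id (mean (\<lambda>x. cnj (u x))) S"
    by (rule ball_image_pairing[OF incr_summable_lam_id assms(1) _ Lq_cnj[OF assms(2)]]) simp
  also have "multiplier lam_id (mean (\<lambda>x. cnj (u x))) S = multiplier lam_id (\<lambda>T. cnj (mean u T)) S"
    by (rule multiplier_cong[OF assms(1)]) (auto simp: mean_cnj)
  finally show ?thesis by (simp only: multiplier_lam_id_cnj)
qed

lemma indicator_pairing_cnj:
  "S \<in> all_balls \<Longrightarrow> (\<integral>x. indicator S x * cnj (v x) \<partial>m) = mu S * cnj (mean v S)"
  using mean_times_mu[of S "\<lambda>x. cnj (v x)"] by (simp add: mean_cnj mult.commute)

lemma ball_span_symmetric: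
  assumes uv: "(u, v) \<in> LC 2" and d: "d \<in> ball_span"
  shows "(\<integral>x. hier_Laplacian m C d x * cnj (u x) \<partial>m) = (\<integral>x. d x * cnj (v x) \<partial>m)"
  using d
proof (induction rule: ball_span.induct)
  case ball_span_zero thus ?case by (simp add: laplacian_zero)
next
  case (ball_span_step d B c)
  have q: "(1::real) \<le> 2" by simp
  note u = LC_D(1)[OF uv] and v = LC_D(2)[OF uv]
  note bL = LC_D(1,2)[OF ball_image_LC[OF q ball_span_step(2)]] and dL = LC_D(1,2)[OF ball_span_LC[OF q ball_span_step(1)]]
  note i = L2_pairing(1)[OF bL(2) u] L2_pairing(1)[OF dL(2) u] L2_pairing(1)[OF bL(1) v] L2_pairing(1)[OF dL(1) v]
  have "(\<integral>x. hier_Laplacian m C (\<lambda>x. c * indicator B x + d x) x * cnj (u x) \<partial>m)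
     = (\<integral>x. c * (ball_image lam_id B x * cnj (u x)) + hier_Laplacian m C d x * cnj (u x) \<partial>m)"
    unfolding ball_span_laplacian(2)[OF ball_span_step(1,2)] by (simp add: algebra_simps)
  also have "\<dots> = c * (\<integral>x. ball_image lam_id B x * cnj (u x) \<partial>m) + (\<integral>x. d x * cnj (v x) \<partial>m)"
    using i ball_span_step(3) by simp
  also have "(\<integral>x. ball_image lam_id B x * cnj (u x) \<partial>m) = (\<integral>x. indicator B x * cnj (v x) \<partial>m)"
    unfolding ball_image_pairing_cnj[OF ball_span_step(2) u] indicator_pairing_cnj[OF ball_span_step(2)]
    using LC_D(3)[OF uv ball_span_step(2)] by simp
  also have "c * (\<integral>x. indicator B x * cnj (v x) \<partial>m) + (\<integral>x. d x * cnj (v x) \<partial>m)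
      = (\<integral>x. c * (indicator B x * cnj (v x)) + d x * cnj (v x) \<partial>m)"
    using i by simp
  finally show ?case by (simp add: algebra_simps)
qed

lemma LC_symmetric:
  assumes fg: "(f, g) \<in> LC 2" and uv: "(u, v) \<in> LC 2"
  shows "(\<integral>x. g x * cnj (u x) \<partial>m) = (\<integral>x. f x * cnj (v x) \<partial>m)"
proof (rule ccontr)
  have q: "(1::real) \<le> 2" by simp
  note f = LC_D(1)[OF fg] and g = LC_D(2)[OF fg] and u = LC_D(1)[OF uv] and v = LC_D(2)[OF uv]
  define D where "D = norm ((\<integral>x. g x * cnj (u x) \<partial>m) - (\<integral>x. f x * cnj (v x) \<partial>m))"
  assume "(\<integral>x. g x * cnj (u x) \<partial>m) \<noteq> (\<integral>x. f x * cnj (v x) \<partial>m)"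
  hence D: "0 < D" by (simp add: D_def)
  define A where "A = Lq_pow m 2 u + Lq_pow m 2 v"
  have A: "0 \<le> A" by (simp add: A_def)
  \<comment> \<open>With these \<delta> and e the final estimate reads D <= 2 * (e / \<delta>) +
    \<delta> * A <= D / 4 + D / 2; the summand 1 keeps the denominator positive.\<close>
  define \<delta> where "\<delta> = D / (2 * (A + 1))"
  have \<delta>: "0 < \<delta>" using D A by (simp add: \<delta>_def)
  define e where "e = \<delta> * D / 8"
  have e: "0 < e" using \<delta> D by (simp add: e_def)
  obtain d where d: "d \<in> ball_span" "Lq_pow m 2 (\<lambda>x. d x - f x) < e" "Lq_pow m 2 (\<lambda>x. hier_Laplacian m C d x - g x) < e"
    using ball_span_core[OF q fg e] by metis
  note dL = LC_D(1,2)[OF ball_span_LC[OF q d(1)]]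
  have L: "(\<lambda>x. d x - f x) \<in> Lq m 2" "(\<lambda>x. hier_Laplacian m C d x - g x) \<in> Lq m 2"
    using dL f g by (auto intro!: Lq_diff)
  have 1: "(\<integral>x. (hier_Laplacian m C d x - g x) * cnj (u x) \<partial>m)
      = (\<integral>x. hier_Laplacian m C d x * cnj (u x) \<partial>m) - (\<integral>x. g x * cnj (u x) \<partial>m)"
    unfolding left_diff_distrib by (rule Bochner_Integration.integral_diff[OF L2_pairing(1)[OF dL(2) u] L2_pairing(1)[OF g u]])
  have 2: "(\<integral>x. (d x - f x) * cnj (v x) \<partial>m) = (\<integral>x. d x * cnj (v x) \<partial>m) - (\<integral>x. f x * cnj (v x) \<partial>m)"
    unfolding left_diff_distrib by (rule Bochner_Integration.integral_diff[OF L2_pairing(1)[OF dL(1) v] L2_pairing(1)[OF f v]])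
  have "(\<integral>x. g x * cnj (u x) \<partial>m) - (\<integral>x. f x * cnj (v x) \<partial>m)
     = (\<integral>x. (d x - f x) * cnj (v x) \<partial>m) - (\<integral>x. (hier_Laplacian m C d x - g x) * cnj (u x) \<partial>m)"
    unfolding 1 2 ball_span_symmetric[OF uv d(1)] by simp
  hence "D \<le> norm (\<integral>x. (d x - f x) * cnj (v x) \<partial>m) + norm (\<integral>x. (hier_Laplacian m C d x - g x) * cnj (u x) \<partial>m)"
    unfolding D_def by (simp only: norm_triangle_ineq4)
  also have "\<dots> \<le> (Lq_pow m 2 (\<lambda>x. d x - f x) / \<delta> + \<delta> * Lq_pow m 2 v) + (Lq_pow m 2 (\<lambda>x. hier_Laplacian m C d x - g x) / \<delta> + \<delta> * Lq_pow m 2 u)"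
    by (intro add_mono L2_pairing(2) L u v \<delta>)
  also have "\<dots> \<le> (e / \<delta> + \<delta> * Lq_pow m 2 v) + (e / \<delta> + \<delta> * Lq_pow m 2 u)"
    using d \<delta> by (intro add_mono divide_right_mono order_refl) auto
  also have "\<dots> = 2 * (e / \<delta>) + \<delta> * A" by (simp add: A_def algebra_simps)
  also have "e / \<delta> = D / 8" using \<delta> by (simp add: e_def)
  also have "\<delta> * A \<le> \<delta> * (A + 1)" using \<delta> by (intro mult_left_mono) auto
  also have "\<delta> * (A + 1) = D / 2"
  proof -
    have "(D / (2 * a)) * a = D / 2" if "a \<noteq> 0" for a :: real using that by simp
    from this[of "A + 1"] A have "(D / (2 * (A + 1))) * (A + 1) = D / 2" by linarith
    thus ?thesis by (simp only: \<delta>_def)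
  qed
  finally show False using D by simp
qed

text \<open>Tested on indicators of balls, the adjoint relation is the condition on means that
  defines \<open>LC\<close>; so the adjoint lies in \<open>LC 2\<close>, and symmetry gives the
  converse.\<close>

lemma LC_self_adjoint: "self_adjoint m (LC 2)"
  unfolding self_adjoint_def
proof (intro conjI)
  have q: "(1::real) \<le> 2" by simp
  show "Lq_operator m 2 (LC 2)" by (rule LC_operator[OF q])
  show "densely_defined m 2 (LC 2)"
    unfolding densely_defined_def
  proof (intro ballI allI impI)
    fix f and e :: real assume f: "f \<in> Lq m 2" and e: "0 < e"
    obtain d where d: "d \<in> ball_span" "Lq_pow m 2 (\<lambda>x. f x - d x) < e powr 2"
    proof -
      have "0 < e powr 2" using e by simp
      thus thesis using ball_span_dense[OF q f] that unfolding approximable_def by blast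
    qed
    have "Lq_norm m 2 (\<lambda>x. f x - d x) < (e powr 2) powr (1 / 2)"
      unfolding Lq_norm_eq using d(2) by (intro powr_less_mono2) auto
    also have "\<dots> = e" using e by (simp only: powr_powr) simp
    finally show "\<exists>u\<in>Domain (LC 2). Lq_norm m 2 (\<lambda>x. f x - u x) < e"
      using ball_span_LC[OF q d(1)] by blast
  qed
  show "L2_adjoint m (LC 2) = LC 2"
  proof
    show "L2_adjoint m (LC 2) \<subseteq> LC 2"
    proof (rule subrelI)
      fix u v assume "(u, v) \<in> L2_adjoint m (LC 2)"
      hence u: "u \<in> Lq m 2" and v: "v \<in> Lq m 2"
        and adj: "\<And>f g. (f, g) \<in> LC 2 \<Longrightarrow> (\<integral>x. g x * cnj (u x) \<partial>m) = (\<integral>x. f x * cnj (v x) \<partial>m)"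
        by (auto simp: L2_adjoint_def)
      have "mean v B = multiplier lam_id (mean u) B" if B: "B \<in> all_balls" for B
        using adj[OF ball_image_LC[OF q B]] B
        unfolding ball_image_pairing_cnj[OF B u] indicator_pairing_cnj[OF B] by simp
      thus "(u, v) \<in> LC 2" using u v by (simp add: LC_def)
    qed
    show "LC 2 \<subseteq> L2_adjoint m (LC 2)"
    proof (rule subrelI)
      fix u v assume uv: "(u, v) \<in> LC 2"
      show "(u, v) \<in> L2_adjoint m (LC 2)"
        unfolding L2_adjoint_def using LC_D(1,2)[OF uv] LC_symmetric[OF _ uv] by auto
    qed
  qed
qed

lemma heat_is_heat_semigroup: "heat_semigroup m C heat"
  using LC_self_adjoint heat_C0[of 2] heat_generator[of 2] closure_hier_graph[of 2]
  by (simp add: heat_semigroup_def)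

text \<open>The same map \<open>heat\<close> represents the semigroup in L^2 and in L^q, so
  agreement on the intersection is an equality of functions.\<close>

lemma LC_is_Laplacian:
  assumes q: "1 \<le> q" shows "is_Lq_Laplacian m C q (LC q)"
  unfolding is_Lq_Laplacian_def
  using heat_is_heat_semigroup heat_C0_contraction[OF q] heat_generator[OF q]
  by (intro exI[of _ heat] conjI) auto

end

theorem proposition3p5:
  fixes m :: "'a::metric_space measure"
    and C :: "'a set \<Rightarrow> real"
  assumes "ultrametric_space TYPE('a)"
    and "locally compact (UNIV :: 'a set)"
    and "separable_space (euclidean :: 'a topology)"
    and "proper_space TYPE('a)"
    and "radon_measure m"
    and "\<forall>B\<in>all_balls. diameter B > 0 \<longrightarrow> emeasure m B > 0"
    and "\<forall>x. emeasure m {x} = 0 \<longleftrightarrow> x islimpt UNIV"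
    and "choice_function C"
  shows "\<exists>LC :: real \<Rightarrow> 'a graph. \<forall>q\<ge>1.
     is_Lq_Laplacian m C q (LC q) \<and>
     closed_operator m q (LC q) \<and>
     hier_graph m C \<subseteq> LC q \<and>
     (\<exists>T. markov_semigroup m q T \<and> generator m q T = neg_op (LC q)) \<and>
     spectrum m q (LC q) = spectrum m 2 (LC 2) \<and>
     spectrum m 2 (LC 2) = complex_of_real ` (closure (lam C ` ns_balls) \<union> {0})"
proof -
  interpret hierarchical m C
    using assms by unfold_locales (auto simp: ultrametric_space_def proper_space_def)
  show ?thesis
  proof (intro exI[of _ LC] allI impI conjI)
    fix q :: real assume q: "1 \<le> q"
    show "is_Lq_Laplacian m C q (LC q)" by (rule LC_is_Laplacian[OF q])
    show "closed_operator m q (LC q)"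
      using LC_operator[OF q] LC_closed[OF q] by (simp add: closed_operator_def)
    show "hier_graph m C \<subseteq> LC q" by (rule hier_graph_LC[OF q])
    show "\<exists>T. markov_semigroup m q T \<and> generator m q T = neg_op (LC q)"
      using heat_markov[OF q] heat_generator[OF q] by blast
    show "spectrum m q (LC q) = spectrum m 2 (LC 2)"
      using spectrum_LC[OF q] spectrum_LC[of 2] by simp
    show "spectrum m 2 (LC 2) = complex_of_real ` (closure (lam C ` ns_balls) \<union> {0})"
      by (rule spectrum_LC) simp
  qed
qed

end
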